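(* Let $T>0$, let $\Omega\subset\mathbb{R}^d$ be a bounded open domain with smooth boundary, let $p\ge0$ and $u\in L^2((0,T);H^p(\Omega))$. For $n\ge0$ let $u_n(\mathbf{x})=\langle u(\mathbf{x},\cdot),\Psi_n\rangle_{L^2_{e^{-2t}}(0,T)}=\int_0^Te^{-2t}u(\mathbf{x},t)\Psi_n(t)\,dt$. (a) If the series $\sum_{n=0}^\infty u_n(\mathbf{x})\Psi_n''(t)$ converges in $L^2((0,T);H^p(\Omega))$, then the generalized (distributional) derivative $u_{tt}$ exists in $L^2((0,T);H^p(\Omega))$ and coincides with the sum of this series. (b) If $u\in H^k((0,T);H^p(\Omega))$ with $k\ge5$, then the series $\sum_{n=0}^\infty u_n(\mathbf{x})\Psi_n''(t)$ converges in $L^2((0,T);H^p(\Omega))$.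
   Context: $P_n(x)=\frac{1}{2^n n!}\frac{d^n}{dx^n}(x^2-1)^n$ is the Legendre polynomial of degree $n$; $Q_n(t)=\sqrt{\tfrac{2n+1}{T}}P_n(\tfrac{2t}{T}-1)$; $\Psi_n(t)=e^tQ_n(t)$. The family $\{\Psi_n\}_{n\ge0}$ is an orthonormal basis of the weighted space $L^2_{e^{-2t}}(0,T)$ with inner product $\langle u,v\rangle=\int_0^Te^{-2t}uv\,dt$. *)

theory Defs
  imports "HOL-Analysis.Analysis" "HOL-Computational_Algebra.Polynomial"
begin

definition legendre :: "nat \<Rightarrow> real poly" where
  "legendre n = smult (1 / (2 ^ n * fact n)) ((pderiv ^^ n) ([:-1, 0, 1:] ^ n))"

definition Qn :: "real \<Rightarrow> nat \<Rightarrow> real \<Rightarrow> real" where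
  "Qn T n t = sqrt ((2 * real n + 1) / T) * poly (legendre n) (2 * t / T - 1)"

definition Psi :: "real \<Rightarrow> nat \<Rightarrow> real \<Rightarrow> real" where
  "Psi T n t = exp t * Qn T n t"

definition Psi2 :: "real \<Rightarrow> nat \<Rightarrow> real \<Rightarrow> real" where
  "Psi2 T n = deriv (deriv (Psi T n))"

definition ucoef :: "real \<Rightarrow> ('x \<Rightarrow> real \<Rightarrow> real) \<Rightarrow> nat \<Rightarrow> 'x \<Rightarrow> real" where
  "ucoef T u n x = (LINT t:{0<..<T}|lborel. exp (-2 * t) * u x t * Psi T n t)"

definition psum2 :: "real \<Rightarrow> ('x \<Rightarrow> real \<Rightarrow> real) \<Rightarrow> nat \<Rightarrow> 'x \<Rightarrow> real \<Rightarrow> real" where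
  "psum2 T u N x t = (\<Sum>n<N. ucoef T u n x * Psi2 T n t)"

definition pdx :: "'d::finite \<Rightarrow> (real^'d \<Rightarrow> real) \<Rightarrow> real^'d \<Rightarrow> real" where
  "pdx i f x = deriv (\<lambda>s. f (x + s *\<^sub>R axis i 1)) 0"

fun ipd :: "'d::finite list \<Rightarrow> (real^'d \<Rightarrow> real) \<Rightarrow> real^'d \<Rightarrow> real" where
  "ipd [] f = f"
| "ipd (i # is) f = pdx i (ipd is f)"

definition smooth_fun :: "(real^'d::finite \<Rightarrow> real) \<Rightarrow> bool" where
  "smooth_fun f \<longleftrightarrow> (\<forall>is x. ipd is f differentiable (at x))"

definition test_fun :: "(real^'d::finite) set \<Rightarrow> (real^'d \<Rightarrow> real) \<Rightarrow> bool" where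
  "test_fun U \<phi> \<longleftrightarrow> smooth_fun \<phi> \<and> compact (closure {x. \<phi> x \<noteq> 0})
      \<and> closure {x. \<phi> x \<noteq> 0} \<subseteq> U"

text \<open>C-infinity boundary: locally, after a rigid rotation, the domain is the
  subgraph of a smooth function of the remaining coordinates.\<close>
definition smooth_boundary :: "(real^'d::finite) set \<Rightarrow> bool" where
  "smooth_boundary \<Omega> \<longleftrightarrow>
     (\<forall>z\<in>frontier \<Omega>. \<exists>r>0. \<exists>(R::real^'d \<Rightarrow> real^'d) k \<gamma>. orthogonal_transformation R \<and> smooth_fun \<gamma>
        \<and> (\<forall>x s. \<gamma> (x + s *\<^sub>R axis k 1) = \<gamma> x)
        \<and> \<Omega> \<inter> ball z r = {x \<in> ball z r. (R x) $ k < \<gamma> (R x)})"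

definition weak_xderiv :: "(real^'d::finite) set \<Rightarrow> 'd list \<Rightarrow> (real^'d \<Rightarrow> real) \<Rightarrow> (real^'d \<Rightarrow> real) \<Rightarrow> bool" where
  "weak_xderiv \<Omega> is f g \<longleftrightarrow>
     (\<forall>\<phi>. test_fun \<Omega> \<phi> \<longrightarrow>
        set_integrable lborel \<Omega> (\<lambda>x. f x * ipd is \<phi> x) \<and>
        set_integrable lborel \<Omega> (\<lambda>x. g x * \<phi> x) \<and>
        (LINT x:\<Omega>|lborel. f x * ipd is \<phi> x) = (-1) ^ length is * (LINT x:\<Omega>|lborel. g x * \<phi> x))"

text \<open>H^p with p = m + s, m integer, 0 <= s < 1: Sobolev-Slobodeckij norm.\<close>
definition sob_m :: "real \<Rightarrow> nat" where "sob_m p = nat \<lfloor>p\<rfloor>"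
definition sob_s :: "real \<Rightarrow> real" where "sob_s p = p - real (sob_m p)"

definition sqL2 :: "real \<Rightarrow> (real^'d::finite) set \<Rightarrow> (real^'d \<Rightarrow> real \<Rightarrow> real) \<Rightarrow> ennreal" where
  "sqL2 T \<Omega> f = (\<integral>\<^sup>+ t. (\<integral>\<^sup>+ x. ennreal ((f x t)\<^sup>2) * indicator \<Omega> x \<partial>lborel)
                       * indicator {0<..<T} t \<partial>lborel)"

definition slob :: "real \<Rightarrow> real \<Rightarrow> (real^'d::finite) set \<Rightarrow> (real^'d \<Rightarrow> real \<Rightarrow> real) \<Rightarrow> ennreal" where
  "slob s T \<Omega> f = (\<integral>\<^sup>+ t. (\<integral>\<^sup>+ x. (\<integral>\<^sup>+ y.
       ennreal ((f x t - f y t)\<^sup>2 / dist x y powr (real CARD('d) + 2 * s)) * indicator \<Omega> y \<partial>lborel)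
       * indicator \<Omega> x \<partial>lborel) * indicator {0<..<T} t \<partial>lborel)"

definition L2H_fam :: "real \<Rightarrow> (real^'d::finite) set \<Rightarrow> real \<Rightarrow> (real^'d \<Rightarrow> real \<Rightarrow> real)
     \<Rightarrow> ('d list \<Rightarrow> real^'d \<Rightarrow> real \<Rightarrow> real) \<Rightarrow> bool" where
  "L2H_fam T \<Omega> p u Du \<longleftrightarrow> Du [] = u \<and>
     (\<forall>is. length is \<le> sob_m p \<longrightarrow>
        (\<lambda>(x, t). Du is x t) \<in> borel_measurable (lborel \<Otimes>\<^sub>M lborel) \<and>
        (AE t in lborel. t \<in> {0<..<T} \<longrightarrow> weak_xderiv \<Omega> is (\<lambda>x. u x t) (\<lambda>x. Du is x t)))"

definition L2H_sq :: "real \<Rightarrow> (real^'d::finite) set \<Rightarrow> real \<Rightarrow> ('d list \<Rightarrow> real^'d \<Rightarrow> real \<Rightarrow> real) \<Rightarrow> ennreal" where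
  "L2H_sq T \<Omega> p Du =
     (\<Sum>is\<in>{is. length is \<le> sob_m p}. sqL2 T \<Omega> (Du is)) +
     (if sob_s p > 0 then (\<Sum>is\<in>{is. length is = sob_m p}. slob (sob_s p) T \<Omega> (Du is)) else 0)"

definition L2H :: "real \<Rightarrow> (real^'d::finite) set \<Rightarrow> real \<Rightarrow> (real^'d \<Rightarrow> real \<Rightarrow> real) \<Rightarrow> bool" where
  "L2H T \<Omega> p u \<longleftrightarrow> (\<exists>Du. L2H_fam T \<Omega> p u Du \<and> L2H_sq T \<Omega> p Du < \<infinity>)"

definition L2H_conv :: "real \<Rightarrow> (real^'d::finite) set \<Rightarrow> real \<Rightarrow> (nat \<Rightarrow> real^'d \<Rightarrow> real \<Rightarrow> real)
     \<Rightarrow> (real^'d \<Rightarrow> real \<Rightarrow> real) \<Rightarrow> bool" where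
  "L2H_conv T \<Omega> p S w \<longleftrightarrow> (\<exists>DS Dw.
      (\<forall>N. L2H_fam T \<Omega> p (S N) (DS N) \<and> L2H_sq T \<Omega> p (DS N) < \<infinity>) \<and>
      L2H_fam T \<Omega> p w Dw \<and> L2H_sq T \<Omega> p Dw < \<infinity> \<and>
      ((\<lambda>N. L2H_sq T \<Omega> p (\<lambda>is x t. DS N is x t - Dw is x t)) \<longlonglongrightarrow> 0))"

definition test_t :: "real \<Rightarrow> (real \<Rightarrow> real) \<Rightarrow> bool" where
  "test_t T \<phi> \<longleftrightarrow> (\<forall>j x. (deriv ^^ j) \<phi> differentiable (at x)) \<and>
     compact (closure {t. \<phi> t \<noteq> 0}) \<and> closure {t. \<phi> t \<noteq> 0} \<subseteq> {0<..<T}"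

text \<open>v is the j-th generalized time derivative of u as an H^p(\<Omega>)-valued function:
  int u phi^(j) dt = (-1)^j int v phi dt in H^p(\<Omega>), i.e. for a.e. x in \<Omega>.\<close>
definition weak_tderiv :: "real \<Rightarrow> (real^'d::finite) set \<Rightarrow> nat \<Rightarrow> (real^'d \<Rightarrow> real \<Rightarrow> real)
     \<Rightarrow> (real^'d \<Rightarrow> real \<Rightarrow> real) \<Rightarrow> bool" where
  "weak_tderiv T \<Omega> j u v \<longleftrightarrow> (\<forall>\<phi>. test_t T \<phi> \<longrightarrow>
     (AE x in lborel. x \<in> \<Omega> \<longrightarrow>
        (LINT t:{0<..<T}|lborel. u x t * (deriv ^^ j) \<phi> t) =
        (-1) ^ j * (LINT t:{0<..<T}|lborel. v x t * \<phi> t)))"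

definition HkH :: "real \<Rightarrow> (real^'d::finite) set \<Rightarrow> real \<Rightarrow> nat \<Rightarrow> (real^'d \<Rightarrow> real \<Rightarrow> real) \<Rightarrow> bool" where
  "HkH T \<Omega> p k u \<longleftrightarrow> (\<exists>v. v 0 = u \<and>
     (\<forall>j\<le>k. L2H T \<Omega> p (v j) \<and> weak_tderiv T \<Omega> j u (v j)))"

end

theory Submission
  imports Defs
begin

text \<open>
  After the substitution \<open>x = 2 t / T - 1\<close> everything rests on the Sturm--Liouville form
  \<open>D (\<rho> ^ (k+1) * D ^ (k+1) q) = - (n - k) (n + k + 1) \<rho> ^ k * D ^ k q\<close> of the Legendre equation, where
  \<open>\<rho> t = t (T - t)\<close>.

  (a) For a test function \<open>\<phi>\<close>, integration by parts and Parseval's identity (polynomials are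
  uniformly dense) show that the partial sums, paired with \<open>\<phi>\<close>, converge to the integral of
  \<open>u \<phi>''\<close> for almost every \<open>x\<close>; convergence of the series in \<open>L\<^sup>2\<close> and Fatou's lemma identify
  this limit with the pairing of \<open>w\<close> and \<open>\<phi>\<close>.

  (b) Since \<open>\<rho>\<close> vanishes at both endpoints, weak derivatives may be tested against
  \<open>exp (- t) \<rho> g\<close> for polynomials \<open>g\<close>. Five integrations by parts write the \<open>n\<close>-th coefficient
  as \<open>n powr -5\<close> times a coefficient with respect to an orthonormal system of weighted derivatives,
  so that by Bessel's inequality the weighted sum of \<open>(n + 1) ^ 10 * (u\<^sub>n)\<^sup>2\<close> is finite. As
  \<open>\<Psi>\<^sub>n''\<close> has \<open>L\<^sup>2\<close> norm of order \<open>n powr (7/2)\<close>, the series converges by the Cauchy--Schwarz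
  inequality. The argument applies verbatim to every Hilbert seminorm in the definition of
  \<open>H\<^sup>p\<close>. As spatial derivatives of \<open>u\<^sub>n\<close> we take the same kernel integrals of the spatial
  derivatives of \<open>u\<close> and its time derivatives, so uniqueness of weak derivatives in space is
  not needed.
\<close>

section \<open>Shifted Legendre polynomials\<close>

text \<open>The threshold k >= 5 is an exponent count. Five integrations by parts gain (n+1)^10 for
  the squared coefficients; Cauchy-Schwarz on the tails of the series spends (n+1)^2 and the squared
  norm of \<open>Psi2 T n\<close> costs (n+1)^7. The sum 9 fits below 10, but not below the 8 that
  four steps would gain. Nothing is known about u at t = 0 and t = T, so plain integration by parts
  would leave endpoint terms. The powers of the weight in the Sturm-Liouville form remove them, but
  the result is not compactly supported in time, as \<open>weak_tderiv\<close> demands of test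
  functions. A cutoff repairs this: its derivative is of size m near the endpoints, yet its product
  with a simple zero of the weight is bounded uniformly in m, and dominated convergence applies. The
  exceptional null set in \<open>weak_tderiv\<close> depends on the test function. For each n, part
  (b) uses only countably many cutoffs, so one null set serves all steps and all m. The Slobodeckij
  seminorm is an L2 norm over pairs of points of a weighted difference, and the coefficients of such
  a difference are again kernel integrals; hence one argument covers all parts of the norm.\<close>

lemma pderiv_funpow_pcompose_linear:
  fixes p :: "real poly"
  shows "(pderiv ^^ k) (pcompose p [:a, b:]) = smult (b ^ k) (pcompose ((pderiv ^^ k) p) [:a, b:])"
proof (induction k)
  case (Suc k)
  then show ?case
    by (simp add: pderiv_smult pderiv_pcompose pderiv_pCons mult.commute)
qed simp

lemma pcompose_power: "pcompose (p ^ n) q = pcompose p q ^ n" for p q :: "real poly"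
  by (induction n) (simp_all add: pcompose_mult pcompose_1)

lemma pderiv_funpow_smult: "(pderiv ^^ k) (smult c p) = smult (c::real) ((pderiv ^^ k) p)"
  by (induction k) (simp_all add: pderiv_smult)

text \<open>The weight \<open>\<rho>\<close>; up to the factor -4 / T^2 it is x^2 - 1 after x = 2 t
  / T - 1.\<close>

definition wpoly :: "real \<Rightarrow> real poly" where "wpoly T = [:0, T, -1:]"

definition sleg :: "real \<Rightarrow> nat \<Rightarrow> real poly" where
  "sleg T n = pcompose (legendre n) [:-1, 2 / T:]"

lemma poly_wpoly: "poly (wpoly T) t = t * (T - t)"
  by (simp add: wpoly_def algebra_simps)

lemma pderiv_wpoly: "pderiv (wpoly T) = [:T, -2:]"
  by (simp add: wpoly_def pderiv_pCons)

lemma poly_pderiv_wpoly: "poly (pderiv (wpoly T)) t = T - 2 * t"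
  by (simp add: pderiv_wpoly)

lemma poly_pderiv2_wpoly: "poly (pderiv (pderiv (wpoly T))) t = - 2"
  by (simp add: pderiv_wpoly pderiv_pCons)

text \<open>Rodrigues' formula after the substitution: x^2 - 1 becomes -4 / T^2 times
  \<open>wpoly T\<close>, and each of the n derivatives contributes T / 2, so the scalars collapse
  to (-1)^n / (T^n n!).\<close>

lemma sleg_rodrigues:
  assumes "T > 0"
  shows "sleg T n = smult ((-1) ^ n / (T ^ n * fact n)) ((pderiv ^^ n) (wpoly T ^ n))"
proof -
  let ?l = "[:-1, 2 / T:]"
  have 1: "pcompose [:-1, 0, 1:] ?l = smult (-4 / T^2) (wpoly T)"
    using assms by (simp add: wpoly_def pcompose_pCons field_simps power2_eq_square)
  have "(pderiv ^^ n) (smult ((-4 / T^2) ^ n) (wpoly T ^ n)) 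
      = (pderiv ^^ n) (pcompose ([:-1, 0, 1:] ^ n) ?l)"
    unfolding pcompose_power 1 by (simp only: smult_power)
  also have "\<dots> = smult ((2/T)^n) (pcompose ((pderiv ^^ n) ([:-1, 0, 1:] ^ n)) ?l)"
    by (rule pderiv_funpow_pcompose_linear)
  finally have "smult ((T/2)^n) ((pderiv ^^ n) (smult ((-4 / T^2) ^ n) (wpoly T ^ n))) =
      smult ((T/2)^n) (smult ((2/T)^n) (pcompose ((pderiv ^^ n) ([:-1, 0, 1:] ^ n)) ?l))"
    by simp
  moreover have "(T/2)^n * (2/T)^n = 1"
    using assms by (simp flip: power_mult_distrib)
  ultimately have 2: "pcompose ((pderiv ^^ n) ([:-1, 0, 1:] ^ n)) ?l
      = smult ((T/2)^n * (-4 / T^2) ^ n) ((pderiv ^^ n) (wpoly T ^ n))"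
    by (simp only: pderiv_funpow_smult smult_smult) simp
  have "(T/2)^n * (-4 / T^2) ^ n = ((T/2) * (-4 / T^2)) ^ n"
    by (simp only: power_mult_distrib)
  also have "(T/2) * (-4 / T^2) = - (2 / T)"
    using assms by (simp add: power2_eq_square)
  finally show ?thesis
    unfolding sleg_def legendre_def pcompose_smult 2 
    using assms by (simp add: power_divide power_minus[of "2/T"] mult.commute)
qed

text \<open>The power y = \<open>wpoly T ^ n\<close> satisfies rho y' = n rho' y; this identity is
  differentiated j + 1 times, using rho'' = -2.\<close>

lemma pderiv_funpow_ode:
  "wpoly T * (pderiv ^^ (j+2)) (wpoly T ^ n) + smult (real j + 1 - real n) (pderiv (wpoly T) * (pderiv ^^ (j+1)) (wpoly T ^ n))
    + smult ((real j + 1) * (2 * real n - real j)) ((pderiv ^^ j) (wpoly T ^ n)) = 0"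
proof (induction j)
  case 0
  have "wpoly T * pderiv (wpoly T ^ n) = smult (real n) (pderiv (wpoly T) * wpoly T ^ n)"
    by (cases n) (simp_all add: pderiv_power_Suc mult_ac del: power_Suc, simp add: mult_ac)
  then have "pderiv (wpoly T * pderiv (wpoly T ^ n)) = pderiv (smult (real n) (pderiv (wpoly T) * wpoly T ^ n))"
    by simp
  then have "poly (pderiv (wpoly T * pderiv (wpoly T ^ n))) x = poly (pderiv (smult (real n) (pderiv (wpoly T) * wpoly T ^ n))) x" for x
    by simp
  then show ?case
    by (simp add: poly_eq_poly_eq_iff[symmetric] fun_eq_iff pderiv_mult pderiv_smult poly_pderiv_wpoly poly_pderiv2_wpoly poly_wpoly)
       (simp add: algebra_simps)
next
  case (Suc j)
  then have "pderiv (wpoly T * (pderiv ^^ (j+2)) (wpoly T ^ n) + smult (real j + 1 - real n) (pderiv (wpoly T) * (pderiv ^^ (j+1)) (wpoly T ^ n))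
    + smult ((real j + 1) * (2 * real n - real j)) ((pderiv ^^ j) (wpoly T ^ n))) = 0"
    by simp
  then have "poly (pderiv (wpoly T * (pderiv ^^ (j+2)) (wpoly T ^ n) + smult (real j + 1 - real n) (pderiv (wpoly T) * (pderiv ^^ (j+1)) (wpoly T ^ n))
    + smult ((real j + 1) * (2 * real n - real j)) ((pderiv ^^ j) (wpoly T ^ n)))) x = 0" for x
    by simp
  then show ?case
    by (simp add: poly_eq_poly_eq_iff[symmetric] fun_eq_iff pderiv_mult pderiv_smult pderiv_add poly_pderiv_wpoly poly_pderiv2_wpoly poly_wpoly)
       (simp add: algebra_simps)
qed

abbreviation dsleg :: "real \<Rightarrow> nat \<Rightarrow> nat \<Rightarrow> real poly" where
  "dsleg T n k \<equiv> (pderiv ^^ k) (sleg T n)"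

text \<open>The previous identity at j = n + k, because the k-th derivative of
  \<open>sleg T n\<close> is a multiple of the (n + k)-th derivative of
  \<open>wpoly T ^ n\<close>.\<close>

lemma sleg_ode:
  assumes "T > 0"
  shows "wpoly T * dsleg T n (k+2) + smult (real k + 1) (pderiv (wpoly T) * dsleg T n (k+1))
     + smult ((real n + real k + 1) * (real n - real k)) (dsleg T n k) = 0"
proof -
  have e: "(pderiv ^^ k) ((pderiv ^^ n) p) = (pderiv ^^ (n + k)) p" for k and p :: "real poly"
    by (simp add: funpow_add add.commute[of n])
  have "wpoly T * dsleg T n (k+2) + smult (real k + 1) (pderiv (wpoly T) * dsleg T n (k+1))
     + smult ((real n + real k + 1) * (real n - real k)) (dsleg T n k)
     = smult ((-1) ^ n / (T ^ n * fact n)) 0"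
    unfolding sleg_rodrigues[OF assms] pderiv_funpow_smult e
      pderiv_funpow_ode[where j = "n + k", symmetric, of T n]
    by (simp add: smult_add_right mult_ac algebra_simps)
  then show ?thesis by simp
qed

text \<open>Multiplying \<open>sleg_ode\<close> by rho^k makes its two leading terms an exact
  derivative.\<close>

lemma sleg_sturm_liouville:
  assumes "T > 0"
  shows "pderiv (wpoly T ^ (k+1) * dsleg T n (k+1))
     = smult (- ((real n - real k) * (real n + real k + 1))) (wpoly T ^ k * dsleg T n k)"
proof -
  have "pderiv (wpoly T ^ (k+1) * dsleg T n (k+1)) =
     wpoly T ^ k * (wpoly T * dsleg T n (k+2) + smult (real k + 1) (pderiv (wpoly T) * dsleg T n (k+1)))"
    using pderiv_power_Suc[of "wpoly T" k] by (simp add: pderiv_mult algebra_simps del: power_Suc)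
       (simp add: algebra_simps)
  also have "wpoly T * dsleg T n (k+2) + smult (real k + 1) (pderiv (wpoly T) * dsleg T n (k+1))
     = smult (- ((real n - real k) * (real n + real k + 1))) (dsleg T n k)"
    using sleg_ode[OF assms, of k n] by (simp add: add_eq_0_iff2 mult.commute[of "real n - real k"])
  finally show ?thesis by simp
qed

text \<open>At the n-fold root a, only the term survives in which all n derivatives fall on the root
  factor. The general q lets the induction peel off one factor; the use is for the endpoint values
  of \<open>sleg\<close>.\<close>

lemma poly_pderiv_funpow_root_power:
  fixes q :: "real poly"
  shows "poly ((pderiv ^^ n) ([:-a, 1:] ^ n * q)) a = fact n * poly q a"
proof (induction n arbitrary: q)
  case (Suc n)
  have "pderiv ([:-a, 1:] ^ Suc n * q) = [:-a, 1:] ^ n * (smult (real (Suc n)) q + [:-a, 1:] * pderiv q)"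
    by (simp add: poly_eq_poly_eq_iff[symmetric] fun_eq_iff pderiv_mult pderiv_power_Suc pderiv_pCons poly_power del: power_Suc)
       (simp add: algebra_simps)
  then have "(pderiv ^^ Suc n) ([:-a, 1:] ^ Suc n * q)
    = (pderiv ^^ n) ([:-a, 1:] ^ n * (smult (real (Suc n)) q + [:-a, 1:] * pderiv q))"
    by (simp only: funpow_Suc_right o_def)
  then have "poly ((pderiv ^^ Suc n) ([:-a, 1:] ^ Suc n * q)) a
    = fact n * poly (smult (real (Suc n)) q + [:-a, 1:] * pderiv q) a"
    by (simp only: Suc.IH)
  then show ?case by simp
qed simp

lemma poly_sleg_0: assumes "T > 0" shows "poly (sleg T n) 0 = (-1) ^ n"
proof -
  have "wpoly T = [:-0, 1:] * [:T, -1:]" by (simp add: wpoly_def)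
  then have "wpoly T ^ n = [:-0, 1:] ^ n * [:T, -1:] ^ n" by (metis power_mult_distrib)
  then show ?thesis unfolding sleg_rodrigues[OF assms]
    using poly_pderiv_funpow_root_power[of n 0 "[:T, -1:] ^ n"] assms by (simp add: poly_power)
qed

lemma poly_sleg_T: assumes "T > 0" shows "poly (sleg T n) T = 1"
proof -
  have "wpoly T = [:-T, 1:] * [:0, -1:]" by (simp add: wpoly_def)
  then have "wpoly T ^ n = [:-T, 1:] ^ n * [:0, -1:] ^ n" by (metis power_mult_distrib)
  then show ?thesis unfolding sleg_rodrigues[OF assms]
    using poly_pderiv_funpow_root_power[of n T "[:0, -1:] ^ n"] assms by (simp add: poly_power power_minus[of T])
qed

section \<open>Integrals over the open time interval\<close>

text \<open>A restricted measure, instead of the set integrals of the definitions, makes product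
  measures and almost-everywhere statements directly available; \<open>integral_ivl\<close>
  translates.\<close>

abbreviation ivl :: "real \<Rightarrow> real measure" where
  "ivl T \<equiv> restrict_space lborel {0<..<T}"

lemma finite_measure_ivl: "finite_measure (ivl T)"
  by (rule finite_measureI) (use emeasure_bounded_finite[of "{0<..<T}"] in \<open>simp add: emeasure_restrict_space space_restrict_space less_top\<close>)

lemma borel_measurable_ivl: "f \<in> borel_measurable borel \<Longrightarrow> f \<in> borel_measurable (ivl T)"
  by (rule measurable_restrict_space1) simp

lemma integral_ivl: "integral\<^sup>L (ivl T) f = (LINT t:{0<..<T}|lborel. f t)" for f :: "real \<Rightarrow> real"
  by (simp add: set_integral_restrict_space[symmetric] integral_restrict_space set_lebesgue_integral_def)

lemma integrable_ivl_bounded: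
  fixes f :: "real \<Rightarrow> real"
  assumes "f \<in> borel_measurable (ivl T)" "\<And>t. t \<in> {0<..<T} \<Longrightarrow> \<bar>f t\<bar> \<le> B"
  shows "integrable (ivl T) f"
proof -
  interpret finite_measure "ivl T" by (rule finite_measure_ivl)
  show ?thesis
    by (rule integrable_const_bound[of _ B]) (use assms in \<open>auto intro!: AE_I2 simp: space_restrict_space\<close>)
qed

lemma continuous_on_ivl_bounded:
  fixes f :: "real \<Rightarrow> real"
  assumes "continuous_on UNIV f"
  obtains B where "B > 0" "\<And>t. t \<in> {0..T} \<Longrightarrow> \<bar>f t\<bar> \<le> B"
proof -
  have "bounded (f ` {0..T})"
    by (intro compact_imp_bounded compact_continuous_image continuous_on_subset[OF assms]) auto
  then show ?thesis using that unfolding bounded_pos by (auto simp: image_iff)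
qed

lemma continuous_on_imp_integrable_ivl:
  fixes f :: "real \<Rightarrow> real"
  assumes "continuous_on UNIV f"
  shows "integrable (ivl T) f"
proof -
  obtain B where B: "\<And>t. t \<in> {0..T} \<Longrightarrow> \<bar>f t\<bar> \<le> B"
    using continuous_on_ivl_bounded[OF assms] by blast
  show ?thesis
    by (rule integrable_ivl_bounded[of _ _ B])
       (use B assms in \<open>auto intro!: borel_measurable_ivl borel_measurable_continuous_onI\<close>)
qed

lemma integral_ivl_FTC:
  fixes f F :: "real \<Rightarrow> real"
  assumes "T > 0" and "\<And>x. (F has_real_derivative f x) (at x)" and "continuous_on UNIV f"
  shows "integral\<^sup>L (ivl T) f = F T - F 0"
proof -
  have "integral\<^sup>L (ivl T) f = (\<integral>t. f t * indicator {0<..<T} t \<partial>lborel)"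
    by (simp add: integral_ivl set_lebesgue_integral_def mult.commute)
  also have "\<dots> = (\<integral>t. f t * indicator {0..T} t \<partial>lborel)"
  proof (rule integral_cong_AE)
    have [measurable]: "f \<in> borel_measurable borel"
      using assms(3) by (rule borel_measurable_continuous_onI)
    show "(\<lambda>t. f t * indicator {0<..<T} t) \<in> borel_measurable lborel"
      "(\<lambda>t. f t * indicator {0..T} t) \<in> borel_measurable lborel" by auto
    show "AE t in lborel. f t * indicator {0<..<T} t = f t * indicator {0..T} t"
      using AE_lborel_singleton[of 0] AE_lborel_singleton[of T] by eventually_elim (auto simp: indicator_def)
  qed
  also have "\<dots> = F T - F 0"
    by (rule integral_FTC_Icc_real) (use assms continuous_on_eq_continuous_at[of UNIV f] in auto)
  finally show ?thesis .
qed

text \<open>Polynomials are integrable over the bounded interval, so on \<open>real poly\<close> the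
  integral is linear without side conditions and the Legendre identities become algebra.\<close>

definition pint :: "real \<Rightarrow> real poly \<Rightarrow> real" where "pint T p = integral\<^sup>L (ivl T) (poly p)"

lemma integrable_ivl_poly: "integrable (ivl T) (poly p)" for p :: "real poly"
  by (intro continuous_on_imp_integrable_ivl continuous_intros)

lemma pint_add: "pint T (p + q) = pint T p + pint T q"
  using Bochner_Integration.integral_add[OF integrable_ivl_poly[of T p] integrable_ivl_poly[of T q]]
  by (simp add: pint_def poly_add[abs_def])

lemma pint_smult: "pint T (smult c p) = c * pint T p"
  using integral_mult_right_zero[of "ivl T" c "poly p"] by (simp add: pint_def poly_smult[abs_def])

lemma pint_0: "pint T 0 = 0"
  using pint_smult[of T 0 0] by simp

lemma pint_minus: "pint T (- p) = - pint T p"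
  using pint_smult[of T "-1" p] by simp

lemma pint_sum: "pint T (\<Sum>i\<in>A. f i) = (\<Sum>i\<in>A. pint T (f i))"
  by (induction A rule: infinite_finite_induct) (simp_all add: pint_0 pint_add)

lemma pint_pderiv: "T > 0 \<Longrightarrow> pint T (pderiv p) = poly p T - poly p 0"
  unfolding pint_def by (rule integral_ivl_FTC) (auto intro!: poly_DERIV continuous_intros)

lemma pint_by_parts:
  "T > 0 \<Longrightarrow> pint T (pderiv p * q) = poly p T * poly q T - poly p 0 * poly q 0 - pint T (p * pderiv q)"
  using pint_pderiv[of T "p * q"] by (simp add: pderiv_mult pint_add mult.commute)

text \<open>Since the weight vanishes at both endpoints, integrating by parts against the
  Sturm--Liouville form raises the order of the weighted inner product by one.\<close>
lemma pint_sleg_step: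
  assumes "T > 0"
  shows "pint T (wpoly T ^ (k+1) * dsleg T n (k+1) * dsleg T m (k+1))
    = (real n - real k) * (real n + real k + 1) * pint T (wpoly T ^ k * dsleg T n k * dsleg T m k)"
proof -
  have "pint T (pderiv (wpoly T ^ (k+1) * dsleg T n (k+1)) * dsleg T m k)
     = - pint T (wpoly T ^ (k+1) * dsleg T n (k+1) * dsleg T m (k+1))"
    by (subst pint_by_parts[OF assms]) (simp add: poly_wpoly)
  then show ?thesis unfolding sleg_sturm_liouville[OF assms]
    by (simp add: pint_smult pint_minus mult.assoc)
qed

text \<open>Exchanging n and m in the step from k = 0 gives the same integral with the eigenvalue n
  (n + 1) and with m (m + 1), which differ.\<close>

lemma pint_sleg_orthogonal:
  assumes "T > 0" "n \<noteq> m"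
  shows "pint T (sleg T n * sleg T m) = 0"
proof -
  have e: "real n * (real n + 1) * pint T (sleg T n * sleg T m) = real m * (real m + 1) * pint T (sleg T n * sleg T m)"
    using pint_sleg_step[OF assms(1), of 0 n m] pint_sleg_step[OF assms(1), of 0 m n]
    by (simp add: mult_ac)
  have "real n * (real n + 1) - real m * (real m + 1) = (real n - real m) * (real n + real m + 1)"
    by (simp add: algebra_simps)
  also have "\<dots> \<noteq> 0" using assms(2) by auto
  finally show ?thesis using e by auto
qed

lemma degree_pderiv_funpow: "degree ((pderiv ^^ k) p) = degree p - k" for p :: "real poly"
  by (induction k) (simp_all add: degree_pderiv)

lemma degree_sleg: assumes "T > 0" shows "degree (sleg T n) = n"
  using assms by (simp add: sleg_rodrigues degree_pderiv_funpow degree_power_eq wpoly_def)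

lemma sleg_neq_0: "T > 0 \<Longrightarrow> sleg T n \<noteq> 0"
  using poly_sleg_T[of T n] by auto

text \<open>Since \<open>sleg T n\<close> has degree exactly n, leading coefficients can be
  eliminated one by one.\<close>

lemma sleg_span:
  assumes "T > 0" "degree p \<le> n"
  obtains c where "p = (\<Sum>k\<le>n. smult (c k) (sleg T k))"
proof -
  have "\<exists>c. p = (\<Sum>k\<le>n. smult (c k) (sleg T k))"
    using assms(2)
  proof (induction n arbitrary: p)
    case 0
    then obtain a where "p = [:a:]" by (auto elim: degree_eq_zeroE)
    moreover obtain b where "sleg T 0 = [:b:]" 
      using degree_sleg[OF assms(1), of 0] by (auto elim: degree_eq_zeroE)
    ultimately show ?case using sleg_neq_0[OF assms(1), of 0]
      by (intro exI[of _ "\<lambda>_. a / b"]) simp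
  next
    case (Suc n)
    define a where "a = coeff p (Suc n) / coeff (sleg T (Suc n)) (Suc n)"
    have nz: "coeff (sleg T (Suc n)) (Suc n) \<noteq> 0"
      using sleg_neq_0[OF assms(1), of "Suc n"] degree_sleg[OF assms(1), of "Suc n"] by (metis leading_coeff_0_iff)
    let ?r = "p - smult a (sleg T (Suc n))"
    have "degree ?r \<le> Suc n"
      using Suc.prems degree_sleg[OF assms(1), of "Suc n"] by (intro degree_diff_le) auto
    moreover have "coeff ?r (Suc n) = 0" using nz by (simp add: a_def)
    ultimately have "degree ?r \<le> n"
      by (metis eq_zero_or_degree_less less_Suc_eq_le degree_0 le0)
    then obtain c where c: "?r = (\<Sum>k\<le>n. smult (c k) (sleg T k))"
      using Suc.IH by blast
    have "p = (\<Sum>k\<le>Suc n. smult ((c(Suc n := a)) k) (sleg T k))"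
      using c by (simp add: algebra_simps)
    then show ?case by blast
  qed
  then show ?thesis using that by blast
qed

lemma pint_sleg_lower_degree:
  assumes "T > 0" "degree p < n"
  shows "pint T (sleg T n * p) = 0"
proof -
  obtain c where c: "p = (\<Sum>k\<le>n - 1. smult (c k) (sleg T k))"
    using assms sleg_span[of T p "n - 1"] by (metis Suc_diff_1 less_Suc_eq_le not_less_zero neq0_conv)
  show ?thesis using assms
    by (auto simp: c sum_distrib_left pint_sum pint_smult intro!: sum.neutral pint_sleg_orthogonal)
qed

text \<open>The polynomial r = t q' - n q has degree below n and is orthogonal to q, so the integral
  of t (q^2)' is 2 n times that of q^2. Integration by parts gives a second relation between these
  two integrals, with the endpoint value T.\<close>

lemma pint_sleg_square:
  assumes "T > 0"
  shows "pint T (sleg T n * sleg T n) = T / (2 * real n + 1)"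
proof -
  let ?q = "sleg T n" and ?X = "[:0, 1:] :: real poly"
  define r where "r = ?X * pderiv ?q - smult (real n) ?q"
  have r0: "pint T (?q * r) = 0"
  proof (cases "n = 0")
    case True
    then have "pderiv ?q = 0" using degree_sleg[OF assms, of n] by (simp add: pderiv_eq_0_iff)
    with True show ?thesis by (simp add: r_def pint_0)
  next
    case False
    have "degree r < n"
    proof -
      have "degree r \<le> n"
        unfolding r_def using degree_sleg[OF assms, of n] False
        by (intro degree_diff_le) (auto simp: degree_pderiv intro!: order.trans[OF degree_mult_le])
      \<comment> \<open>The leading terms of t q' and n q cancel.\<close>
      moreover have "coeff r n = 0"
        using False by (cases n) (simp_all add: r_def coeff_pderiv)
      ultimately show ?thesis using False
        by (metis eq_zero_or_degree_less degree_0 gr0I)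
    qed
    then show ?thesis by (rule pint_sleg_lower_degree[OF assms])
  qed
  have "pint T (pderiv ?X * (?q * ?q)) = T - pint T (?X * pderiv (?q * ?q))"
    by (subst pint_by_parts[OF assms]) (simp add: poly_sleg_T[OF assms])
  moreover have "?X * pderiv (?q * ?q) = smult 2 (?q * r) + smult (2 * real n) (?q * ?q)"
    by (simp add: poly_eq_poly_eq_iff[symmetric] fun_eq_iff r_def pderiv_mult algebra_simps)
  ultimately have "pint T (?q * ?q) = T - 2 * real n * pint T (?q * ?q)"
    by (simp add: pint_add pint_smult r0 pderiv_pCons)
  then have "(2 * real n + 1) * pint T (?q * ?q) = T" by (simp add: algebra_simps)
  then show ?thesis by (simp add: field_simps)
qed

section \<open>Orthonormal polynomials and their weighted derivatives\<close>

text \<open>Orthonormal for the unweighted integral; the weight exp (- 2 t) of the theorem is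
  absorbed by expanding exp (- t) u.\<close>

definition Qpoly :: "real \<Rightarrow> nat \<Rightarrow> real poly" where
  "Qpoly T n = smult (sqrt ((2 * real n + 1) / T)) (sleg T n)"

lemma Qn_eq_Qpoly: "Qn T n t = poly (Qpoly T n) t"
  by (simp add: Qn_def Qpoly_def sleg_def poly_pcompose mult.commute[of t])

lemma pint_Qpoly:
  assumes "T > 0"
  shows "pint T (Qpoly T n * Qpoly T m) = (if n = m then 1 else 0)"
  using assms by (simp add: Qpoly_def pint_smult pint_sleg_orthogonal pint_sleg_square)

text \<open>Equals (n + k)! / (n - k)! for k <= n and 0 for n < k. It will be the squared norm of
  the k-th derivative of \<open>Qpoly T n\<close> in the weight \<open>wpoly T ^ k\<close>; its
  growth of order n^(2 k) is the source of the decay.\<close>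

definition jac_norm :: "nat \<Rightarrow> nat \<Rightarrow> real" where
  "jac_norm k n = (\<Prod>i<k. (real n - real i) * (real n + real i + 1))"

lemma pint_sleg_jac:
  assumes "T > 0"
  shows "pint T (wpoly T ^ k * dsleg T n k * dsleg T m k) = jac_norm k n * pint T (sleg T n * sleg T m)"
proof (induction k)
  case (Suc k)
  then show ?case using pint_sleg_step[OF assms, of k n m] by (simp add: jac_norm_def mult_ac)
qed (simp add: jac_norm_def)

lemma pint_Qpoly_jac:
  assumes "T > 0"
  shows "pint T (wpoly T ^ k * (pderiv ^^ k) (Qpoly T n) * (pderiv ^^ k) (Qpoly T m)) = (if n = m then jac_norm k n else 0)"
proof -
  have "pint T (wpoly T ^ k * (pderiv ^^ k) (Qpoly T n) * (pderiv ^^ k) (Qpoly T m)) = jac_norm k n * pint T (Qpoly T n * Qpoly T m)"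
    using pint_sleg_jac[OF assms, of k n m] by (simp add: Qpoly_def pderiv_funpow_smult pint_smult mult_ac)
  then show ?thesis by (simp add: pint_Qpoly[OF assms])
qed

text \<open>For i <= 4 and n >= 5 the inequality n - i >= (n + 1) / 6 holds, with equality at n = 5,
  i = 4; hence the 6.\<close>

lemma jac_norm_5_ge:
  assumes "n \<ge> 5"
  shows "(real n + 1) ^ 10 \<le> 6 ^ 5 * jac_norm 5 n"
proof -
  have "(\<Prod>i<5::nat. (real n + 1)^2 / 6) \<le> jac_norm 5 n"
    unfolding jac_norm_def
  proof (rule prod_mono)
    fix i :: nat assume "i \<in> {..<5}"
    then have i: "real i \<le> 4" by auto
    have "(real n + 1) / 6 * (real n + 1) \<le> (real n - real i) * (real n + real i + 1)"
      by (rule mult_mono) (use i assms in auto)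
    then show "0 \<le> (real n + 1)^2 / 6 \<and> (real n + 1)^2 / 6 \<le> (real n - real i) * (real n + real i + 1)"
      by (simp add: power2_eq_square)
  qed
  then have "((real n + 1)^2 / 6) ^ 5 \<le> jac_norm 5 n" by simp
  then show ?thesis by (simp add: power_divide field_simps flip: power_mult)
qed

section \<open>Endpoint values and norms of derivatives\<close>

text \<open>At an endpoint \<open>wpoly T\<close> vanishes and the differential equation degenerates
  to a first-order recursion in k; its derivative has modulus T at both ends.\<close>

lemma sleg_pderiv_endpoint:
  assumes "T > 0" "z = 0 \<or> z = T"
  shows "(real k + 1) * T * \<bar>poly (dsleg T n (k+1)) z\<bar> = \<bar>(real n + real k + 1) * (real n - real k)\<bar> * \<bar>poly (dsleg T n k) z\<bar>"
proof -
  have "poly (wpoly T * dsleg T n (k+2) + smult (real k + 1) (pderiv (wpoly T) * dsleg T n (k+1))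
     + smult ((real n + real k + 1) * (real n - real k)) (dsleg T n k)) z = 0"
    using sleg_ode[OF assms(1), of k n] by simp
  then have "(real k + 1) * ((T - 2 * z) * poly (dsleg T n (k+1)) z) = - ((real n + real k + 1) * (real n - real k) * poly (dsleg T n k) z)"
    using assms by (auto simp add: poly_wpoly poly_pderiv_wpoly)
  then have "\<bar>(real k + 1) * ((T - 2 * z) * poly (dsleg T n (k+1)) z)\<bar> = \<bar>(real n + real k + 1) * (real n - real k) * poly (dsleg T n k) z\<bar>"
    by simp
  moreover have "\<bar>T - 2 * z\<bar> = T" using assms by auto
  ultimately show ?thesis by (simp add: abs_mult)
qed

lemma sleg_pderiv_endpoint_le:
  assumes "T > 0" "z = 0 \<or> z = T" "k \<le> 3"
  shows "\<bar>poly (dsleg T n k) z\<bar> \<le> (2 * (real n + 1)^2 / T) ^ k"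
  using assms(3)
proof (induction k)
  case 0
  then show ?case using assms poly_sleg_0[of T n] poly_sleg_T[of T n] by (auto simp: power_abs)
next
  case (Suc k)
  have e: "(real n + real k + 1) * (real n - real k) = real n * (real n + 1) - real k * (real k + 1)"
    by (simp add: algebra_simps)
  have n2: "real n * (real n + 1) \<le> (real n + 1)^2" "1 \<le> (real n + 1)^2"
    by (simp_all add: power2_eq_square algebra_simps)
  \<comment> \<open>The step only meets k <= 2, so k <= 2 (n + 1)^2. The factor 2 of the bound pays
    for n = 0 and k = 2.\<close>
  have "real k * (real k + 1) \<le> (2 * (real n + 1)^2) * (real k + 1)"
    using Suc.prems n2(2) by (intro mult_right_mono) (linarith | simp)+
  moreover have "real n * (real n + 1) \<le> (2 * (real n + 1)^2) * (real k + 1)"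
  proof -
    have "(real n + 1)^2 * 1 \<le> (2 * (real n + 1)^2) * (real k + 1)"
      by (intro mult_mono) auto
    then show ?thesis using n2 by linarith
  qed
  moreover have "0 \<le> real n * (real n + 1)" "0 \<le> real k * (real k + 1)" by auto
  ultimately have "\<bar>(real n + real k + 1) * (real n - real k)\<bar> \<le> (2 * (real n + 1)^2) * (real k + 1)"
    unfolding e by linarith
  then have "(real k + 1) * T * \<bar>poly (dsleg T n (k+1)) z\<bar> \<le> ((2 * (real n + 1)^2) * (real k + 1)) * (2 * (real n + 1)^2 / T) ^ k"
    unfolding sleg_pderiv_endpoint[OF assms(1,2)] using Suc by (intro mult_mono) auto
  then have "(real k + 1) * (T * \<bar>poly (dsleg T n (k+1)) z\<bar>) \<le> (real k + 1) * ((2 * (real n + 1)^2) * (2 * (real n + 1)^2 / T) ^ k)"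
    by (simp only: mult_ac)
  then have "T * \<bar>poly (dsleg T n (k+1)) z\<bar> \<le> (2 * (real n + 1)^2) * (2 * (real n + 1)^2 / T) ^ k"
    by (rule mult_left_le_imp_le) auto
  then show ?case using assms(1) by (simp add: field_simps)
qed

text \<open>Integration by parts moves all derivatives to one factor; the remaining integral pairs
  \<open>sleg T n\<close> with a polynomial of lower degree and vanishes. Only products of endpoint
  values are left, of orders n^2 and n^6.\<close>

lemma pint_sleg_pderiv_square_le:
  assumes "T > 0"
  shows "pint T (dsleg T n 1 * dsleg T n 1) \<le> 2 * (2 * (real n + 1)^2 / T)"
    and "pint T (dsleg T n 2 * dsleg T n 2) \<le> 4 * (2 * (real n + 1)^2 / T) ^ 3"
proof -
  let ?N = "2 * (real n + 1)^2 / T" and ?d = "dsleg T n"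
  have b: "\<bar>poly (?d i) z * poly (?d j) z\<bar> \<le> ?N ^ (i + j)" if "z = 0 \<or> z = T" "i \<le> 3" "j \<le> 3" for i j z
    unfolding abs_mult power_add using sleg_pderiv_endpoint_le[OF assms that(1)] that(2,3) assms
    by (intro mult_mono) auto
  have low: "pint T (?d 0 * ?d (Suc i)) = 0" for i
  \<comment> \<open>For n = 0 the derivative has degree 0, which is not below n, but it is itself
    0.\<close>
  proof (cases "n = 0")
    case True
    have "?d (Suc i) = 0"
      using degree_sleg[OF assms, of n] True by (simp add: pderiv_eq_0_iff degree_pderiv_funpow)
    then show ?thesis by (simp add: pint_0)
  next
    case False
    then show ?thesis unfolding funpow_0
      by (intro pint_sleg_lower_degree[OF assms]) (simp_all add: degree_pderiv_funpow degree_pderiv degree_sleg[OF assms])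
  qed
  have "pint T (?d 1 * ?d 1) = poly (?d 0) T * poly (?d 1) T - poly (?d 0) 0 * poly (?d 1) 0"
    using pint_by_parts[OF assms, of "?d 0" "?d 1"] low[of 1] by simp
  also have "\<dots> \<le> 2 * ?N" using b[of T 0 1] b[of 0 0 1] by simp
  finally show "pint T (?d 1 * ?d 1) \<le> 2 * ?N" .
  have "pint T (?d 2 * ?d 2) = poly (?d 1) T * poly (?d 2) T - poly (?d 1) 0 * poly (?d 2) 0
     - pint T (?d 1 * ?d 3)"
    using pint_by_parts[OF assms, of "?d 1" "?d 2"] by (simp add: numeral_2_eq_2 numeral_3_eq_3)
  also have "pint T (?d 1 * ?d 3) = poly (?d 0) T * poly (?d 3) T - poly (?d 0) 0 * poly (?d 3) 0"
    using pint_by_parts[OF assms, of "?d 0" "?d 3"] low[of 3] by (simp add: numeral_2_eq_2 numeral_3_eq_3)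
  also have "poly (?d 1) T * poly (?d 2) T - poly (?d 1) 0 * poly (?d 2) 0 - (poly (?d 0) T * poly (?d 3) T - poly (?d 0) 0 * poly (?d 3) 0)
     \<le> 4 * ?N ^ 3"
  proof -
    have "\<bar>poly (?d 1) T * poly (?d 2) T\<bar> \<le> ?N ^ (1 + 2)" "\<bar>poly (?d 1) 0 * poly (?d 2) 0\<bar> \<le> ?N ^ (1 + 2)"
      "\<bar>poly (?d 0) T * poly (?d 3) T\<bar> \<le> ?N ^ (0 + 3)" "\<bar>poly (?d 0) 0 * poly (?d 3) 0\<bar> \<le> ?N ^ (0 + 3)"
      by (rule b; simp)+
    moreover have "?N ^ (1 + 2) = ?N ^ 3" "?N ^ (0 + 3) = ?N ^ 3" by (simp_all only: numeral_One[symmetric] arith_simps add_0)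
    ultimately show ?thesis by linarith
  qed
  finally show "pint T (?d 2 * ?d 2) \<le> 4 * ?N ^ 3" .
qed

section \<open>Second derivatives of the basis functions\<close>

lemma Psi_eq: "Psi T n = (\<lambda>t. exp t * poly (Qpoly T n) t)"
  by (simp add: Psi_def Qn_eq_Qpoly fun_eq_iff)

lemma deriv_exp_poly: "deriv (\<lambda>t. exp t * poly p t) = (\<lambda>t. exp t * poly (p + pderiv p) t)" for p :: "real poly"
  by (rule ext, rule DERIV_imp_deriv) (auto intro!: derivative_eq_intros simp: algebra_simps)

definition Psi2poly :: "real \<Rightarrow> nat \<Rightarrow> real poly" where
  "Psi2poly T n = Qpoly T n + smult 2 (pderiv (Qpoly T n)) + pderiv (pderiv (Qpoly T n))"

lemma Psi2_eq: "Psi2 T n = (\<lambda>t. exp t * poly (Psi2poly T n) t)"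
  unfolding Psi2_def Psi_eq deriv_exp_poly by (simp add: fun_eq_iff Psi2poly_def pderiv_add algebra_simps)

text \<open>The second derivative dominates with n^6, and the squared normalising factor (2 n + 1) /
  T adds one power.\<close>

lemma pint_Psi2poly_square_le:
  assumes "T > 0"
  obtains C where "C > 0" "\<And>n. pint T (Psi2poly T n * Psi2poly T n) \<le> C * (real n + 1) ^ 7"
proof -
  define S where "S = 1 + 1 / T"
  have S: "S \<ge> 1" "1 / T \<le> S" using assms by (auto simp: S_def)
  let ?C = "2 / T * (3 * T + 48 * S + 96 * S^3)"
  have "pint T (Psi2poly T n * Psi2poly T n) \<le> ?C * (real n + 1) ^ 7" for n
  proof -
    let ?q = "dsleg T n" and ?c = "sqrt ((2 * real n + 1) / T)" and ?m = "real n + 1"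
    have m: "?m \<ge> 1" by simp
    define p where "p = sleg T n + smult 2 (?q 1) + ?q 2"
    have e: "Psi2poly T n = smult ?c p"
      by (simp add: Psi2poly_def Qpoly_def p_def pderiv_smult smult_add_right numeral_2_eq_2 mult.commute)
    have "pint T (p * p) \<le> pint T (smult 3 (?q 0 * ?q 0) + smult 12 (?q 1 * ?q 1) + smult 3 (?q 2 * ?q 2))"
      unfolding pint_def
    proof (rule integral_mono[OF integrable_ivl_poly integrable_ivl_poly])
      fix t
      have "(a + 2 * b + c)^2 \<le> 3 * a^2 + 12 * b^2 + 3 * c^2" for a b c :: real
      proof -
        have "0 \<le> (a - 2 * b)^2 + (a - c)^2 + (2 * b - c)^2" by simp
        then show ?thesis by (simp add: power2_eq_square algebra_simps)
      qed
      then show "poly (p * p) t \<le> poly (smult 3 (?q 0 * ?q 0) + smult 12 (?q 1 * ?q 1) + smult 3 (?q 2 * ?q 2)) t"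
        by (simp add: p_def power2_eq_square numeral_2_eq_2)
    qed
    also have "\<dots> = 3 * (T / (2 * real n + 1)) + 12 * pint T (?q 1 * ?q 1) + 3 * pint T (?q 2 * ?q 2)"
      using pint_sleg_square[OF assms, of n] by (simp only: pint_add pint_smult funpow_0)
    also have "\<dots> \<le> 3 * T + 12 * (2 * (2 * ?m^2 / T)) + 3 * (4 * (2 * ?m^2 / T) ^ 3)"
      using assms by (intro add_mono mult_left_mono pint_sleg_pderiv_square_le) (auto simp: field_simps)
    also have "\<dots> = 3 * T + 48 * (1/T * ?m^2) + 96 * ((1/T)^3 * ?m^6)"
      by (simp add: power_divide power_mult_distrib flip: power_mult)
    also have "\<dots> \<le> 3 * T * ?m^6 + 48 * (S * ?m^6) + 96 * (S^3 * ?m^6)"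
    proof (intro add_mono mult_left_mono)
      show "3 * T \<le> 3 * T * ?m^6" using assms one_le_power[OF m, of 6] by simp
      show "1/T * ?m^2 \<le> S * ?m^6" using S assms by (intro mult_mono power_increasing) auto
      show "(1/T)^3 * ?m^6 \<le> S^3 * ?m^6" using S assms by (intro mult_right_mono power_mono) auto
    qed auto
    also have "\<dots> = (3 * T + 48 * S + 96 * S^3) * ?m^6" by (simp add: algebra_simps)
    finally have 1: "pint T (p * p) \<le> (3 * T + 48 * S + 96 * S^3) * ?m^6" .
    have "pint T (Psi2poly T n * Psi2poly T n) = (2 * real n + 1) / T * pint T (p * p)"
      using assms by (simp add: e pint_smult)
    also have "\<dots> \<le> (2 * ?m / T) * ((3 * T + 48 * S + 96 * S^3) * ?m^6)"
      using assms S by (intro mult_mono 1 divide_right_mono) (auto simp: pint_def intro!: integral_nonneg)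
    also have "\<dots> = ?C * ?m^7" by (simp add: power_numeral_reduce field_simps)
    finally show ?thesis .
  qed
  moreover have "?C > 0" using assms S by (intro mult_pos_pos add_pos_pos divide_pos_pos) auto
  ultimately show ?thesis using that by blast
qed

section \<open>Testing weak derivatives against functions vanishing at the endpoints\<close>

text \<open>For p = 1 this is the standard smooth function exp (- 1 / x) continued by 0. Admitting a
  polynomial in y = 1 / x closes the family under differentiation: p becomes y^2 (p - p').\<close>

definition exp_bump :: "real poly \<Rightarrow> real \<Rightarrow> real" where
  "exp_bump p x = (if x > 0 then poly p (1 / x) * exp (- (1 / x)) else 0)"

lemma poly_times_exp_minus_tendsto_0:
  fixes p :: "real poly"
  shows "((\<lambda>y. poly p y * exp (- y)) \<longlongrightarrow> 0) at_top"
proof -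
  have "((\<lambda>y. \<Sum>i\<le>degree p. coeff p i * (y ^ i / exp y)) \<longlongrightarrow> (\<Sum>i\<le>degree p. coeff p i * 0)) at_top"
    by (intro tendsto_intros tendsto_power_div_exp_0)
  then show ?thesis
    by (simp add: poly_altdef sum_distrib_right exp_minus divide_inverse mult.assoc)
qed

lemma has_real_derivative_exp_bump:
  "(exp_bump p has_real_derivative exp_bump ([:0, 0, 1:] * (p - pderiv p)) x) (at x)"
proof (cases x "0::real" rule: linorder_cases)
  case less
  have "((\<lambda>x. 0) has_real_derivative 0) (at x)" by simp
  then have "(exp_bump p has_real_derivative 0) (at x)"
    by (rule has_field_derivative_transform_within_open[of _ _ _ "{..<0}"]) (use less in \<open>auto simp: exp_bump_def\<close>)
  then show ?thesis using less by (simp add: exp_bump_def)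
next
  case equal
  \<comment> \<open>With y = 1 / h the right difference quotient at 0 is y p(y) exp (- y).\<close>
  have r: "((\<lambda>h. poly ([:0, 1:] * p) (1 / h) * exp (- (1 / h))) \<longlongrightarrow> 0) (at_right 0)"
    using filterlim_compose[OF poly_times_exp_minus_tendsto_0 filterlim_inverse_at_top_right, of "[:0, 1:] * p"]
    by (simp add: inverse_eq_divide)
  have "((\<lambda>h. (exp_bump p (0 + h) - exp_bump p 0) / h) \<longlongrightarrow> 0) (at_right 0)"
    by (rule Lim_transform_eventually[OF r])
      (auto simp: eventually_at_filter exp_bump_def field_simps)
  moreover have "((\<lambda>h. (exp_bump p (0 + h) - exp_bump p 0) / h) \<longlongrightarrow> 0) (at_left 0)"
    by (rule Lim_transform_eventually[OF tendsto_const])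
       (auto simp: eventually_at_filter exp_bump_def)
  ultimately have "((\<lambda>h. (exp_bump p (0 + h) - exp_bump p 0) / h) \<longlongrightarrow> 0) (at 0)"
    by (simp add: filterlim_split_at)
  then have "(exp_bump p has_real_derivative 0) (at 0)" by (simp add: DERIV_def)
  then show ?thesis by (simp add: equal exp_bump_def)
next
  case greater
  have "((\<lambda>x. poly p (1 / x) * exp (- (1 / x))) has_real_derivative
     (poly ([:0, 0, 1:] * (p - pderiv p)) (1 / x) * exp (- (1 / x)))) (at x)"
    using greater
    by (auto intro!: derivative_eq_intros simp: power2_eq_square) (simp add: field_simps)
  then have "(exp_bump p has_real_derivative (poly ([:0, 0, 1:] * (p - pderiv p)) (1 / x) * exp (- (1 / x)))) (at x)"
    by (rule has_field_derivative_transform_within_open[of _ _ _ "{0<..}"]) (use greater in \<open>auto simp: exp_bump_def\<close>)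
  then show ?thesis using greater by (simp add: exp_bump_def)
qed

text \<open>For p = 1 this makes the cutoffs tend to 1 inside the interval; for p = y + y^2 it makes
  the additional term in their derivatives tend to 0.\<close>

lemma exp_bump_tendsto_at_top: "(exp_bump p \<longlongrightarrow> poly p 0) at_top"
proof -
  have "((\<lambda>x::real. 1 / x) \<longlongrightarrow> 0) at_top"
    by (intro tendsto_divide_0[OF tendsto_const] filterlim_at_top_imp_at_infinity filterlim_ident)
  then have "((\<lambda>x. poly p (1 / x) * exp (- (1 / x))) \<longlongrightarrow> poly p 0 * exp (- 0)) at_top"
    by (intro tendsto_intros)
  moreover have "\<forall>\<^sub>F x in at_top. poly p (1 / x) * exp (- (1 / x)) = exp_bump p x"
    using eventually_gt_at_top[of 0] by eventually_elim (simp add: exp_bump_def)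
  ultimately show ?thesis by (auto intro: Lim_transform_eventually)
qed

lemma exp_bump_1_bounded: "\<bar>exp_bump 1 x\<bar> \<le> 1"
  by (simp add: exp_bump_def)

lemma exp_bump_quadratic_bounded: "\<bar>exp_bump [:0, 1, 1:] x\<bar> \<le> 2"
proof (cases "x > 0")
  case True
  define y where "y = 1 / x"
  have y: "y > 0" using True by (simp add: y_def)
  then have "1 + y + y^2 / 2 \<le> exp y" by (intro exp_lower_Taylor_quadratic) simp
  then have "y + y * y \<le> 2 * exp y" using y by (simp add: power2_eq_square)
  then have "(y + y * y) / exp y \<le> 2" by (simp add: pos_divide_le_eq)
  moreover have "exp_bump [:0, 1, 1:] x = (y + y * y) / exp y"
    using True unfolding exp_bump_def y_def[symmetric] by (simp add: exp_minus divide_inverse algebra_simps)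
  ultimately show ?thesis using y by simp
qed (simp add: exp_bump_def)

text \<open>The factor \<open>s\<close> comes from the chain rule for the cutoff \<open>\<lambda>t. exp_bump 1 (m * \<rho> t - 1)\<close>
  and keeps the derivative bounded uniformly in \<open>m\<close>.\<close>
lemma exp_bump_scaling: "exp_bump [:0, 0, 1:] (s - 1) * s = exp_bump [:0, 1, 1:] (s - 1)"
proof (cases "s > 1")
  case True
  define y where "y = 1 / (s - 1)"
  have s: "s = 1 + 1 / y" and y: "y > 0" using True by (simp_all add: y_def)
  have "y * y * (1 + 1 / y) = y + y * y" using y by (simp add: distrib_left)
  then have "y * y * s * exp (- y) = (y + y * y) * exp (- y)" using s by simp
  then show ?thesis using True unfolding exp_bump_def y_def[symmetric] by (simp add: algebra_simps)
qed (simp add: exp_bump_def)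

section \<open>Repeatedly differentiable functions\<close>

text \<open>Derivatives are existential witnesses instead of iterates of \<open>deriv\<close>, so
  that closure under products and compositions is a plain induction.\<close>

fun times_diff :: "nat \<Rightarrow> (real \<Rightarrow> real) \<Rightarrow> bool" where
  "times_diff 0 f = True"
| "times_diff (Suc n) f = (\<exists>f'. (\<forall>x. (f has_real_derivative f' x) (at x)) \<and> times_diff n f')"

lemma times_diff_Suc_imp: "times_diff (Suc n) f \<Longrightarrow> times_diff n f"
proof (induction n arbitrary: f)
  case (Suc n)
  then obtain f' where f': "\<forall>x. (f has_real_derivative f' x) (at x)" "times_diff (Suc n) f'"
    by (simp only: times_diff.simps(2)[of "Suc n"]) blast
  then show ?case using Suc.IH[OF f'(2)] by auto
qed simp

lemma times_diff_add: "times_diff n f \<Longrightarrow> times_diff n g \<Longrightarrow> times_diff n (\<lambda>x. f x + g x)"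
proof (induction n arbitrary: f g)
  case (Suc n)
  then obtain f' g' where *: "\<forall>x. (f has_real_derivative f' x) (at x)" "times_diff n f'"
    "\<forall>x. (g has_real_derivative g' x) (at x)" "times_diff n g'" by auto
  then show ?case using Suc.IH[OF *(2,4)]
    by (auto intro!: exI[of _ "\<lambda>x. f' x + g' x"] derivative_intros)
qed simp

lemma times_diff_mult: "times_diff n f \<Longrightarrow> times_diff n g \<Longrightarrow> times_diff n (\<lambda>x. f x * g x)"
proof (induction n arbitrary: f g)
  case (Suc n)
  then obtain f' g' where *: "\<forall>x. (f has_real_derivative f' x) (at x)" "times_diff n f'"
    "\<forall>x. (g has_real_derivative g' x) (at x)" "times_diff n g'" by auto
  have "times_diff n f" "times_diff n g" using Suc.prems times_diff_Suc_imp by blast+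
  then have "times_diff n (\<lambda>x. f' x * g x + g' x * f x)"
    using * by (intro times_diff_add Suc.IH)
  then show ?case using *
    by (auto intro!: exI[of _ "\<lambda>x. f' x * g x + g' x * f x"] DERIV_mult)
qed simp

lemma times_diff_compose: "times_diff n f \<Longrightarrow> times_diff n g \<Longrightarrow> times_diff n (\<lambda>x. f (g x))"
proof (induction n arbitrary: f g)
  case (Suc n)
  then obtain f' g' where *: "\<forall>x. (f has_real_derivative f' x) (at x)" "times_diff n f'"
    "\<forall>x. (g has_real_derivative g' x) (at x)" "times_diff n g'" by auto
  have g: "times_diff n g" using Suc.prems times_diff_Suc_imp by blast
  have "times_diff n (\<lambda>x. f' (g x) * g' x)"
    by (rule times_diff_mult[OF Suc.IH[OF *(2) g] *(4)])
  moreover have "((\<lambda>x. f (g x)) has_real_derivative f' (g x) * g' x) (at x)" for x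
    using * by (intro DERIV_chain2[of f]) auto
  ultimately show ?case by (auto intro!: exI[of _ "\<lambda>x. f' (g x) * g' x"])
qed simp

lemma times_diff_poly: "times_diff n (poly p)"
  by (induction n arbitrary: p) (auto intro: poly_DERIV)

lemma times_diff_exp_bump: "times_diff n (exp_bump p)"
  by (induction n arbitrary: p) (auto intro: has_real_derivative_exp_bump)

lemma times_diff_exp_minus: "times_diff n (\<lambda>t. exp (- t))"
proof -
  have "times_diff n exp" by (induction n) (auto intro: DERIV_exp)
  then have "times_diff n (\<lambda>t. exp (poly [:0, -1:] t))" by (rule times_diff_compose) (rule times_diff_poly)
  then show ?thesis by simp
qed

text \<open>The way back to the iterates of \<open>deriv\<close> in \<open>test_t\<close>: a witness
  is determined pointwise, hence equals \<open>deriv\<close>.\<close>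

lemma times_diff_funpow_deriv: "times_diff (n + j) f \<Longrightarrow> times_diff n ((deriv ^^ j) f)"
proof (induction j arbitrary: n)
  case (Suc j)
  then obtain f' where f': "\<forall>x. ((deriv ^^ j) f has_real_derivative f' x) (at x)" "times_diff n f'"
    using Suc.IH[of "Suc n"] by auto
  then have "deriv ((deriv ^^ j) f) = f'" by (auto intro: DERIV_imp_deriv)
  then show ?case using f' by simp
qed simp

lemma times_diff_imp_differentiable: "(\<And>n. times_diff n f) \<Longrightarrow> (deriv ^^ j) f differentiable (at x)"
  using times_diff_funpow_deriv[of 1 j f] by (auto simp: real_differentiable_def)

section \<open>Test functions in time and cutoffs near the endpoints\<close>

lemma test_t_DERIV: "test_t T \<phi> \<Longrightarrow> ((deriv ^^ j) \<phi> has_real_derivative (deriv ^^ Suc j) \<phi> x) (at x)"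
  unfolding test_t_def
  by (simp add: DERIV_deriv_iff_real_differentiable)

lemma test_t_continuous: "test_t T \<phi> \<Longrightarrow> continuous_on UNIV ((deriv ^^ j) \<phi>)"
  by (meson DERIV_isCont continuous_at_imp_continuous_on test_t_DERIV)

text \<open>Off the closed support the function is locally 0, hence so is its derivative, and the
  support does not grow.\<close>

lemma test_t_deriv:
  assumes "test_t T \<phi>"
  shows "test_t T (deriv \<phi>)"
proof -
  have *: "{t. deriv \<phi> t \<noteq> 0} \<subseteq> closure {t. \<phi> t \<noteq> 0}"
  proof (rule ccontr)
    assume "\<not> ?thesis"
    then obtain x where x: "deriv \<phi> x \<noteq> 0" "x \<in> - closure {t. \<phi> t \<noteq> 0}" by auto
    have "((\<lambda>_. 0) has_real_derivative 0) (at x)" by simp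
    then have "(\<phi> has_real_derivative 0) (at x)"
      by (rule has_field_derivative_transform_within_open[of _ _ _ "- closure {t. \<phi> t \<noteq> 0}"])
         (use x closure_subset[of "{t. \<phi> t \<noteq> 0}"] in auto)
    with x(1) show False by (simp add: DERIV_imp_deriv)
  qed
  have "(deriv ^^ j) (deriv \<phi>) differentiable (at x)" for j x
    using test_t_DERIV[OF assms, of "Suc j" x] unfolding funpow_Suc_right o_def real_differentiable_def by blast
  moreover have "closure {t. deriv \<phi> t \<noteq> 0} \<subseteq> closure {t. \<phi> t \<noteq> 0}"
    using * closure_minimal by blast
  moreover from this have "compact (closure {t. deriv \<phi> t \<noteq> 0})"
    using assms unfolding test_t_def by (metis closed_closure compact_Int_closed inf.absorb2)
  ultimately show ?thesis using assms unfolding test_t_def by blast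
qed

lemma test_t_endpoints: "test_t T \<phi> \<Longrightarrow> \<phi> 0 = 0" "test_t T \<phi> \<Longrightarrow> \<phi> T = 0"
  unfolding test_t_def using closure_subset[of "{t. \<phi> t \<noteq> 0}"] by force+

lemma test_t_by_parts:
  assumes "T > 0" "test_t T \<phi>" "\<And>x. (\<psi> has_real_derivative \<psi>' x) (at x)" "continuous_on UNIV \<psi>'"
  shows "(\<integral>t. \<psi>' t * \<phi> t \<partial>ivl T) = - (\<integral>t. \<psi> t * deriv \<phi> t \<partial>ivl T)"
proof -
  note d = test_t_DERIV[OF assms(2), of 0, simplified]
  note c = test_t_continuous[OF assms(2), of 0, simplified] test_t_continuous[OF assms(2), of 1, simplified]
  have c3: "continuous_on UNIV \<psi>"
    by (meson DERIV_isCont assms(3) continuous_at_imp_continuous_on)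
  have "(\<integral>t. \<psi>' t * \<phi> t + deriv \<phi> t * \<psi> t \<partial>ivl T) = \<psi> T * \<phi> T - \<psi> 0 * \<phi> 0"
    by (rule integral_ivl_FTC[OF assms(1)])
       (intro DERIV_mult assms d continuous_intros c c3)+
  also have "\<dots> = 0" using test_t_endpoints[OF assms(2)] by simp
  finally show ?thesis
    by (subst (asm) Bochner_Integration.integral_add)
       (auto intro!: continuous_on_imp_integrable_ivl continuous_intros assms c c3 simp: mult.commute)
qed

text \<open>The first factor vanishes where m rho <= 1, that is near both endpoints. Building it
  from rho itself lets its derivative combine with the factor rho in front of g.\<close>

definition cutoff :: "real \<Rightarrow> real poly \<Rightarrow> nat \<Rightarrow> real \<Rightarrow> real" where
  "cutoff T g m t = exp_bump 1 (real m * poly (wpoly T) t - 1) * (exp (- t) * poly (wpoly T * g) t)"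

lemma cutoff_DERIV:
  "(cutoff T g m has_real_derivative
      exp_bump [:0, 1, 1:] (real m * poly (wpoly T) t - 1) * (poly (pderiv (wpoly T)) t * exp (- t) * poly g t)
      + exp_bump 1 (real m * poly (wpoly T) t - 1) * (exp (- t) * poly (pderiv (wpoly T * g) - wpoly T * g) t)) (at t)"
proof -
  have b: "((\<lambda>t. exp_bump 1 (real m * poly (wpoly T) t - 1)) has_real_derivative
      exp_bump [:0, 0, 1:] (real m * poly (wpoly T) t - 1) * (real m * poly (pderiv (wpoly T)) t)) (at t)"
    by (rule DERIV_chain2[OF has_real_derivative_exp_bump[of 1, simplified]])
       (auto intro!: derivative_eq_intros)
  have e: "((\<lambda>t. exp (- t) * poly (wpoly T * g) t) has_real_derivative exp (- t) * poly (pderiv (wpoly T * g) - wpoly T * g) t) (at t)"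
    by (auto intro!: derivative_eq_intros simp: pderiv_mult algebra_simps)
  have s: "exp_bump [:0, 1, 1:] (real m * poly (wpoly T) t - 1) = exp_bump [:0, 0, 1:] (real m * poly (wpoly T) t - 1) * (real m * poly (wpoly T) t)"
    by (rule exp_bump_scaling[symmetric])
  show ?thesis
    unfolding cutoff_def s
    by (rule DERIV_cong[OF DERIV_mult[OF b e]]) (simp add: algebra_simps)
qed

text \<open>The support lies in the closed set where m rho >= 1; there rho is positive, which
  confines it to the open interval.\<close>

lemma test_t_cutoff:
  assumes "T > 0"
  shows "test_t T (cutoff T g m)"
proof -
  let ?K = "{t. 1 \<le> real m * poly (wpoly T) t}"
  have "times_diff n (\<lambda>t. exp_bump 1 (poly (smult (real m) (wpoly T) - 1) t) * (exp (- t) * poly (wpoly T * g) t))" for n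
    by (intro times_diff_mult times_diff_compose[OF times_diff_exp_bump] times_diff_poly times_diff_exp_minus)
  then have "times_diff n (cutoff T g m)" for n
    by (simp add: cutoff_def[abs_def])
  then have 1: "(deriv ^^ j) (cutoff T g m) differentiable (at x)" for j x
    by (rule times_diff_imp_differentiable)
  have K: "?K \<subseteq> {0<..<T}"
  proof
    fix t assume "t \<in> ?K"
    then have "real m * (t * (T - t)) > 0" by (simp add: poly_wpoly)
    then have "t * (T - t) > 0" by (simp add: zero_less_mult_iff)
    then show "t \<in> {0<..<T}" using assms by (auto simp: zero_less_mult_iff)
  qed
  have cl: "closed ?K" by (intro closed_Collect_le continuous_intros)
  have "bounded ?K" by (rule bounded_subset[OF _ K]) simp
  with cl have cK: "compact ?K" by (simp add: compact_eq_bounded_closed)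
  have "{t. cutoff T g m t \<noteq> 0} \<subseteq> ?K" by (auto simp: cutoff_def exp_bump_def split: if_splits)
  then have sub: "closure {t. cutoff T g m t \<noteq> 0} \<subseteq> ?K" using cl by (rule closure_minimal)
  then have "compact (closure {t. cutoff T g m t \<noteq> 0})"
    using cK by (metis closed_closure compact_Int_closed inf.absorb2)
  then show ?thesis unfolding test_t_def using 1 sub K by blast
qed

text \<open>Let m tend to infinity under dominated convergence. The term \<open>F\<close>, stemming
  from the derivative of the cutoff, carries a factor that is bounded by 2 and tends to 0, so
  nothing is left of the endpoints.\<close>

lemma weak_derivative_cutoff_limit:
  assumes T: "T > 0" and a: "integrable (ivl T) a" and b: "integrable (ivl T) b"
    and weak: "\<And>m. (\<integral>t. a t * deriv (cutoff T g m) t \<partial>ivl T) = - (\<integral>t. b t * cutoff T g m t \<partial>ivl T)"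
  shows "(\<integral>t. a t * (exp (- t) * poly (pderiv (wpoly T * g) - wpoly T * g) t) \<partial>ivl T)
     = - (\<integral>t. b t * (exp (- t) * poly (wpoly T * g) t) \<partial>ivl T)"
proof -
  let ?c = "\<lambda>p m t. exp_bump p (real m * poly (wpoly T) t - 1)"
  define F where "F = (\<lambda>t. poly (pderiv (wpoly T)) t * exp (- t) * poly g t)"
  define G where "G = (\<lambda>t. exp (- t) * poly (pderiv (wpoly T * g) - wpoly T * g) t)"
  define H where "H = (\<lambda>t. exp (- t) * poly (wpoly T * g) t)"
  have cont: "continuous_on UNIV F" "continuous_on UNIV G" "continuous_on UNIV H"
    unfolding F_def G_def H_def by (intro continuous_intros)+
  have cb: "continuous_on UNIV (exp_bump p)" for p
    by (meson DERIV_isCont continuous_at_imp_continuous_on has_real_derivative_exp_bump)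
  have [measurable]: "a \<in> borel_measurable (ivl T)" "b \<in> borel_measurable (ivl T)"
    using a b by auto
  have [measurable]: "F \<in> borel_measurable (ivl T)" "G \<in> borel_measurable (ivl T)" "H \<in> borel_measurable (ivl T)"
    "?c p m \<in> borel_measurable (ivl T)" for p m
    using cont by (auto intro!: borel_measurable_ivl borel_measurable_continuous_onI continuous_intros continuous_on_compose2[OF cb])
  obtain BF where BF: "\<And>t. t \<in> {0..T} \<Longrightarrow> \<bar>F t\<bar> \<le> BF" using continuous_on_ivl_bounded[OF cont(1)] by blast
  obtain BG where BG: "\<And>t. t \<in> {0..T} \<Longrightarrow> \<bar>G t\<bar> \<le> BG" using continuous_on_ivl_bounded[OF cont(2)] by blast
  obtain BH where BH: "\<And>t. t \<in> {0..T} \<Longrightarrow> \<bar>H t\<bar> \<le> BH" using continuous_on_ivl_bounded[OF cont(3)] by blast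
  have lim: "(\<lambda>m. ?c p m t) \<longlonglongrightarrow> poly p 0" if "t \<in> {0<..<T}" for p t
  proof -
    have pos: "poly (wpoly T) t > 0" using that by (simp add: poly_wpoly)
    have "filterlim (\<lambda>m. -1 + poly (wpoly T) t * real m) at_top sequentially"
      by (intro filterlim_tendsto_add_at_top[OF tendsto_const] filterlim_tendsto_pos_mult_at_top[OF tendsto_const pos] filterlim_real_sequentially)
    then have "filterlim (\<lambda>m. real m * poly (wpoly T) t - 1) at_top sequentially"
      by (simp add: mult.commute)
    then show ?thesis by (rule filterlim_compose[OF exp_bump_tendsto_at_top])
  qed
  have dc: "deriv (cutoff T g m) t = ?c [:0, 1, 1:] m t * F t + ?c 1 m t * G t" for m t
    using DERIV_imp_deriv[OF cutoff_DERIV[of T g m t]] by (simp add: F_def G_def)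
  have cc: "cutoff T g m t = ?c 1 m t * H t" for m t
    by (simp add: cutoff_def H_def)
  have "(\<lambda>m. \<integral>t. a t * deriv (cutoff T g m) t \<partial>ivl T) \<longlonglongrightarrow> (\<integral>t. a t * G t \<partial>ivl T)"
  proof (rule integral_dominated_convergence[where w = "\<lambda>t. \<bar>a t\<bar> * (2 * BF + BG)"])
    show "integrable (ivl T) (\<lambda>t. \<bar>a t\<bar> * (2 * BF + BG))" using a by simp
    show "AE t in ivl T. (\<lambda>m. a t * deriv (cutoff T g m) t) \<longlonglongrightarrow> a t * G t"
    proof (rule AE_I2)
      fix t assume "t \<in> space (ivl T)"
      then have t: "t \<in> {0<..<T}" by (simp add: space_restrict_space)
      have "(\<lambda>m. a t * (?c [:0, 1, 1:] m t * F t + ?c 1 m t * G t)) \<longlonglongrightarrow> a t * (poly [:0, 1, 1:] 0 * F t + poly 1 0 * G t)"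
        by (intro tendsto_intros lim t)
      then show "(\<lambda>m. a t * deriv (cutoff T g m) t) \<longlonglongrightarrow> a t * G t" by (simp add: dc)
    qed
    show "AE t in ivl T. norm (a t * deriv (cutoff T g m) t) \<le> \<bar>a t\<bar> * (2 * BF + BG)" for m
    proof (rule AE_I2)
      fix t assume "t \<in> space (ivl T)"
      then have t: "t \<in> {0..T}" by (simp add: space_restrict_space)
      have "\<bar>deriv (cutoff T g m) t\<bar> \<le> \<bar>?c [:0, 1, 1:] m t\<bar> * \<bar>F t\<bar> + \<bar>?c 1 m t\<bar> * \<bar>G t\<bar>"
        unfolding dc abs_mult[symmetric] by (rule abs_triangle_ineq)
      also have "\<dots> \<le> 2 * BF + 1 * BG"
        by (intro add_mono mult_mono BF BG t exp_bump_1_bounded exp_bump_quadratic_bounded) auto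
      finally show "norm (a t * deriv (cutoff T g m) t) \<le> \<bar>a t\<bar> * (2 * BF + BG)"
        by (simp add: abs_mult mult_left_mono)
    qed
  qed (simp_all add: dc)
  moreover have "(\<lambda>m. \<integral>t. b t * cutoff T g m t \<partial>ivl T) \<longlonglongrightarrow> (\<integral>t. b t * H t \<partial>ivl T)"
  proof (rule integral_dominated_convergence[where w = "\<lambda>t. \<bar>b t\<bar> * BH"])
    show "integrable (ivl T) (\<lambda>t. \<bar>b t\<bar> * BH)" using b by simp
    show "AE t in ivl T. (\<lambda>m. b t * cutoff T g m t) \<longlonglongrightarrow> b t * H t"
    proof (rule AE_I2)
      fix t assume "t \<in> space (ivl T)"
      then have t: "t \<in> {0<..<T}" by (simp add: space_restrict_space)
      have "(\<lambda>m. b t * (?c 1 m t * H t)) \<longlonglongrightarrow> b t * (poly 1 0 * H t)"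
        by (intro tendsto_intros lim t)
      then show "(\<lambda>m. b t * cutoff T g m t) \<longlonglongrightarrow> b t * H t" by (simp add: cc)
    qed
    show "AE t in ivl T. norm (b t * cutoff T g m t) \<le> \<bar>b t\<bar> * BH" for m
    proof (rule AE_I2)
      fix t assume "t \<in> space (ivl T)"
      then have t: "t \<in> {0..T}" by (simp add: space_restrict_space)
      have "\<bar>cutoff T g m t\<bar> \<le> 1 * BH"
        unfolding cc abs_mult by (intro mult_mono BH t exp_bump_1_bounded) auto
      then show "norm (b t * cutoff T g m t) \<le> \<bar>b t\<bar> * BH"
        by (simp add: abs_mult mult_left_mono)
    qed
  qed (simp_all add: cc)
  ultimately have "(\<integral>t. a t * G t \<partial>ivl T) = - (\<integral>t. b t * H t \<partial>ivl T)"
    unfolding weak using LIMSEQ_unique tendsto_minus by blast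
  then show ?thesis by (simp add: G_def H_def)
qed

section \<open>Square-integrable functions and Fourier--Legendre series\<close>

text \<open>About functions, not classes modulo null sets: slices and coefficients are evaluated
  pointwise.\<close>

definition sq_int :: "'a measure \<Rightarrow> ('a \<Rightarrow> real) \<Rightarrow> bool" where
  "sq_int M f \<longleftrightarrow> f \<in> borel_measurable M \<and> integrable M (\<lambda>x. (f x)\<^sup>2)"

lemma sq_int_mult_integrable:
  assumes "sq_int M f" "sq_int M g"
  shows "integrable M (\<lambda>x. f x * g x)"
proof (rule Bochner_Integration.integrable_bound[of M "\<lambda>x. (f x)\<^sup>2 + (g x)\<^sup>2"])
  have "\<bar>a * b\<bar> \<le> a\<^sup>2 + b\<^sup>2" for a b :: real
    using sum_squares_bound[of "\<bar>a\<bar>" "\<bar>b\<bar>"] zero_le_power2[of a] zero_le_power2[of b] unfolding abs_mult power2_abs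
    by linarith
  then show "AE x in M. norm (f x * g x) \<le> norm ((f x)\<^sup>2 + (g x)\<^sup>2)" by auto
qed (use assms in \<open>auto simp: sq_int_def\<close>)

lemma sq_int_cmult: "sq_int M f \<Longrightarrow> sq_int M (\<lambda>x. c * f x)"
  by (auto simp: sq_int_def power_mult_distrib)

lemma sq_int_add:
  assumes "sq_int M f" "sq_int M g" shows "sq_int M (\<lambda>x. f x + g x)"
  using assms sq_int_mult_integrable[OF assms]
  by (simp add: sq_int_def power2_sum mult.assoc borel_measurable_add)

lemma sq_int_diff:
  assumes "sq_int M f" "sq_int M g" shows "sq_int M (\<lambda>x. f x - g x)"
  using sq_int_add[OF assms(1) sq_int_cmult[OF assms(2), of "-1"]] by simp

lemma sq_int_sum: "(\<And>i. i \<in> A \<Longrightarrow> sq_int M (f i)) \<Longrightarrow> sq_int M (\<lambda>x. \<Sum>i\<in>A. f i x)"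
  by (induction A rule: infinite_finite_induct) (auto simp: sq_int_def intro!: sq_int_add[unfolded sq_int_def])

lemma integral_square_nonneg: "0 \<le> (\<integral>x. (f x)\<^sup>2 \<partial>M)" for f :: "'a \<Rightarrow> real"
  by (rule Bochner_Integration.integral_nonneg) simp

text \<open>Expand the nonnegative squared norm of f - s. Measure and index set are general because
  two systems are used: \<open>Qpoly\<close>, and for n >= 5 its weighted fifth derivatives.\<close>

lemma bessel_inequality:
  assumes "finite A" "sq_int M f" "\<And>n. n \<in> A \<Longrightarrow> sq_int M (e n)"
    and "\<And>n m. n \<in> A \<Longrightarrow> m \<in> A \<Longrightarrow> (\<integral>x. e n x * e m x \<partial>M) = (if n = m then 1 else 0)"
  shows "(\<Sum>n\<in>A. (\<integral>x. f x * e n x \<partial>M)\<^sup>2) \<le> (\<integral>x. (f x)\<^sup>2 \<partial>M)"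
proof -
  define c where "c n = (\<integral>x. f x * e n x \<partial>M)" for n
  define s where "s x = (\<Sum>n\<in>A. c n * e n x)" for x
  have sq: "sq_int M s" unfolding s_def by (intro sq_int_sum sq_int_cmult assms)
  have fs: "(\<integral>x. f x * s x \<partial>M) = (\<Sum>n\<in>A. (c n)\<^sup>2)"
  proof -
    have "(\<integral>x. f x * s x \<partial>M) = (\<integral>x. (\<Sum>n\<in>A. c n * (f x * e n x)) \<partial>M)"
      by (simp add: s_def sum_distrib_left mult_ac)
    also have "\<dots> = (\<Sum>n\<in>A. c n * (\<integral>x. f x * e n x \<partial>M))"
      by (subst Bochner_Integration.integral_sum) (auto intro!: sq_int_mult_integrable assms)
    finally show ?thesis by (simp add: c_def power2_eq_square)
  qed
  have se: "(\<integral>x. s x * e m x \<partial>M) = c m" if "m \<in> A" for m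
  proof -
    have "(\<integral>x. s x * e m x \<partial>M) = (\<integral>x. (\<Sum>n\<in>A. c n * (e n x * e m x)) \<partial>M)"
      by (simp add: s_def sum_distrib_right mult.assoc)
    also have "\<dots> = (\<Sum>n\<in>A. c n * (\<integral>x. e n x * e m x \<partial>M))"
      by (subst Bochner_Integration.integral_sum) (auto intro!: sq_int_mult_integrable assms that)
    also have "\<dots> = (\<Sum>n\<in>A. if n = m then c n else 0)"
      by (rule sum.cong) (simp_all add: assms(4) that)
    finally show ?thesis using that assms(1) by simp
  qed
  have ss: "(\<integral>x. (s x)\<^sup>2 \<partial>M) = (\<Sum>n\<in>A. (c n)\<^sup>2)"
  proof -
    have "(\<integral>x. (s x)\<^sup>2 \<partial>M) = (\<integral>x. (\<Sum>n\<in>A. c n * (s x * e n x)) \<partial>M)"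
    proof (rule Bochner_Integration.integral_cong[OF refl])
      fix x
      have "(s x)\<^sup>2 = s x * (\<Sum>n\<in>A. c n * e n x)" by (simp add: power2_eq_square s_def)
      then show "(s x)\<^sup>2 = (\<Sum>n\<in>A. c n * (s x * e n x))" by (simp add: sum_distrib_left mult_ac)
    qed
    also have "\<dots> = (\<Sum>n\<in>A. c n * (\<integral>x. s x * e n x \<partial>M))"
      by (subst Bochner_Integration.integral_sum) (auto intro!: sq_int_mult_integrable assms sq)
    also have "\<dots> = (\<Sum>n\<in>A. (c n)\<^sup>2)" by (rule sum.cong) (simp_all add: se power2_eq_square)
    finally show ?thesis .
  qed
  have i: "integrable M (\<lambda>x. (f x)\<^sup>2)" "integrable M (\<lambda>x. (s x)\<^sup>2)" "integrable M (\<lambda>x. 2 * (f x * s x))"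
    using assms(2) sq sq_int_mult_integrable[OF assms(2) sq] by (auto simp: sq_int_def)
  have "0 \<le> (\<integral>x. (f x - s x)\<^sup>2 \<partial>M)" by (rule integral_square_nonneg)
  also have "\<dots> = (\<integral>x. (f x)\<^sup>2 + (s x)\<^sup>2 - 2 * (f x * s x) \<partial>M)"
    by (simp add: power2_diff mult.assoc)
  also have "\<dots> = (\<integral>x. (f x)\<^sup>2 \<partial>M) + (\<integral>x. (s x)\<^sup>2 \<partial>M) - 2 * (\<integral>x. f x * s x \<partial>M)"
    using i by simp
  finally show ?thesis by (simp add: fs ss c_def)
qed

lemma Cauchy_Schwarz_sq_int:
  assumes "sq_int M f" "sq_int M g"
  shows "(\<integral>x. f x * g x \<partial>M)\<^sup>2 \<le> (\<integral>x. (f x)\<^sup>2 \<partial>M) * (\<integral>x. (g x)\<^sup>2 \<partial>M)"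
proof -
  define a b c where "a = (\<integral>x. (g x)\<^sup>2 \<partial>M)" and "b = (\<integral>x. f x * g x \<partial>M)" and "c = (\<integral>x. (f x)\<^sup>2 \<partial>M)"
  have i: "integrable M (\<lambda>x. (f x)\<^sup>2)" "integrable M (\<lambda>x. (g x)\<^sup>2)" "integrable M (\<lambda>x. f x * g x)"
    using assms sq_int_mult_integrable[OF assms] by (auto simp: sq_int_def)
  have q: "0 \<le> c - 2 * s * b + s\<^sup>2 * a" for s
  proof -
    have "0 \<le> (\<integral>x. (f x - s * g x)\<^sup>2 \<partial>M)" by (rule integral_square_nonneg)
    also have "\<dots> = (\<integral>x. (f x)\<^sup>2 - (2 * s) * (f x * g x) + s\<^sup>2 * (g x)\<^sup>2 \<partial>M)"
      by (rule Bochner_Integration.integral_cong) (simp_all add: power2_eq_square algebra_simps)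
    also have "\<dots> = c - 2 * s * b + s\<^sup>2 * a"
      using i by (simp add: a_def b_def c_def)
    finally show ?thesis .
  qed
  have "a \<ge> 0" unfolding a_def by (rule integral_square_nonneg)
  have "b\<^sup>2 \<le> c * a"
  proof (cases "a = 0")
    case True
    have "b = 0"
    proof (rule ccontr)
      assume "b \<noteq> 0"
      \<comment> \<open>For a = 0 the quadratic is linear in s, and this s gives it the value
        -1.\<close>
      then show False using q[of "(c + 1) / (2 * b)"] True by simp
    qed
    then show ?thesis using True by simp
  next
    case False
    then show ?thesis using q[of "b / a"] \<open>a \<ge> 0\<close>
      by (simp add: power2_eq_square field_simps)
  qed
  then show ?thesis by (simp add: a_def b_def c_def)
qed

lemma sq_int_ivl_continuous: "continuous_on UNIV f \<Longrightarrow> sq_int (ivl T) f"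
  unfolding sq_int_def
  by (auto intro!: borel_measurable_ivl borel_measurable_continuous_onI continuous_on_imp_integrable_ivl continuous_intros)

lemma sq_int_mult_continuous:
  assumes "sq_int (ivl T) f" "continuous_on UNIV g"
  shows "sq_int (ivl T) (\<lambda>t. f t * g t)"
proof -
  obtain B where B: "\<And>t. t \<in> {0..T} \<Longrightarrow> \<bar>g t\<bar> \<le> B" using continuous_on_ivl_bounded[OF assms(2)] by blast
  have m: "f \<in> borel_measurable (ivl T)" "g \<in> borel_measurable (ivl T)"
    using assms by (auto simp: sq_int_def intro!: borel_measurable_ivl borel_measurable_continuous_onI)
  have "integrable (ivl T) (\<lambda>t. (f t * g t)\<^sup>2)"
  proof (rule Bochner_Integration.integrable_bound[of _ "\<lambda>t. B\<^sup>2 * (f t)\<^sup>2"])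
    show "AE t in ivl T. norm ((f t * g t)\<^sup>2) \<le> norm (B\<^sup>2 * (f t)\<^sup>2)"
    proof (rule AE_I2)
      fix t assume "t \<in> space (ivl T)"
      then have "\<bar>g t\<bar> \<le> \<bar>B\<bar>" using B[of t] by (auto simp: space_restrict_space)
      then have "(g t)\<^sup>2 \<le> B\<^sup>2" by (simp add: abs_le_square_iff)
      then show "norm ((f t * g t)\<^sup>2) \<le> norm (B\<^sup>2 * (f t)\<^sup>2)"
        by (simp add: power_mult_distrib mult.commute[of "B\<^sup>2"] mult_left_mono)
    qed
  qed (use assms m in \<open>auto simp: sq_int_def\<close>)
  then show ?thesis using m by (simp add: sq_int_def)
qed

lemma sq_int_ivl_integrable: "sq_int (ivl T) f \<Longrightarrow> integrable (ivl T) f"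
  using sq_int_mult_integrable[OF _ sq_int_ivl_continuous[of "\<lambda>_. 1" T], of f] by simp

section \<open>Fourier-Legendre expansions\<close>

abbreviation q_coef :: "real \<Rightarrow> (real \<Rightarrow> real) \<Rightarrow> nat \<Rightarrow> real" where
  "q_coef T F n \<equiv> (\<integral>t. F t * poly (Qpoly T n) t \<partial>ivl T)"

lemma Qpoly_orthonormal:
  "T > 0 \<Longrightarrow> (\<integral>t. poly (Qpoly T n) t * poly (Qpoly T m) t \<partial>ivl T) = (if n = m then 1 else 0)"
  using pint_Qpoly[of T n m] by (simp add: pint_def poly_mult[abs_def])

lemma bessel_Qpoly:
  assumes "T > 0" "sq_int (ivl T) F"
  shows "(\<Sum>n<N. (q_coef T F n)\<^sup>2) \<le> (\<integral>t. (F t)\<^sup>2 \<partial>ivl T)"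
  by (rule bessel_inequality) (auto intro!: assms sq_int_ivl_continuous continuous_intros simp: Qpoly_orthonormal[OF assms(1)])

lemma Qpoly_span:
  assumes "T > 0"
  obtains c where "p = (\<Sum>k\<le>degree p. smult (c k) (Qpoly T k))"
proof -
  obtain c where c: "p = (\<Sum>k\<le>degree p. smult (c k) (sleg T k))"
    using sleg_span[OF assms order_refl] by blast
  have "sleg T k = smult (1 / sqrt ((2 * real k + 1) / T)) (Qpoly T k)" for k
    using assms by (simp add: Qpoly_def)
  then have "p = (\<Sum>k\<le>degree p. smult (c k / sqrt ((2 * real k + 1) / T)) (Qpoly T k))"
    by (subst c) simp
  then show ?thesis by (rule that)
qed

lemma Qpoly_expansion:
  assumes "T > 0" "degree p < N"
  shows "poly p t = (\<Sum>k<N. q_coef T (poly p) k * poly (Qpoly T k) t)"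
proof -
  obtain c where c: "p = (\<Sum>k\<le>degree p. smult (c k) (Qpoly T k))" using Qpoly_span[OF assms(1)] by blast
  define d where "d k = (if k \<le> degree p then c k else 0)" for k
  have "poly p t = (\<Sum>k\<le>degree p. d k * poly (Qpoly T k) t)" for t
    by (subst c) (simp add: poly_sum d_def)
  also have "(\<Sum>k\<le>degree p. d k * poly (Qpoly T k) t) = (\<Sum>k<N. d k * poly (Qpoly T k) t)" for t
    using assms(2) by (intro sum.mono_neutral_left) (auto simp: d_def)
  finally have p: "poly p t = (\<Sum>k<N. d k * poly (Qpoly T k) t)" for t .
  have "q_coef T (poly p) m = d m" if "m < N" for m
  proof -
    have "q_coef T (poly p) m = (\<integral>t. (\<Sum>k<N. d k * (poly (Qpoly T k) t * poly (Qpoly T m) t)) \<partial>ivl T)"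
      by (simp add: p sum_distrib_right mult.assoc)
    also have "\<dots> = (\<Sum>k<N. d k * (\<integral>t. poly (Qpoly T k) t * poly (Qpoly T m) t \<partial>ivl T))"
      by (subst Bochner_Integration.integral_sum)
         (auto intro!: continuous_on_imp_integrable_ivl continuous_intros)
    also have "\<dots> = d m" using that by (simp add: Qpoly_orthonormal[OF assms(1)] if_distrib[of "(*) _"] cong: if_cong)
    finally show ?thesis .
  qed
  then show ?thesis by (simp add: p)
qed

lemma polynomial_approximation:
  fixes G :: "real \<Rightarrow> real"
  assumes "continuous_on UNIV G" "e > 0"
  obtains p where "\<And>t. t \<in> {0..T} \<Longrightarrow> \<bar>G t - poly p t\<bar> < e"
proof -
  obtain g where g: "real_polynomial_function g" "\<And>t. t \<in> {0..T} \<Longrightarrow> \<bar>G t - g t\<bar> < e"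
    using Stone_Weierstrass_real_polynomial_function[of "{0..T}" G e] continuous_on_subset[OF assms(1)] assms(2) by auto
  then obtain a n where "g = (\<lambda>x. \<Sum>i\<le>n. a i * x ^ i)"
    using real_polynomial_function_iff_sum by blast
  then have "g t = poly (\<Sum>i\<le>n. monom (a i) i) t" for t by (simp add: poly_sum poly_monom)
  then show ?thesis using g(2) that by metis
qed

text \<open>Against a polynomial p the partial sums are exact once N exceeds its degree, so the
  error only involves H = G - p. Cauchy-Schwarz bounds its integral and Bessel its sum, both by the
  norm of F times the norm of H, uniformly in N.\<close>

lemma parseval_Qpoly:
  assumes T: "T > 0" and F: "sq_int (ivl T) F" and G: "continuous_on UNIV G"
  shows "(\<lambda>N. \<Sum>n<N. q_coef T F n * q_coef T G n) \<longlonglongrightarrow> (\<integral>t. F t * G t \<partial>ivl T)"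
proof (rule LIMSEQ_I)
  fix r :: real assume "r > 0"
  define B where "B = sqrt (\<integral>t. (F t)\<^sup>2 \<partial>ivl T)"
  have B: "B \<ge> 0" by (simp add: B_def integral_square_nonneg)
  \<comment> \<open>Makes 2 B e sqrt T smaller than r; the summand 1 also covers B = 0.\<close>
  define e where "e = r / (2 * (B * sqrt T + 1))"
  have e: "e > 0" using \<open>r > 0\<close> B T by (simp add: e_def add_nonneg_pos)
  obtain p where p: "\<And>t. t \<in> {0..T} \<Longrightarrow> \<bar>G t - poly p t\<bar> < e"
    using polynomial_approximation[OF G e] by blast
  define H where "H t = G t - poly p t" for t
  have cH: "continuous_on UNIV H" unfolding H_def by (intro continuous_intros G)
  have sH: "sq_int (ivl T) H" by (rule sq_int_ivl_continuous[OF cH])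
  have "(\<integral>t. (H t)\<^sup>2 \<partial>ivl T) \<le> (\<integral>t. e\<^sup>2 \<partial>ivl T)"
  proof (rule integral_mono)
    show "integrable (ivl T) (\<lambda>t. (H t)\<^sup>2)" using sH by (simp add: sq_int_def)
    show "integrable (ivl T) (\<lambda>t. e\<^sup>2)" by (intro continuous_on_imp_integrable_ivl continuous_intros)
    fix t assume "t \<in> space (ivl T)"
    then have "\<bar>H t\<bar> \<le> e" using p[of t] by (auto simp: H_def space_restrict_space)
    then show "(H t)\<^sup>2 \<le> e\<^sup>2" using e by (simp add: abs_le_square_iff[symmetric])
  qed
  also have "\<dots> = e\<^sup>2 * T" using integral_ivl_FTC[OF T, of "\<lambda>t. e\<^sup>2 * t" "\<lambda>_. e\<^sup>2"]
    by (auto intro!: derivative_eq_intros)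
  finally have "sqrt (\<integral>t. (H t)\<^sup>2 \<partial>ivl T) \<le> sqrt (e\<^sup>2 * T)" by (rule real_sqrt_le_mono)
  then have H2: "sqrt (\<integral>t. (H t)\<^sup>2 \<partial>ivl T) \<le> e * sqrt T" using e by (simp add: real_sqrt_mult)
  have cs: "\<bar>\<integral>t. F t * H t \<partial>ivl T\<bar> \<le> B * (e * sqrt T)"
  proof -
    have "\<bar>\<integral>t. F t * H t \<partial>ivl T\<bar> = sqrt ((\<integral>t. F t * H t \<partial>ivl T)\<^sup>2)" by simp
    also have "\<dots> \<le> B * sqrt (\<integral>t. (H t)\<^sup>2 \<partial>ivl T)"
      unfolding B_def real_sqrt_mult[symmetric] by (intro real_sqrt_le_mono Cauchy_Schwarz_sq_int F sH)
    also have "\<dots> \<le> B * (e * sqrt T)" by (intro mult_left_mono H2 B)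
    finally show ?thesis .
  qed
  have bs: "\<bar>\<Sum>n<N. q_coef T F n * q_coef T H n\<bar> \<le> B * (e * sqrt T)" for N
  proof -
    have "\<bar>\<Sum>n<N. q_coef T F n * q_coef T H n\<bar> \<le> (\<Sum>n<N. \<bar>q_coef T F n\<bar> * \<bar>q_coef T H n\<bar>)"
      by (rule order.trans[OF sum_abs]) (simp add: abs_mult)
    also have "\<dots> \<le> L2_set (q_coef T F) {..<N} * L2_set (q_coef T H) {..<N}"
      by (rule L2_set_mult_ineq)
    also have "\<dots> \<le> B * sqrt (\<integral>t. (H t)\<^sup>2 \<partial>ivl T)"
      unfolding L2_set_def B_def
      by (intro mult_mono real_sqrt_le_mono bessel_Qpoly T F sH) (simp_all add: integral_square_nonneg sum_nonneg)
    also have "\<dots> \<le> B * (e * sqrt T)" by (intro mult_left_mono H2 B)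
    finally show ?thesis .
  qed
  show "\<exists>no. \<forall>N\<ge>no. norm ((\<Sum>n<N. q_coef T F n * q_coef T G n) - (\<integral>t. F t * G t \<partial>ivl T)) < r"
  proof (intro exI allI impI)
    fix N assume "N \<ge> Suc (degree p)"
    then have N: "degree p < N" by simp
    have sF: "sq_int (ivl T) (poly q)" for q by (intro sq_int_ivl_continuous continuous_intros)
    have "(\<integral>t. F t * poly p t \<partial>ivl T) = (\<integral>t. (\<Sum>n<N. q_coef T (poly p) n * (F t * poly (Qpoly T n) t)) \<partial>ivl T)"
      by (subst Qpoly_expansion[OF T N]) (simp add: sum_distrib_left mult_ac)
    also have "\<dots> = (\<Sum>n<N. q_coef T F n * q_coef T (poly p) n)"
      by (subst Bochner_Integration.integral_sum) (auto intro!: sq_int_mult_integrable F sF simp: mult.commute)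
    finally have 1: "(\<integral>t. F t * poly p t \<partial>ivl T) = (\<Sum>n<N. q_coef T F n * q_coef T (poly p) n)" .
    have 2: "(\<integral>t. F t * G t \<partial>ivl T) = (\<integral>t. F t * poly p t \<partial>ivl T) + (\<integral>t. F t * H t \<partial>ivl T)"
      by (subst Bochner_Integration.integral_add[OF sq_int_mult_integrable sq_int_mult_integrable, OF F sF F sH, symmetric])
         (simp add: H_def algebra_simps)
    have 3: "q_coef T G n = q_coef T (poly p) n + q_coef T H n" for n
      by (subst Bochner_Integration.integral_add[OF sq_int_mult_integrable sq_int_mult_integrable, OF sF sF sH sF, symmetric])
         (simp add: H_def algebra_simps)
    have "(\<Sum>n<N. q_coef T F n * q_coef T G n) - (\<integral>t. F t * G t \<partial>ivl T) = (\<Sum>n<N. q_coef T F n * q_coef T H n) - (\<integral>t. F t * H t \<partial>ivl T)"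
      unfolding 1 2 3 by (simp add: distrib_left sum.distrib)
    then have "norm ((\<Sum>n<N. q_coef T F n * q_coef T G n) - (\<integral>t. F t * G t \<partial>ivl T)) \<le> 2 * (B * (e * sqrt T))"
      using cs bs[of N] by simp
    also have "\<dots> = r * (B * sqrt T / (B * sqrt T + 1))"
    proof -
      have "B * sqrt T + 1 > 0" using B T by (simp add: add_nonneg_pos)
      then show ?thesis by (simp add: e_def field_simps)
    qed
    also have "\<dots> < r * 1"
      using B T \<open>r > 0\<close> by (intro mult_strict_left_mono) (simp_all add: add_nonneg_pos)
    finally show "norm ((\<Sum>n<N. q_coef T F n * q_coef T G n) - (\<integral>t. F t * G t \<partial>ivl T)) < r" by simp
  qed
qed

section \<open>Decay of the coefficients\<close>

text \<open>The index i will count time derivatives. One integration by parts turns the value at i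
  into the difference of the values at i and i + 1, so iteration yields finite differences.\<close>

fun fwd_diff :: "nat \<Rightarrow> (nat \<Rightarrow> real) \<Rightarrow> nat \<Rightarrow> real" where
  "fwd_diff 0 a i = a i"
| "fwd_diff (Suc k) a i = fwd_diff k a (Suc i) - fwd_diff k a i"

lemma fwd_diff_cmult: "fwd_diff k (\<lambda>i. c * a i) i = c * fwd_diff k a i"
  by (induction k arbitrary: i) (simp_all add: algebra_simps)

text \<open>The hypothesis makes a the negative first difference of b; i + k < N keeps all indices
  in the range where this is known.\<close>

lemma fwd_diff_shift:
  assumes "\<And>i. i < N \<Longrightarrow> a i = b i - b (Suc i)" "i + k < N"
  shows "fwd_diff k a i = - fwd_diff (Suc k) b i"
  using assms(2) by (induction k arbitrary: i) (simp_all add: assms(1))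

lemma fwd_diff_5: "fwd_diff 5 a 0 = a 5 - 5 * a 4 + 10 * a 3 - 10 * a 2 + 5 * a 1 - a 0"
  by (simp add: eval_nat_numeral)

definition coef5 :: "nat \<Rightarrow> real" where "coef5 j = (-1) ^ (5 - j) * real (5 choose j)"

lemma fwd_diff_5_sum: "fwd_diff 5 a 0 = (\<Sum>j\<le>5. coef5 j * a j)"
  unfolding fwd_diff_5 coef5_def by (simp add: eval_nat_numeral)

text \<open>For \<open>n \<ge> 5\<close> the kernel combines five integrations by parts with the fifth derivative of
  \<open>exp (- t) u\<close>, which is \<open>exp (- t)\<close> times the fifth power of the operator \<open>v \<mapsto> v' - v\<close>
  applied to \<open>u\<close>; \<open>coef5\<close> are its binomial coefficients and \<open>j\<close> is the order of the time derivative
  that the kernel is paired with.\<close>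
definition coef_kernel :: "real \<Rightarrow> nat \<Rightarrow> nat \<Rightarrow> real \<Rightarrow> real" where
  "coef_kernel T n j t = exp (- t) *
     (if n < 5 then (if j = 0 then poly (Qpoly T n) t else 0)
      else coef5 j / jac_norm 5 n * poly (wpoly T ^ 5 * (pderiv ^^ 5) (Qpoly T n)) t)"

lemma continuous_coef_kernel: "continuous_on UNIV (coef_kernel T n j)"
  unfolding coef_kernel_def[abs_def] divide_inverse by (cases "n < 5"; cases "j = 0") (auto intro!: continuous_intros)

lemma Qpoly_sturm_liouville:
  "T > 0 \<Longrightarrow> pderiv (wpoly T ^ (k+1) * (pderiv ^^ (k+1)) (Qpoly T n))
     = smult (- ((real n - real k) * (real n + real k + 1))) (wpoly T ^ k * (pderiv ^^ k) (Qpoly T n))"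
  using sleg_sturm_liouville[of T k n]
  by (simp add: Qpoly_def pderiv_funpow_smult pderiv_smult mult.commute del: power_Suc)

text \<open>With p_k = rho^k Q^(k), the Sturm-Liouville form replaces p_k by the derivative of
  p_(k+1) = rho g, where g = rho^k Q^(k+1) is exactly the polynomial in the assumed cutoffs. The
  eigenvalues multiply up to \<open>jac_norm 5 n\<close>, which is positive for n >= 5.\<close>

lemma coefficient_representation:
  fixes a :: "nat \<Rightarrow> real \<Rightarrow> real"
  assumes T: "T > 0" and int: "\<And>j. j \<le> 5 \<Longrightarrow> integrable (ivl T) (a j)"
    and weak: "\<And>j k m. j < 5 \<Longrightarrow> 
      (\<integral>t. a j t * deriv (cutoff T (wpoly T ^ k * (pderiv ^^ (k+1)) (Qpoly T n)) m) t \<partial>ivl T)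
      = - (\<integral>t. a (Suc j) t * cutoff T (wpoly T ^ k * (pderiv ^^ (k+1)) (Qpoly T n)) m t \<partial>ivl T)"
  shows "(\<integral>t. a 0 t * (exp (- t) * poly (Qpoly T n) t) \<partial>ivl T) = (\<Sum>j\<le>5. \<integral>t. a j t * coef_kernel T n j t \<partial>ivl T)"
proof (cases "n < 5")
  case True
  have "(\<Sum>j\<le>5. \<integral>t. a j t * coef_kernel T n j t \<partial>ivl T) = (\<Sum>j\<le>5::nat. if j = 0 then \<integral>t. a 0 t * (exp (- t) * poly (Qpoly T n) t) \<partial>ivl T else 0)"
    by (rule sum.cong) (auto simp: coef_kernel_def True)
  then show ?thesis by simp
next
  case False
  define A where "A p j = (\<integral>t. a j t * (exp (- t) * poly p t) \<partial>ivl T)" for p j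
  let ?p = "\<lambda>k. wpoly T ^ k * (pderiv ^^ k) (Qpoly T n)"
  have Ai: "integrable (ivl T) (\<lambda>t. a j t * (exp (- t) * poly p t))" if "j \<le> 5" for p j
  proof -
    have c: "continuous_on UNIV (\<lambda>t. exp (- t) * poly p t)" by (intro continuous_intros)
    obtain B where B: "\<And>t. t \<in> {0..T} \<Longrightarrow> \<bar>exp (- t) * poly p t\<bar> \<le> B"
      using continuous_on_ivl_bounded[OF c] by blast
    have m: "(\<lambda>t. exp (- t) * poly p t) \<in> borel_measurable (ivl T)"
      using c by (intro borel_measurable_ivl borel_measurable_continuous_onI)
    show ?thesis
    proof (rule Bochner_Integration.integrable_bound[of _ "\<lambda>t. a j t * B"])
      show "AE t in ivl T. norm (a j t * (exp (- t) * poly p t)) \<le> norm (a j t * B)"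
      proof (rule AE_I2)
        fix t assume "t \<in> space (ivl T)"
        then have "\<bar>exp (- t) * poly p t\<bar> \<le> \<bar>B\<bar>" using B[of t] by (auto simp: space_restrict_space)
        then show "norm (a j t * (exp (- t) * poly p t)) \<le> norm (a j t * B)"
          by (simp only: real_norm_def abs_mult[of "a j t"] mult_left_mono abs_ge_zero)
      qed
    qed (use int[OF that] m in auto)
  qed
  have Ad: "A (p - q) j = A p j - A q j" if "j \<le> 5" for p q j
    unfolding A_def using Bochner_Integration.integral_diff[OF Ai[OF that, of p] Ai[OF that, of q]]
    by (simp add: algebra_simps)
  have As: "A (smult c p) = (\<lambda>j. c * A p j)" for c p
    unfolding A_def by (simp add: mult_ac flip: Bochner_Integration.integral_mult_right_zero)
  \<comment> \<open>Integration by parts also differentiates exp (- t); hence both the value at j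
    and the one at j + 1.\<close>
  have step: "A (pderiv (?p (Suc k))) j = A (?p (Suc k)) j - A (?p (Suc k)) (Suc j)" if "j < 5" for k j
  proof -
    have "A (pderiv (?p (Suc k)) - ?p (Suc k)) j = - A (?p (Suc k)) (Suc j)"
      unfolding A_def
      using weak_derivative_cutoff_limit[OF T int[of j] int[of "Suc j"] weak[OF that, of k]] that
      by (simp add: mult.assoc)
    then show ?thesis using that by (simp add: Ad)
  qed
  have rec: "jac_norm k n * A (?p 0) 0 = fwd_diff k (A (?p k)) 0" if "k \<le> 5" for k
    using that
  proof (induction k)
    case (Suc k)
    have "fwd_diff k (A (pderiv (?p (Suc k)))) 0 = - fwd_diff (Suc k) (A (?p (Suc k))) 0"
      by (rule fwd_diff_shift[of 5]) (use step Suc.prems in auto)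
    moreover have "A (pderiv (?p (Suc k))) = (\<lambda>j. - ((real n - real k) * (real n + real k + 1)) * A (?p k) j)"
      using Qpoly_sturm_liouville[OF T, of k n] by (simp only: As Suc_eq_plus1)
    \<comment> \<open>The minus sign of the Sturm-Liouville form cancels the one of
      \<open>fwd_diff_shift\<close>.\<close>
    ultimately have "(real n - real k) * (real n + real k + 1) * fwd_diff k (A (?p k)) 0 = fwd_diff (Suc k) (A (?p (Suc k))) 0"
      by (simp only: fwd_diff_cmult) simp
    moreover have "jac_norm (Suc k) n * A (?p 0) 0 = (real n - real k) * (real n + real k + 1) * (jac_norm k n * A (?p 0) 0)"
      by (simp add: jac_norm_def)
    moreover have "jac_norm k n * A (?p 0) 0 = fwd_diff k (A (?p k)) 0"
      using Suc by simp
    ultimately show ?case by (simp only:)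
  qed (simp add: jac_norm_def)
  have pos: "jac_norm 5 n > 0"
    using False unfolding jac_norm_def by (intro prod_pos) auto
  have "A (?p 0) 0 = (\<Sum>j\<le>5. coef5 j / jac_norm 5 n * A (?p 5) j)"
  proof -
    have "A (?p 0) 0 = (\<Sum>j\<le>5. coef5 j * A (?p 5) j) / jac_norm 5 n"
      using rec[of 5] pos by (simp add: fwd_diff_5_sum eq_divide_eq mult.commute)
    then show ?thesis by (simp add: sum_divide_distrib)
  qed
  also have "\<dots> = (\<Sum>j\<le>5. \<integral>t. a j t * coef_kernel T n j t \<partial>ivl T)"
    unfolding A_def coef_kernel_def using False
    by (simp add: mult_ac flip: Bochner_Integration.integral_mult_right_zero)
  finally show ?thesis by (simp add: A_def)
qed

text \<open>The constant 252 is the sum of the squares of the binomial coefficients (5 choose j),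
  that is (10 choose 5).\<close>

lemma sum_square_le: "(\<Sum>j\<le>5. coef5 j * x j)\<^sup>2 \<le> 252 * (\<Sum>j\<le>5. (x j)\<^sup>2)" for x :: "nat \<Rightarrow> real"
proof -
  have "(\<Sum>j\<le>5. coef5 j * x j)\<^sup>2 \<le> (\<Sum>j\<le>5. (coef5 j)\<^sup>2) * (\<Sum>j\<le>5. (x j)\<^sup>2)"
    by (rule Cauchy_Schwarz_ineq_sum)
  also have "(\<Sum>j\<le>5. (coef5 j)\<^sup>2) = 252"
    by (simp add: coef5_def eval_nat_numeral)
  finally show ?thesis .
qed

text \<open>For n >= 5 the sum of kernel integrals is 1 / sqrt (\<open>jac_norm 5 n\<close>) times
  the coefficient of one function \<open>F\<close> in the orthonormal system \<open>e\<close>;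
  Bessel's inequality and the growth of \<open>jac_norm\<close> absorb the weight. The indices n <
  5, where \<open>jac_norm 5 n\<close> is 0, are estimated with \<open>Qpoly\<close> itself.\<close>

lemma kernel_bessel:
  assumes T: "T > 0"
  obtains C where "C > 0" "\<And>a N. (\<And>j. j \<le> 5 \<Longrightarrow> sq_int (ivl T) (a j)) \<Longrightarrow>
    (\<Sum>n<N. (real n + 1) ^ 10 * (\<Sum>j\<le>5. \<integral>t. a j t * coef_kernel T n j t \<partial>ivl T)\<^sup>2) \<le> C * (\<Sum>j\<le>5. \<integral>t. (a j t)\<^sup>2 \<partial>ivl T)"
proof -
  let ?w = "\<lambda>t. sqrt (poly (wpoly T ^ 5) t)"
  have cw: "continuous_on UNIV ?w" by (intro continuous_intros)
  obtain B where B: "B > 0" "\<And>t. t \<in> {0..T} \<Longrightarrow> \<bar>?w t\<bar> \<le> B" using continuous_on_ivl_bounded[OF cw] by blast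
  \<comment> \<open>The first summand bounds (n + 1)^10 for n < 5. In the second, 6^5 comes from
    \<open>jac_norm_5_ge\<close>, B from the root of the weight and 252 from the combination of the
    \<open>a j\<close>.\<close>
  let ?C = "5 ^ 10 + 6 ^ 5 * B\<^sup>2 * 252"
  have ex: "\<bar>exp (- t)\<bar> \<le> 1" if "t \<in> {0<..<T}" for t using that by simp
  have "(\<Sum>n<N. (real n + 1) ^ 10 * (\<Sum>j\<le>5. \<integral>t. a j t * coef_kernel T n j t \<partial>ivl T)\<^sup>2) \<le> ?C * (\<Sum>j\<le>5. \<integral>t. (a j t)\<^sup>2 \<partial>ivl T)"
    if sq: "\<And>j. j \<le> 5 \<Longrightarrow> sq_int (ivl T) (a j)" for a N
  proof -
    define S where "S = (\<Sum>j\<le>5. \<integral>t. (a j t)\<^sup>2 \<partial>ivl T)"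
    define f where "f n = (\<Sum>j\<le>5. \<integral>t. a j t * coef_kernel T n j t \<partial>ivl T)" for n
    have low: "(\<Sum>n<5. (real n + 1) ^ 10 * (f n)\<^sup>2) \<le> 5 ^ 10 * S"
    proof -
      have se: "sq_int (ivl T) (\<lambda>t. a 0 t * exp (- t))"
        by (intro sq_int_mult_continuous sq continuous_intros) simp
      have fq: "f n = q_coef T (\<lambda>t. a 0 t * exp (- t)) n" if "n < 5" for n
      proof -
        have "f n = (\<Sum>j\<le>5::nat. if j = 0 then \<integral>t. a 0 t * (exp (- t) * poly (Qpoly T n) t) \<partial>ivl T else 0)"
          unfolding f_def by (rule sum.cong) (auto simp: coef_kernel_def that)
        then show ?thesis by (simp add: mult.assoc)
      qed
      have "(\<Sum>n<5. (real n + 1) ^ 10 * (f n)\<^sup>2) \<le> (\<Sum>n<5. 5 ^ 10 * (f n)\<^sup>2)"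
        by (intro sum_mono mult_right_mono power_mono) auto
      also have "\<dots> = 5 ^ 10 * (\<Sum>n<5. (f n)\<^sup>2)" by (rule sum_distrib_left[symmetric])
      also have "(\<Sum>n<5. (f n)\<^sup>2) = (\<Sum>n<5. (q_coef T (\<lambda>t. a 0 t * exp (- t)) n)\<^sup>2)"
        by (rule sum.cong) (simp_all add: fq)
      also have "\<dots> \<le> (\<integral>t. (a 0 t * exp (- t))\<^sup>2 \<partial>ivl T)" by (rule bessel_Qpoly[OF T se])
      also have "\<dots> \<le> (\<integral>t. (a 0 t)\<^sup>2 \<partial>ivl T)"
      proof (rule integral_mono)
        fix t assume "t \<in> space (ivl T)"
        then have "\<bar>a 0 t * exp (- t)\<bar> \<le> \<bar>a 0 t\<bar> * 1"
          unfolding abs_mult using ex by (intro mult_left_mono) (auto simp: space_restrict_space)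
        then show "(a 0 t * exp (- t))\<^sup>2 \<le> (a 0 t)\<^sup>2" by (simp add: abs_le_square_iff[symmetric])
      qed (use se sq[of 0] in \<open>auto simp: sq_int_def\<close>)
      also have "\<dots> \<le> S" unfolding S_def by (rule member_le_sum) (auto simp: integral_square_nonneg)
      finally show ?thesis by simp
    qed
    define b where "b t = (\<Sum>j\<le>5. coef5 j * a j t)" for t
    have sb: "sq_int (ivl T) b" unfolding b_def by (intro sq_int_sum sq_int_cmult sq) auto
    define F where "F t = b t * (exp (- t) * ?w t)" for t
    have sF: "sq_int (ivl T) F" unfolding F_def by (intro sq_int_mult_continuous sb continuous_intros)
    \<comment> \<open>The root of the weight goes to each factor of the inner product, which turns
      weighted orthogonality into orthonormality over \<open>ivl T\<close>.\<close>
    define e where "e n t = ?w t * poly ((pderiv ^^ 5) (Qpoly T n)) t / sqrt (jac_norm 5 n)" for n t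
    have ce: "continuous_on UNIV (e n)" for n
      unfolding e_def divide_inverse by (intro continuous_intros)
    have pos: "jac_norm 5 n > 0" if "n \<ge> 5" for n
      using that unfolding jac_norm_def by (intro prod_pos) auto
    have ww: "?w t * ?w t = poly (wpoly T ^ 5) t" if "t \<in> space (ivl T)" for t
    proof -
      have "poly (wpoly T ^ 5) t \<ge> 0" using that by (auto simp: poly_power poly_wpoly space_restrict_space)
      then show ?thesis by simp
    qed
    have on: "(\<integral>t. e n t * e m t \<partial>ivl T) = (if n = m then 1 else 0)" if "n \<ge> 5" "m \<ge> 5" for n m
    proof -
      have "(\<integral>t. e n t * e m t \<partial>ivl T) = (\<integral>t. (1 / (sqrt (jac_norm 5 n) * sqrt (jac_norm 5 m))) *
          poly (wpoly T ^ 5 * (pderiv ^^ 5) (Qpoly T n) * (pderiv ^^ 5) (Qpoly T m)) t \<partial>ivl T)"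
      proof (rule Bochner_Integration.integral_cong[OF refl])
        fix t assume t: "t \<in> space (ivl T)"
        show "e n t * e m t = (1 / (sqrt (jac_norm 5 n) * sqrt (jac_norm 5 m))) *
          poly (wpoly T ^ 5 * (pderiv ^^ 5) (Qpoly T n) * (pderiv ^^ 5) (Qpoly T m)) t"
        proof -
          obtain r where r: "?w t = r" by simp
          show ?thesis
            unfolding poly_mult e_def r ww[OF t, symmetric, unfolded r] by simp
        qed
      qed
      also have "\<dots> = (1 / (sqrt (jac_norm 5 n) * sqrt (jac_norm 5 m))) * pint T (wpoly T ^ 5 * (pderiv ^^ 5) (Qpoly T n) * (pderiv ^^ 5) (Qpoly T m))"
        unfolding pint_def by (rule Bochner_Integration.integral_mult_right_zero)
      also have "\<dots> = (if n = m then 1 else 0)"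
        unfolding pint_Qpoly_jac[OF T] using pos[OF that(1)] by auto
      finally show ?thesis .
    qed
    have fe: "f n = (1 / sqrt (jac_norm 5 n)) * (\<integral>t. F t * e n t \<partial>ivl T)" if "n \<ge> 5" for n
    proof -
      have "f n = (\<integral>t. (\<Sum>j\<le>5. a j t * coef_kernel T n j t) \<partial>ivl T)"
        unfolding f_def
        by (subst Bochner_Integration.integral_sum)
           (auto intro!: sq_int_ivl_integrable sq_int_mult_continuous sq continuous_coef_kernel)
      also have "\<dots> = (\<integral>t. (1 / sqrt (jac_norm 5 n)) * (F t * e n t) \<partial>ivl T)"
      proof (rule Bochner_Integration.integral_cong[OF refl])
        fix t assume t: "t \<in> space (ivl T)"
        have "(\<Sum>j\<le>5. a j t * coef_kernel T n j t) = (\<Sum>j\<le>5. coef5 j * a j t * (exp (- t) / jac_norm 5 n * (poly (wpoly T ^ 5 * (pderiv ^^ 5) (Qpoly T n)) t)))"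
          using that by (intro sum.cong) (auto simp: coef_kernel_def)
        also have "\<dots> = b t * (exp (- t) / jac_norm 5 n * (poly (wpoly T ^ 5 * (pderiv ^^ 5) (Qpoly T n)) t))"
          unfolding b_def by (rule sum_distrib_right[symmetric])
        also have "\<dots> = (1 / sqrt (jac_norm 5 n)) * (F t * e n t)"
        proof -
          obtain r where r: "?w t = r" by simp
          have "sqrt (jac_norm 5 n) * sqrt (jac_norm 5 n) = jac_norm 5 n" "sqrt (jac_norm 5 n) > 0"
            using pos[OF that] by simp_all
          then show ?thesis
            unfolding poly_mult F_def e_def r ww[OF t, symmetric, unfolded r] by simp
        qed
        finally show "(\<Sum>j\<le>5. a j t * coef_kernel T n j t) = (1 / sqrt (jac_norm 5 n)) * (F t * e n t)" .
      qed
      also have "\<dots> = (1 / sqrt (jac_norm 5 n)) * (\<integral>t. F t * e n t \<partial>ivl T)"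
        by (rule Bochner_Integration.integral_mult_right_zero)
      finally show ?thesis .
    qed
    have high: "(\<Sum>n\<in>{5..<N}. (real n + 1) ^ 10 * (f n)\<^sup>2) \<le> 6 ^ 5 * B\<^sup>2 * 252 * S"
    proof -
      have "(\<Sum>n\<in>{5..<N}. (real n + 1) ^ 10 * (f n)\<^sup>2) \<le> (\<Sum>n\<in>{5..<N}. 6 ^ 5 * (\<integral>t. F t * e n t \<partial>ivl T)\<^sup>2)"
      proof (rule sum_mono)
        fix n assume "n \<in> {5..<N}"
        then have n: "n \<ge> 5" by simp
        have "(real n + 1) ^ 10 * (f n)\<^sup>2 \<le> 6 ^ 5 * jac_norm 5 n * (f n)\<^sup>2"
          using jac_norm_5_ge[OF n] by (intro mult_right_mono) auto
        also have "\<dots> = 6 ^ 5 * (\<integral>t. F t * e n t \<partial>ivl T)\<^sup>2"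
          unfolding fe[OF n] using pos[OF n] by (simp add: power_mult_distrib power_divide)
        finally show "(real n + 1) ^ 10 * (f n)\<^sup>2 \<le> 6 ^ 5 * (\<integral>t. F t * e n t \<partial>ivl T)\<^sup>2" .
      qed
      also have "\<dots> = 6 ^ 5 * (\<Sum>n\<in>{5..<N}. (\<integral>t. F t * e n t \<partial>ivl T)\<^sup>2)" by (rule sum_distrib_left[symmetric])
      also have "\<dots> \<le> 6 ^ 5 * (\<integral>t. (F t)\<^sup>2 \<partial>ivl T)"
        by (intro mult_left_mono bessel_inequality) (simp_all add: sF sq_int_ivl_continuous ce on del: power_even_eq)
      also have "(\<integral>t. (F t)\<^sup>2 \<partial>ivl T) \<le> (\<integral>t. B\<^sup>2 * (252 * (\<Sum>j\<le>5. (a j t)\<^sup>2)) \<partial>ivl T)"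
      proof (rule integral_mono)
        fix t assume "t \<in> space (ivl T)"
        then have t: "t \<in> {0<..<T}" by (simp add: space_restrict_space)
        have "\<bar>exp (- t) * ?w t\<bar> \<le> 1 * B"
          unfolding abs_mult using ex[OF t] B(2)[of t] t by (intro mult_mono) auto
        then have "(exp (- t) * ?w t)\<^sup>2 \<le> B\<^sup>2" using B(1) by (simp add: abs_le_square_iff[symmetric])
        then have "(b t)\<^sup>2 * (exp (- t) * ?w t)\<^sup>2 \<le> (252 * (\<Sum>j\<le>5. (a j t)\<^sup>2)) * B\<^sup>2"
          using sum_square_le[of "\<lambda>j. a j t"] unfolding b_def by (intro mult_mono) (auto intro!: sum_nonneg)
        then show "(F t)\<^sup>2 \<le> B\<^sup>2 * (252 * (\<Sum>j\<le>5. (a j t)\<^sup>2))"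
          unfolding F_def power_mult_distrib by (simp add: mult_ac)
      qed (use sF sq in \<open>auto simp: sq_int_def\<close>)
      also have "\<dots> = B\<^sup>2 * (252 * S)"
        using sq by (simp add: S_def sq_int_def)
      finally show ?thesis by (simp add: mult_ac)
    qed
    have "(\<Sum>n<N. (real n + 1) ^ 10 * (f n)\<^sup>2) \<le> (\<Sum>n\<in>{..<5} \<union> {5..<N}. (real n + 1) ^ 10 * (f n)\<^sup>2)"
      by (rule sum_mono2) auto
    also have "\<dots> = (\<Sum>n<5. (real n + 1) ^ 10 * (f n)\<^sup>2) + (\<Sum>n\<in>{5..<N}. (real n + 1) ^ 10 * (f n)\<^sup>2)"
      by (rule sum.union_disjoint) auto
    also have "\<dots> \<le> ?C * S" using low high by (simp add: algebra_simps)
    finally show ?thesis by (simp add: f_def S_def)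
  qed
  moreover have "?C > 0" by (simp add: add_pos_nonneg)
  ultimately show ?thesis using that by blast
qed

section \<open>The series of second derivatives\<close>

lemma sigma_finite_ivl: "sigma_finite_measure (ivl T)"
  using finite_measure_ivl by (simp add: finite_measure_def)

lemma continuous_Psi2: "continuous_on UNIV (Psi2 T n)"
  unfolding Psi2_eq by (intro continuous_intros)

lemma Psi2_measurable[measurable]: "Psi2 T n \<in> borel_measurable borel"
  by (rule borel_measurable_continuous_onI[OF continuous_Psi2])

lemma nn_integral_Psi2_square_le:
  assumes T: "T > 0"
  obtains C where "C > 0" "\<And>n. (\<integral>\<^sup>+ t. ennreal ((Psi2 T n t)\<^sup>2) \<partial>ivl T) \<le> ennreal (C * (real n + 1) ^ 7)"
proof -
  obtain C where C: "C > 0" "\<And>n. pint T (Psi2poly T n * Psi2poly T n) \<le> C * (real n + 1) ^ 7"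
    using pint_Psi2poly_square_le[OF T] by blast
  have "(\<integral>\<^sup>+ t. ennreal ((Psi2 T n t)\<^sup>2) \<partial>ivl T) \<le> ennreal ((exp T)\<^sup>2 * C * (real n + 1) ^ 7)" for n
  proof -
    have "(\<integral>\<^sup>+ t. ennreal ((Psi2 T n t)\<^sup>2) \<partial>ivl T) \<le> (\<integral>\<^sup>+ t. ennreal ((exp T)\<^sup>2 * poly (Psi2poly T n * Psi2poly T n) t) \<partial>ivl T)"
    proof (rule nn_integral_mono)
      fix t assume "t \<in> space (ivl T)"
      then have "(exp t)\<^sup>2 \<le> (exp T)\<^sup>2" by (intro power_mono) (auto simp: space_restrict_space)
      then show "ennreal ((Psi2 T n t)\<^sup>2) \<le> ennreal ((exp T)\<^sup>2 * poly (Psi2poly T n * Psi2poly T n) t)"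
        unfolding Psi2_eq power_mult_distrib poly_mult power2_eq_square[of "poly _ _"]
        by (intro ennreal_leI mult_right_mono) auto
    qed
    also have "\<dots> = ennreal (\<integral>t. (exp T)\<^sup>2 * poly (Psi2poly T n * Psi2poly T n) t \<partial>ivl T)"
      by (rule nn_integral_eq_integral) (auto intro!: continuous_on_imp_integrable_ivl continuous_intros)
    also have "\<dots> = ennreal ((exp T)\<^sup>2 * pint T (Psi2poly T n * Psi2poly T n))"
      unfolding pint_def by (simp only: Bochner_Integration.integral_mult_right_zero)
    also have "\<dots> \<le> ennreal ((exp T)\<^sup>2 * C * (real n + 1) ^ 7)"
      using C(2)[of n] by (intro ennreal_leI) (simp add: mult.assoc mult_left_mono)
    finally show ?thesis .
  qed
  then show ?thesis using C(1) by (intro that[of "(exp T)\<^sup>2 * C"]) auto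
qed

section \<open>Majorants for the series\<close>

definition inv_sq_tail :: "nat \<Rightarrow> real" where "inv_sq_tail N = (\<Sum>n. 1 / (real (n + N) + 1)\<^sup>2)"

lemma summable_inverse_square_Suc: "summable (\<lambda>n. 1 / (real n + 1)\<^sup>2)"
  using inverse_power_summable[of 2, where 'a=real] summable_Suc_iff[of "\<lambda>n. inverse (real n ^ 2)"]
  by (simp add: inverse_eq_divide add.commute)

lemma inv_sq_tail_tendsto_0: "inv_sq_tail \<longlonglongrightarrow> 0"
proof -
  let ?f = "\<lambda>n. 1 / (real n + 1)\<^sup>2"
  have "(\<lambda>N. suminf ?f - (\<Sum>n<N. ?f n)) \<longlonglongrightarrow> suminf ?f - suminf ?f"
    by (intro tendsto_intros summable_LIMSEQ summable_inverse_square_Suc)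
  then show ?thesis
    using suminf_minus_initial_segment[OF summable_inverse_square_Suc] by (simp add: inv_sq_tail_def[abs_def])
qed

lemma inv_sq_tail_nonneg: "inv_sq_tail N \<ge> 0"
  unfolding inv_sq_tail_def
  using summable_iff_shift[of "\<lambda>n. 1 / (real n + 1)\<^sup>2" N] summable_inverse_square_Suc
  by (intro suminf_nonneg) (simp_all add: add.assoc)

lemma sum_inverse_square_le_inv_sq_tail: "(\<Sum>n\<in>{N..<M}. 1 / (real n + 1)\<^sup>2) \<le> inv_sq_tail N"
proof -
  have "(\<Sum>n\<in>{N..<M}. 1 / (real n + 1)\<^sup>2) = (\<Sum>n<M - N. 1 / (real (n + N) + 1)\<^sup>2)"
    by (rule sum.reindex_bij_witness[of _ "\<lambda>n. n + N" "\<lambda>n. n - N"]) auto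
  also have "\<dots> \<le> inv_sq_tail N" unfolding inv_sq_tail_def
    using summable_iff_shift[of "\<lambda>n. 1 / (real n + 1)\<^sup>2" N] summable_inverse_square_Suc
    by (intro sum_le_suminf) (simp_all add: add.assoc)
  finally show ?thesis .
qed

text \<open>Split x n into 1 / (n + 1) and (n + 1) x n and apply Cauchy-Schwarz to blocks. The first
  factor is a tail independent of x, so the single number w controls summability, rate of
  convergence and size of partial sums; \<open>ennreal\<close> prepares for integration.\<close>

lemma weighted_square_summable:
  fixes x :: "nat \<Rightarrow> real"
  assumes fin: "(\<Sum>n. ennreal ((real n + 1)\<^sup>2 * (x n)\<^sup>2)) < \<infinity>"
  defines "w \<equiv> (\<Sum>n. ennreal ((real n + 1)\<^sup>2 * (x n)\<^sup>2))"
  shows "summable x"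
    and "ennreal (((\<Sum>n<N. x n) - suminf x)\<^sup>2) \<le> ennreal (inv_sq_tail N) * w"
    and "ennreal ((\<Sum>n<N. x n)\<^sup>2) \<le> ennreal (inv_sq_tail 0) * w"
proof -
  define y where "y n = (real n + 1)\<^sup>2 * (x n)\<^sup>2" for n
  have y0: "y n \<ge> 0" for n by (simp add: y_def)
  have sy: "summable y"
    by (rule summable_suminf_not_top[of y, OF y0]) (use fin in \<open>simp add: y_def less_top\<close>)
  have wy: "w = ennreal (suminf y)"
    using suminf_ennreal2[OF y0 sy] unfolding w_def y_def .
  have xb: "\<bar>x n\<bar> \<le> 1 / (real n + 1)\<^sup>2 + y n" for n
  proof -
    have "\<bar>x n\<bar> = (1 / (real n + 1)) * ((real n + 1) * \<bar>x n\<bar>)" by simp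
    also have "\<dots> \<le> (1 / (real n + 1))\<^sup>2 + ((real n + 1) * \<bar>x n\<bar>)\<^sup>2"
      using sum_squares_bound[of "1 / (real n + 1)" "(real n + 1) * \<bar>x n\<bar>"]
        mult_nonneg_nonneg[of "1 / (real n + 1)" "(real n + 1) * \<bar>x n\<bar>"] by simp
    finally show ?thesis by (simp add: y_def power_divide power_mult_distrib)
  qed
  show sx: "summable x"
    by (rule summable_comparison_test[OF _ summable_add[OF summable_inverse_square_Suc sy]])
       (use xb in auto)
  have blk: "(\<Sum>n\<in>{N..<M}. x n)\<^sup>2 \<le> inv_sq_tail N * suminf y" for N M
  proof -
    have "(\<Sum>n\<in>{N..<M}. x n)\<^sup>2 = (\<Sum>n\<in>{N..<M}. (1 / (real n + 1)) * ((real n + 1) * x n))\<^sup>2"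
      by simp
    also have "\<dots> \<le> (\<Sum>n\<in>{N..<M}. (1 / (real n + 1))\<^sup>2) * (\<Sum>n\<in>{N..<M}. ((real n + 1) * x n)\<^sup>2)"
      by (rule Cauchy_Schwarz_ineq_sum)
    also have "\<dots> = (\<Sum>n\<in>{N..<M}. 1 / (real n + 1)\<^sup>2) * (\<Sum>n\<in>{N..<M}. y n)"
      by (simp add: power_divide power_mult_distrib y_def)
    also have "\<dots> \<le> inv_sq_tail N * suminf y"
      by (intro mult_mono sum_inverse_square_le_inv_sq_tail sum_le_suminf sy inv_sq_tail_nonneg sum_nonneg) (auto simp: y0)
    finally show ?thesis .
  qed
  have "((\<Sum>n<N. x n) - suminf x)\<^sup>2 \<le> inv_sq_tail N * suminf y" for N
  proof (rule tendsto_upperbound)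
    show "(\<lambda>M. ((\<Sum>n<N. x n) - (\<Sum>n<M. x n))\<^sup>2) \<longlonglongrightarrow> ((\<Sum>n<N. x n) - suminf x)\<^sup>2"
      by (intro tendsto_intros summable_LIMSEQ sx)
    show "\<forall>\<^sub>F M in sequentially. ((\<Sum>n<N. x n) - (\<Sum>n<M. x n))\<^sup>2 \<le> inv_sq_tail N * suminf y"
      using eventually_ge_at_top[of N]
    proof eventually_elim
      case (elim M)
      then have "(\<Sum>n<M. x n) = (\<Sum>n<N. x n) + (\<Sum>n\<in>{N..<M}. x n)"
        by (metis lessThan_atLeast0 sum.atLeastLessThan_concat zero_le)
      then show ?case using blk[of N M] by simp
    qed
  qed simp
  then show "ennreal (((\<Sum>n<N. x n) - suminf x)\<^sup>2) \<le> ennreal (inv_sq_tail N) * w"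
    unfolding wy using inv_sq_tail_nonneg suminf_nonneg[OF sy y0] by (simp add: ennreal_leI flip: ennreal_mult)
  show "ennreal ((\<Sum>n<N. x n)\<^sup>2) \<le> ennreal (inv_sq_tail 0) * w"
    unfolding wy using blk[of 0 N] inv_sq_tail_nonneg suminf_nonneg[OF sy y0]
    by (simp add: ennreal_leI lessThan_atLeast0 flip: ennreal_mult)
qed

text \<open>\<open>W\<close> is the number w of the previous lemma at the point (z, t). Each of its
  terms is a function of z times a function of t, so its double integral is computed term by term;
  finiteness then makes \<open>W\<close> finite almost everywhere.\<close>

lemma series_Psi2_majorant:
  fixes c :: "nat \<Rightarrow> 'z \<Rightarrow> real"
  assumes T: "T > 0" and [measurable]: "\<And>n. c n \<in> borel_measurable Z"
    and fin: "(\<Sum>n. ennreal ((real n + 1) ^ 10) * (\<integral>\<^sup>+ z. ennreal ((c n z)\<^sup>2) \<partial>Z)) < \<infinity>"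
  obtains W :: "'z \<Rightarrow> real \<Rightarrow> ennreal" where
    "\<And>t. (\<lambda>z. W z t) \<in> borel_measurable Z"
    "(\<lambda>t. \<integral>\<^sup>+ z. W z t \<partial>Z) \<in> borel_measurable (ivl T)"
    "(\<integral>\<^sup>+ t. \<integral>\<^sup>+ z. W z t \<partial>Z \<partial>ivl T) < \<infinity>"
    "AE t in ivl T. (\<integral>\<^sup>+ z. W z t \<partial>Z) < \<infinity>"
    "AE t in ivl T. AE z in Z. summable (\<lambda>n. c n z * Psi2 T n t)"
    "AE t in ivl T. AE z in Z. \<forall>N. ennreal (((\<Sum>n<N. c n z * Psi2 T n t) - (\<Sum>n. c n z * Psi2 T n t))\<^sup>2) \<le> ennreal (inv_sq_tail N) * W z t"
    "AE t in ivl T. AE z in Z. \<forall>N. ennreal ((\<Sum>n<N. c n z * Psi2 T n t)\<^sup>2) \<le> ennreal (inv_sq_tail 0) * W z t"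
proof -
  define W where "W z t = (\<Sum>n. ennreal ((real n + 1)\<^sup>2 * (c n z * Psi2 T n t)\<^sup>2))" for z t
  have We: "W z t = (\<Sum>n. ennreal ((real n + 1)\<^sup>2 * (Psi2 T n t)\<^sup>2) * ennreal ((c n z)\<^sup>2))" for z t
    unfolding W_def by (simp add: power_mult_distrib mult_ac flip: ennreal_mult)
  have m1: "(\<lambda>z. W z t) \<in> borel_measurable Z" for t
    unfolding W_def by measurable
  have S: "(\<integral>\<^sup>+ z. W z t \<partial>Z) = (\<Sum>n. ennreal ((real n + 1)\<^sup>2 * (Psi2 T n t)\<^sup>2) * (\<integral>\<^sup>+ z. ennreal ((c n z)\<^sup>2) \<partial>Z))" for t
    unfolding We by (subst nn_integral_suminf) (simp_all add: nn_integral_cmult)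
  have Pm [measurable]: "Psi2 T n \<in> borel_measurable (ivl T)" for n
    by (rule borel_measurable_ivl) simp
  have m2: "(\<lambda>t. \<integral>\<^sup>+ z. W z t \<partial>Z) \<in> borel_measurable (ivl T)"
    unfolding S by measurable
  obtain C where C: "C > 0" "\<And>n. (\<integral>\<^sup>+ t. ennreal ((Psi2 T n t)\<^sup>2) \<partial>ivl T) \<le> ennreal (C * (real n + 1) ^ 7)"
    using nn_integral_Psi2_square_le[OF T] by blast
  have "(\<integral>\<^sup>+ t. \<integral>\<^sup>+ z. W z t \<partial>Z \<partial>ivl T) =
      (\<Sum>n. (\<integral>\<^sup>+ t. ennreal ((real n + 1)\<^sup>2 * (Psi2 T n t)\<^sup>2) \<partial>ivl T) * (\<integral>\<^sup>+ z. ennreal ((c n z)\<^sup>2) \<partial>Z))"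
    unfolding S by (subst nn_integral_suminf) (simp_all add: nn_integral_multc)
  also have "\<dots> \<le> (\<Sum>n. ennreal C * (ennreal ((real n + 1) ^ 10) * (\<integral>\<^sup>+ z. ennreal ((c n z)\<^sup>2) \<partial>Z)))"
  proof (rule suminf_le)
    fix n
    have "(\<integral>\<^sup>+ t. ennreal ((real n + 1)\<^sup>2 * (Psi2 T n t)\<^sup>2) \<partial>ivl T) = ennreal ((real n + 1)\<^sup>2) * (\<integral>\<^sup>+ t. ennreal ((Psi2 T n t)\<^sup>2) \<partial>ivl T)"
      by (subst nn_integral_cmult[symmetric]) (simp_all add: ennreal_mult)
    also have "\<dots> \<le> ennreal ((real n + 1)\<^sup>2) * ennreal (C * (real n + 1) ^ 7)"
      by (intro mult_left_mono C) auto
    also have "\<dots> = ennreal (C * (real n + 1) ^ 9)"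
      using C(1) by (simp add: mult_ac flip: ennreal_mult power_add)
    \<comment> \<open>The exponent 9 is 2 from the Cauchy-Schwarz weight plus 7 from
      \<open>Psi2\<close>; one power is to spare.\<close>
    also have "\<dots> \<le> ennreal (C * (real n + 1) ^ 10)"
      using C(1) by (intro ennreal_leI mult_left_mono power_increasing) auto
    also have "\<dots> = ennreal C * ennreal ((real n + 1) ^ 10)"
      using C(1) by (simp add: ennreal_mult)
    finally show "(\<integral>\<^sup>+ t. ennreal ((real n + 1)\<^sup>2 * (Psi2 T n t)\<^sup>2) \<partial>ivl T) * (\<integral>\<^sup>+ z. ennreal ((c n z)\<^sup>2) \<partial>Z)
       \<le> ennreal C * (ennreal ((real n + 1) ^ 10) * (\<integral>\<^sup>+ z. ennreal ((c n z)\<^sup>2) \<partial>Z))"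
      by (simp add: mult_right_mono flip: mult.assoc)
  qed auto
  also have "\<dots> = ennreal C * (\<Sum>n. ennreal ((real n + 1) ^ 10) * (\<integral>\<^sup>+ z. ennreal ((c n z)\<^sup>2) \<partial>Z))"
    by (rule ennreal_suminf_cmult)
  also have "\<dots> < \<infinity>" using fin by (simp add: ennreal_mult_less_top)
  finally have f: "(\<integral>\<^sup>+ t. \<integral>\<^sup>+ z. W z t \<partial>Z \<partial>ivl T) < \<infinity>" .
  have ae: "AE t in ivl T. (\<integral>\<^sup>+ z. W z t \<partial>Z) < \<infinity>"
    using nn_integral_noteq_infinite[OF m2] f by (auto simp: less_top)
  have ae2: "AE t in ivl T. AE z in Z. W z t < \<infinity>"
    using ae
  proof eventually_elim
    case (elim t)
    then show ?case using nn_integral_noteq_infinite[OF m1[of t]] by (auto simp: less_top)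
  qed
  have p: "summable (\<lambda>n. c n z * Psi2 T n t)"
    "ennreal (((\<Sum>n<N. c n z * Psi2 T n t) - (\<Sum>n. c n z * Psi2 T n t))\<^sup>2) \<le> ennreal (inv_sq_tail N) * W z t"
    "ennreal ((\<Sum>n<N. c n z * Psi2 T n t)\<^sup>2) \<le> ennreal (inv_sq_tail 0) * W z t"
    if "W z t < \<infinity>" for z t N
    using weighted_square_summable[of "\<lambda>n. c n z * Psi2 T n t"] that unfolding W_def by blast+
  show ?thesis
    by (rule that[OF m1 m2 f ae])
       (use ae2 in \<open>auto elim!: eventually_mono intro: p simp del: infinity_ennreal_def\<close>)
qed

lemma sq_int_iff_nn_integral:
  "f \<in> borel_measurable M \<Longrightarrow> sq_int M f \<longleftrightarrow> (\<integral>\<^sup>+ x. ennreal ((f x)\<^sup>2) \<partial>M) < \<infinity>"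
  unfolding sq_int_def by (auto simp: integrable_iff_bounded)

lemma measurable_pair_ivl:
  assumes "case_prod f \<in> borel_measurable (Z \<Otimes>\<^sub>M lborel)"
  shows "case_prod f \<in> borel_measurable (Z \<Otimes>\<^sub>M ivl T)"
proof -
  have "(\<lambda>x. (fst x, snd x)) \<in> Z \<Otimes>\<^sub>M ivl T \<rightarrow>\<^sub>M Z \<Otimes>\<^sub>M lborel"
    by (intro measurable_Pair measurable_fst measurable_compose[OF measurable_snd] measurable_restrict_space1 measurable_ident_sets) auto
  from measurable_compose[OF this assms] show ?thesis by simp
qed

text \<open>For almost every z \<open>kernel_bessel\<close> bounds all partial sums at once;
  integrating over z and using Tonelli leaves the squared norms of the \<open>f j\<close>.\<close>

lemma kernel_coefficients_summable:
  fixes f :: "nat \<Rightarrow> 'z \<Rightarrow> real \<Rightarrow> real" and c :: "nat \<Rightarrow> 'z \<Rightarrow> real"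
  assumes T: "T > 0" and Z: "sigma_finite_measure Z"
    and f: "\<And>j. j \<le> 5 \<Longrightarrow> case_prod (f j) \<in> borel_measurable (Z \<Otimes>\<^sub>M lborel)"
    and fin: "\<And>j. j \<le> 5 \<Longrightarrow> (\<integral>\<^sup>+ t. \<integral>\<^sup>+ z. ennreal ((f j z t)\<^sup>2) \<partial>Z \<partial>ivl T) < \<infinity>"
    and c[measurable]: "\<And>n. c n \<in> borel_measurable Z"
    and eq: "\<And>n. AE z in Z. c n z = (\<Sum>j\<le>5. \<integral>t. f j z t * coef_kernel T n j t \<partial>ivl T)"
  shows "(\<Sum>n. ennreal ((real n + 1) ^ 10) * (\<integral>\<^sup>+ z. ennreal ((c n z)\<^sup>2) \<partial>Z)) < \<infinity>"
proof -
  interpret Z: sigma_finite_measure Z by (rule Z)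
  interpret I: sigma_finite_measure "ivl T" by (rule sigma_finite_ivl)
  interpret P: pair_sigma_finite Z "ivl T" ..
  obtain C where C: "C > 0" "\<And>a N. (\<And>j. j \<le> 5 \<Longrightarrow> sq_int (ivl T) (a j)) \<Longrightarrow>
    (\<Sum>n<N. (real n + 1) ^ 10 * (\<Sum>j\<le>5. \<integral>t. a j t * coef_kernel T n j t \<partial>ivl T)\<^sup>2) \<le> C * (\<Sum>j\<le>5. \<integral>t. (a j t)\<^sup>2 \<partial>ivl T)"
    using kernel_bessel[OF T] by blast
  have fm: "(\<lambda>x. f j (fst x) (snd x)) \<in> borel_measurable (Z \<Otimes>\<^sub>M ivl T)" if "j \<le> 5" for j
    using measurable_pair_ivl[OF f[OF that]] by (simp add: case_prod_beta')
  have m2: "(\<lambda>x. ennreal ((f j (fst x) (snd x))\<^sup>2)) \<in> borel_measurable (Z \<Otimes>\<^sub>M ivl T)" if "j \<le> 5" for j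
    using fm[OF that] by measurable
  have fz: "f j z \<in> borel_measurable (ivl T)" if "j \<le> 5" "z \<in> space Z" for j z
    using measurable_compose[OF measurable_Pair1'[OF that(2)] fm[OF that(1)]] by simp
  define q where "q j z = (\<integral>\<^sup>+ t. ennreal ((f j z t)\<^sup>2) \<partial>ivl T)" for j z
  have qm: "q j \<in> borel_measurable Z" if "j \<le> 5" for j
    unfolding q_def using I.borel_measurable_nn_integral_fst[OF m2[OF that]] by simp
  have qi: "(\<integral>\<^sup>+ z. q j z \<partial>Z) < \<infinity>" if "j \<le> 5" for j
    using P.Fubini[OF m2[OF that]] fin[OF that] by (simp add: q_def)
  have "AE z in Z. q j z < \<infinity>" if "j \<le> 5" for j
    using nn_integral_noteq_infinite[OF qm[OF that]] qi[OF that] by (auto simp: less_top)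
  then have qf: "AE z in Z. \<forall>j\<in>{..5}. q j z < \<infinity>"
    by (subst AE_ball_countable) auto
  have eq': "AE z in Z. \<forall>n. c n z = (\<Sum>j\<le>5. \<integral>t. f j z t * coef_kernel T n j t \<partial>ivl T)"
    using eq by (simp add: AE_all_countable)
  have "(\<Sum>n. ennreal ((real n + 1) ^ 10) * (\<integral>\<^sup>+ z. ennreal ((c n z)\<^sup>2) \<partial>Z))
     = (\<integral>\<^sup>+ z. (\<Sum>n. ennreal ((real n + 1) ^ 10 * (c n z)\<^sup>2)) \<partial>Z)"
    by (subst nn_integral_suminf) (simp_all add: ennreal_mult nn_integral_cmult)
  also have "\<dots> \<le> (\<integral>\<^sup>+ z. ennreal C * (\<Sum>j\<le>5. q j z) \<partial>Z)"
  proof (rule nn_integral_mono_AE)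
    show "AE z in Z. (\<Sum>n. ennreal ((real n + 1) ^ 10 * (c n z)\<^sup>2)) \<le> ennreal C * (\<Sum>j\<le>5. q j z)"
      using qf eq' AE_space
    proof eventually_elim
      case (elim z)
      then have s: "sq_int (ivl T) (f j z)" if "j \<le> 5" for j
        using that by (auto simp: sq_int_iff_nn_integral[OF fz] q_def)
      have qe: "q j z = ennreal (\<integral>t. (f j z t)\<^sup>2 \<partial>ivl T)" if "j \<le> 5" for j
        unfolding q_def using s[OF that] by (intro nn_integral_eq_integral) (auto simp: sq_int_def)
      have "(\<Sum>n<N. ennreal ((real n + 1) ^ 10 * (c n z)\<^sup>2)) \<le> ennreal C * (\<Sum>j\<le>5. q j z)" for N
      proof -
        have "(\<Sum>n<N. ennreal ((real n + 1) ^ 10 * (c n z)\<^sup>2)) = ennreal (\<Sum>n<N. (real n + 1) ^ 10 * (c n z)\<^sup>2)"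
          by (rule sum_ennreal) simp
        also have "\<dots> \<le> ennreal (C * (\<Sum>j\<le>5. \<integral>t. (f j z t)\<^sup>2 \<partial>ivl T))"
          using C(2)[of "\<lambda>j. f j z" N] s elim by (intro ennreal_leI) simp
        also have "\<dots> = ennreal C * (\<Sum>j\<le>5. ennreal (\<integral>t. (f j z t)\<^sup>2 \<partial>ivl T))"
          using C(1) by (subst sum_ennreal) (auto simp: integral_square_nonneg ennreal_mult sum_nonneg)
        also have "\<dots> = ennreal C * (\<Sum>j\<le>5. q j z)" by (simp add: qe)
        finally show ?thesis .
      qed
      then show ?case by (intro suminf_le_const) auto
    qed
  qed
  also have "\<dots> = ennreal C * (\<Sum>j\<le>5. \<integral>\<^sup>+ z. q j z \<partial>Z)"
  proof -
    have "(\<integral>\<^sup>+ z. ennreal C * (\<Sum>j\<le>5. q j z) \<partial>Z) = ennreal C * (\<integral>\<^sup>+ z. (\<Sum>j\<le>5. q j z) \<partial>Z)"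
      by (intro nn_integral_cmult borel_measurable_sum qm) simp
    also have "(\<integral>\<^sup>+ z. (\<Sum>j\<le>5. q j z) \<partial>Z) = (\<Sum>j\<le>5. \<integral>\<^sup>+ z. q j z \<partial>Z)"
      by (intro nn_integral_sum qm) simp
    finally show ?thesis .
  qed
  also have "\<dots> < \<infinity>"
    using qi by (simp add: ennreal_mult_less_top ennreal_sum_less_top)
  finally show ?thesis .
qed

lemma inv_sq_tail_times_tendsto_0: 
  assumes "K < \<infinity>" shows "(\<lambda>N. ennreal (inv_sq_tail N) * K) \<longlonglongrightarrow> 0"
proof -
  obtain k where k: "k \<ge> 0" "K = ennreal k" using assms by (auto simp: less_top_ennreal)
  have "(\<lambda>N. ennreal (inv_sq_tail N * k)) \<longlonglongrightarrow> ennreal (0 * k)"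
    by (intro tendsto_intros inv_sq_tail_tendsto_0)
  then show ?thesis using k inv_sq_tail_nonneg by (simp add: ennreal_mult)
qed

text \<open>The integrated statements give the norms; the ones at almost every t serve to pass
  spatial weak derivatives to the limit, since those are posed at fixed t.\<close>

lemma series_Psi2_slices:
  fixes c :: "nat \<Rightarrow> 'z \<Rightarrow> real"
  assumes T: "T > 0" and c: "\<And>n. c n \<in> borel_measurable Z"
    and fin: "(\<Sum>n. ennreal ((real n + 1) ^ 10) * (\<integral>\<^sup>+ z. ennreal ((c n z)\<^sup>2) \<partial>Z)) < \<infinity>"
  defines "S \<equiv> \<lambda>N z t. \<Sum>n<N. c n z * Psi2 T n t" and "w \<equiv> \<lambda>z t. \<Sum>n. c n z * Psi2 T n t"
  shows "AE t in ivl T. AE z in Z. summable (\<lambda>n. c n z * Psi2 T n t)"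
    and "AE t in ivl T. (\<forall>N. (\<integral>\<^sup>+ z. ennreal ((S N z t)\<^sup>2) \<partial>Z) < \<infinity>) \<and> (\<integral>\<^sup>+ z. ennreal ((w z t)\<^sup>2) \<partial>Z) < \<infinity>
       \<and> (\<lambda>N. \<integral>\<^sup>+ z. ennreal ((S N z t - w z t)\<^sup>2) \<partial>Z) \<longlonglongrightarrow> 0"
    and "(\<lambda>N. \<integral>\<^sup>+ t. \<integral>\<^sup>+ z. ennreal ((S N z t - w z t)\<^sup>2) \<partial>Z \<partial>ivl T) \<longlonglongrightarrow> 0"
    and "(\<integral>\<^sup>+ t. \<integral>\<^sup>+ z. ennreal ((S N z t)\<^sup>2) \<partial>Z \<partial>ivl T) < \<infinity>"
    and "(\<integral>\<^sup>+ t. \<integral>\<^sup>+ z. ennreal ((w z t)\<^sup>2) \<partial>Z \<partial>ivl T) < \<infinity>"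
proof -
  obtain W :: "'z \<Rightarrow> real \<Rightarrow> ennreal" where
    W: "\<And>t. (\<lambda>z. W z t) \<in> borel_measurable Z"
    "(\<lambda>t. \<integral>\<^sup>+ z. W z t \<partial>Z) \<in> borel_measurable (ivl T)"
    "(\<integral>\<^sup>+ t. \<integral>\<^sup>+ z. W z t \<partial>Z \<partial>ivl T) < \<infinity>"
    "AE t in ivl T. (\<integral>\<^sup>+ z. W z t \<partial>Z) < \<infinity>"
    "AE t in ivl T. AE z in Z. summable (\<lambda>n. c n z * Psi2 T n t)"
    "AE t in ivl T. AE z in Z. \<forall>N. ennreal (((\<Sum>n<N. c n z * Psi2 T n t) - (\<Sum>n. c n z * Psi2 T n t))\<^sup>2) \<le> ennreal (inv_sq_tail N) * W z t"
    "AE t in ivl T. AE z in Z. \<forall>N. ennreal ((\<Sum>n<N. c n z * Psi2 T n t)\<^sup>2) \<le> ennreal (inv_sq_tail 0) * W z t"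
    apply (rule series_Psi2_majorant[OF T c fin])
    apply (rule that; assumption)
    done
  have b1: "AE t in ivl T. \<forall>N. (\<integral>\<^sup>+ z. ennreal ((S N z t - w z t)\<^sup>2) \<partial>Z) \<le> ennreal (inv_sq_tail N) * (\<integral>\<^sup>+ z. W z t \<partial>Z)"
    using W(6)
  proof eventually_elim
    case (elim t)
    show ?case unfolding S_def w_def
      by (subst nn_integral_cmult[OF W(1), symmetric])
         (intro allI nn_integral_mono_AE eventually_mono[OF elim], blast)
  qed
  have b2: "AE t in ivl T. \<forall>N. (\<integral>\<^sup>+ z. ennreal ((S N z t)\<^sup>2) \<partial>Z) \<le> ennreal (inv_sq_tail 0) * (\<integral>\<^sup>+ z. W z t \<partial>Z)"
    using W(7)
  proof eventually_elim
    case (elim t)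
    show ?case unfolding S_def
      by (subst nn_integral_cmult[OF W(1), symmetric])
         (intro allI nn_integral_mono_AE eventually_mono[OF elim], blast)
  qed
  \<comment> \<open>The empty partial sum turns the error bound at N = 0 into a bound for the sum
    itself.\<close>
  have w0: "S 0 z t - w z t = - w z t" for z t by (simp add: S_def)
  have b3: "AE t in ivl T. (\<integral>\<^sup>+ z. ennreal ((w z t)\<^sup>2) \<partial>Z) \<le> ennreal (inv_sq_tail 0) * (\<integral>\<^sup>+ z. W z t \<partial>Z)"
    using b1
  proof eventually_elim
    case (elim t)
    then show ?case using spec[OF elim, of 0] by (simp add: w0)
  qed
  show "AE t in ivl T. AE z in Z. summable (\<lambda>n. c n z * Psi2 T n t)" by (rule W(5))
  show "AE t in ivl T. (\<forall>N. (\<integral>\<^sup>+ z. ennreal ((S N z t)\<^sup>2) \<partial>Z) < \<infinity>) \<and> (\<integral>\<^sup>+ z. ennreal ((w z t)\<^sup>2) \<partial>Z) < \<infinity>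
       \<and> (\<lambda>N. \<integral>\<^sup>+ z. ennreal ((S N z t - w z t)\<^sup>2) \<partial>Z) \<longlonglongrightarrow> 0"
    using b1 b2 b3 W(4)
  proof eventually_elim
    case (elim t)
    have K: "ennreal (inv_sq_tail 0) * (\<integral>\<^sup>+ z. W z t \<partial>Z) < \<infinity>" using elim(4) by (simp add: ennreal_mult_less_top)
    have "(\<lambda>N. \<integral>\<^sup>+ z. ennreal ((S N z t - w z t)\<^sup>2) \<partial>Z) \<longlonglongrightarrow> 0"
      by (rule tendsto_sandwich[OF _ _ tendsto_const inv_sq_tail_times_tendsto_0[OF elim(4)]]) (use elim(1) in auto)
    then show ?case using elim K by (meson le_less_trans)
  qed
  have i: "(\<integral>\<^sup>+ t. ennreal (inv_sq_tail N) * (\<integral>\<^sup>+ z. W z t \<partial>Z) \<partial>ivl T) = ennreal (inv_sq_tail N) * (\<integral>\<^sup>+ t. \<integral>\<^sup>+ z. W z t \<partial>Z \<partial>ivl T)" for N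
    by (rule nn_integral_cmult[OF W(2)])
  have f: "ennreal (inv_sq_tail 0) * (\<integral>\<^sup>+ t. \<integral>\<^sup>+ z. W z t \<partial>Z \<partial>ivl T) < \<infinity>"
    using W(3) by (simp add: ennreal_mult_less_top)
  have "(\<integral>\<^sup>+ t. \<integral>\<^sup>+ z. ennreal ((S N z t - w z t)\<^sup>2) \<partial>Z \<partial>ivl T) \<le> ennreal (inv_sq_tail N) * (\<integral>\<^sup>+ t. \<integral>\<^sup>+ z. W z t \<partial>Z \<partial>ivl T)" for N
    unfolding i[symmetric] using b1 by (auto intro!: nn_integral_mono_AE elim!: eventually_mono)
  then show "(\<lambda>N. \<integral>\<^sup>+ t. \<integral>\<^sup>+ z. ennreal ((S N z t - w z t)\<^sup>2) \<partial>Z \<partial>ivl T) \<longlonglongrightarrow> 0"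
    by (intro tendsto_sandwich[OF _ _ tendsto_const inv_sq_tail_times_tendsto_0[OF W(3)]]) auto
  have "(\<integral>\<^sup>+ t. \<integral>\<^sup>+ z. ennreal ((S N z t)\<^sup>2) \<partial>Z \<partial>ivl T) \<le> ennreal (inv_sq_tail 0) * (\<integral>\<^sup>+ t. \<integral>\<^sup>+ z. W z t \<partial>Z \<partial>ivl T)"
    unfolding i[symmetric] using b2 by (auto intro!: nn_integral_mono_AE elim!: eventually_mono)
  then show "(\<integral>\<^sup>+ t. \<integral>\<^sup>+ z. ennreal ((S N z t)\<^sup>2) \<partial>Z \<partial>ivl T) < \<infinity>" using f by (rule le_less_trans)
  have "(\<integral>\<^sup>+ t. \<integral>\<^sup>+ z. ennreal ((w z t)\<^sup>2) \<partial>Z \<partial>ivl T) \<le> ennreal (inv_sq_tail 0) * (\<integral>\<^sup>+ t. \<integral>\<^sup>+ z. W z t \<partial>Z \<partial>ivl T)"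
    unfolding i[symmetric] using b3 by (auto intro!: nn_integral_mono_AE elim!: eventually_mono)
  then show "(\<integral>\<^sup>+ t. \<integral>\<^sup>+ z. ennreal ((w z t)\<^sup>2) \<partial>Z \<partial>ivl T) < \<infinity>" using f by (rule le_less_trans)
qed

lemma AE_slices_sq_int:
  assumes X: "sigma_finite_measure X" 
    and f: "case_prod f \<in> borel_measurable (X \<Otimes>\<^sub>M lborel)"
    and fin: "(\<integral>\<^sup>+ t. \<integral>\<^sup>+ x. ennreal ((f x t)\<^sup>2) \<partial>X \<partial>ivl T) < \<infinity>"
  shows "AE x in X. sq_int (ivl T) (f x)"
proof -
  interpret X: sigma_finite_measure X by (rule X)
  interpret I: sigma_finite_measure "ivl T" by (rule sigma_finite_ivl)
  interpret P: pair_sigma_finite X "ivl T" ..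
  have fm: "(\<lambda>x. f (fst x) (snd x)) \<in> borel_measurable (X \<Otimes>\<^sub>M ivl T)"
    using measurable_pair_ivl[OF f] by (simp add: case_prod_beta')
  have m2: "(\<lambda>x. ennreal ((f (fst x) (snd x))\<^sup>2)) \<in> borel_measurable (X \<Otimes>\<^sub>M ivl T)"
    using fm by measurable
  have qm: "(\<lambda>x. \<integral>\<^sup>+ t. ennreal ((f x t)\<^sup>2) \<partial>ivl T) \<in> borel_measurable X"
    using I.borel_measurable_nn_integral_fst[OF m2] by simp
  have "(\<integral>\<^sup>+ x. \<integral>\<^sup>+ t. ennreal ((f x t)\<^sup>2) \<partial>ivl T \<partial>X) < \<infinity>"
    using P.Fubini[OF m2] fin by simp
  then have "AE x in X. (\<integral>\<^sup>+ t. ennreal ((f x t)\<^sup>2) \<partial>ivl T) < \<infinity>"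
    using nn_integral_noteq_infinite[OF qm] by (auto simp: less_top)
  then show ?thesis using AE_space
  proof eventually_elim
    case (elim x)
    have "f x \<in> borel_measurable (ivl T)"
      using measurable_compose[OF measurable_Pair1'[OF elim(2)] fm] by simp
    then show ?case using elim by (simp add: sq_int_iff_nn_integral)
  qed
qed

text \<open>The transformed coefficients \<open>C n\<close> are kernel integrals of the transformed
  functions \<open>F j\<close>, so the results above apply on Z. With Z the square of the domain,
  its projections and a = b = \<open>slob_weight s\<close> this is the Slobodeckij seminorm. The
  assumption \<open>ae\<close> says that p1 and p2 pull null sets back to null sets.\<close>

lemma seminorm_series_convergence:
  fixes D :: "nat \<Rightarrow> 'x \<Rightarrow> real \<Rightarrow> real" and c :: "nat \<Rightarrow> 'x \<Rightarrow> real" and Z :: "'z measure"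
  assumes T: "T > 0" and X: "sigma_finite_measure X" and Z: "sigma_finite_measure Z"
    and p: "p1 \<in> Z \<rightarrow>\<^sub>M X" "p2 \<in> Z \<rightarrow>\<^sub>M X"
    and ae: "\<And>P. AE x in X. P x \<Longrightarrow> AE z in Z. P (p1 z)" "\<And>P. AE x in X. P x \<Longrightarrow> AE z in Z. P (p2 z)"
    and ab[measurable]: "a \<in> borel_measurable Z" "b \<in> borel_measurable Z"
    and D: "\<And>j. j \<le> 5 \<Longrightarrow> case_prod (D j) \<in> borel_measurable (X \<Otimes>\<^sub>M lborel)"
    and D2: "\<And>j. j \<le> 5 \<Longrightarrow> (\<integral>\<^sup>+ t. \<integral>\<^sup>+ x. ennreal ((D j x t)\<^sup>2) \<partial>X \<partial>ivl T) < \<infinity>"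
    and c: "\<And>n. c n \<in> borel_measurable X"
    and ceq: "\<And>n. AE x in X. c n x = (\<Sum>j\<le>5. \<integral>t. D j x t * coef_kernel T n j t \<partial>ivl T)"
    and finN: "\<And>j. j \<le> 5 \<Longrightarrow> (\<integral>\<^sup>+ t. \<integral>\<^sup>+ z. ennreal ((a z * D j (p1 z) t - b z * D j (p2 z) t)\<^sup>2) \<partial>Z \<partial>ivl T) < \<infinity>"
  defines "S \<equiv> \<lambda>N x t. \<Sum>n<N. c n x * Psi2 T n t" and "w \<equiv> \<lambda>x t. \<Sum>n. c n x * Psi2 T n t"
  shows "(\<lambda>N. \<integral>\<^sup>+ t. \<integral>\<^sup>+ z. ennreal ((a z * (S N (p1 z) t - w (p1 z) t) - b z * (S N (p2 z) t - w (p2 z) t))\<^sup>2) \<partial>Z \<partial>ivl T) \<longlonglongrightarrow> 0"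
    and "(\<integral>\<^sup>+ t. \<integral>\<^sup>+ z. ennreal ((a z * S N (p1 z) t - b z * S N (p2 z) t)\<^sup>2) \<partial>Z \<partial>ivl T) < \<infinity>"
    and "(\<integral>\<^sup>+ t. \<integral>\<^sup>+ z. ennreal ((a z * w (p1 z) t - b z * w (p2 z) t)\<^sup>2) \<partial>Z \<partial>ivl T) < \<infinity>"
proof -
  define C where "C n z = a z * c n (p1 z) - b z * c n (p2 z)" for n z
  define F where "F j z t = a z * D j (p1 z) t - b z * D j (p2 z) t" for j z t
  have cp[measurable]: "(\<lambda>z. c n (p1 z)) \<in> borel_measurable Z" "(\<lambda>z. c n (p2 z)) \<in> borel_measurable Z" for n
    using measurable_compose[OF p(1) c] measurable_compose[OF p(2) c] by auto
  have Cm: "C n \<in> borel_measurable Z" for n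
    unfolding C_def by measurable
  have Fm: "case_prod (F j) \<in> borel_measurable (Z \<Otimes>\<^sub>M lborel)" if "j \<le> 5" for j
  proof -
    have "(\<lambda>x. (q (fst x), snd x)) \<in> Z \<Otimes>\<^sub>M lborel \<rightarrow>\<^sub>M X \<Otimes>\<^sub>M lborel" if "q \<in> Z \<rightarrow>\<^sub>M X" for q
      by (intro measurable_Pair measurable_compose[OF measurable_fst that] measurable_snd)
    from measurable_compose[OF this[OF p(1)] D[OF that]] measurable_compose[OF this[OF p(2)] D[OF that]]
    have [measurable]: "(\<lambda>x. D j (p1 (fst x)) (snd x)) \<in> borel_measurable (Z \<Otimes>\<^sub>M lborel)"
      "(\<lambda>x. D j (p2 (fst x)) (snd x)) \<in> borel_measurable (Z \<Otimes>\<^sub>M lborel)" by auto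
    show ?thesis unfolding F_def case_prod_beta' by measurable
  qed
  have sq: "AE x in X. \<forall>j\<in>{..5}. sq_int (ivl T) (D j x)"
    by (subst AE_ball_countable) (auto intro!: AE_slices_sq_int X D D2)
  have Ceq: "AE z in Z. C n z = (\<Sum>j\<le>5. \<integral>t. F j z t * coef_kernel T n j t \<partial>ivl T)" for n
    using ae(1)[OF ceq[of n]] ae(2)[OF ceq[of n]] ae(1)[OF sq] ae(2)[OF sq]
  proof eventually_elim
    case (elim z)
    have "(\<integral>t. F j z t * coef_kernel T n j t \<partial>ivl T) = a z * (\<integral>t. D j (p1 z) t * coef_kernel T n j t \<partial>ivl T) - b z * (\<integral>t. D j (p2 z) t * coef_kernel T n j t \<partial>ivl T)"
      if "j \<le> 5" for j
    proof -
      have i: "integrable (ivl T) (\<lambda>t. a z * (D j (p1 z) t * coef_kernel T n j t))" "integrable (ivl T) (\<lambda>t. b z * (D j (p2 z) t * coef_kernel T n j t))"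
        using elim(3,4) that
        by (auto intro!: sq_int_ivl_integrable sq_int_mult_continuous continuous_coef_kernel integrable_mult_right)
      show ?thesis
        using Bochner_Integration.integral_diff[OF i] by (simp add: F_def algebra_simps)
    qed
    then show ?case
      by (simp add: C_def elim(1,2) sum_subtractf sum_distrib_left)
  qed
  have Cfin: "(\<Sum>n. ennreal ((real n + 1) ^ 10) * (\<integral>\<^sup>+ z. ennreal ((C n z)\<^sup>2) \<partial>Z)) < \<infinity>"
    by (rule kernel_coefficients_summable[OF T Z Fm _ Cm Ceq]) (use finN in \<open>auto simp: F_def\<close>)
  have cfin: "(\<Sum>n. ennreal ((real n + 1) ^ 10) * (\<integral>\<^sup>+ x. ennreal ((c n x)\<^sup>2) \<partial>X)) < \<infinity>"
    by (rule kernel_coefficients_summable[OF T X D D2 c ceq])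
  note E = series_Psi2_slices[OF T Cm Cfin]
  have SC: "(\<Sum>n<N. C n z * Psi2 T n t) = a z * S N (p1 z) t - b z * S N (p2 z) t" for N z t
    by (simp add: C_def S_def sum_subtractf sum_distrib_left algebra_simps)
  \<comment> \<open>Splitting the sum of a difference requires both series to converge, because
    \<open>suminf\<close> has no meaningful value otherwise; at almost every t this holds for almost
    every z.\<close>
  have wC: "AE t in ivl T. AE z in Z. (\<Sum>n. C n z * Psi2 T n t) = a z * w (p1 z) t - b z * w (p2 z) t"
    using series_Psi2_slices(1)[OF T c cfin]
  proof eventually_elim
    case (elim t)
    show ?case
      using ae(1)[OF elim] ae(2)[OF elim]
    proof eventually_elim
      case (elim z)
      have "(\<Sum>n. C n z * Psi2 T n t) = (\<Sum>n. a z * (c n (p1 z) * Psi2 T n t) - b z * (c n (p2 z) * Psi2 T n t))"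
        by (simp add: C_def algebra_simps)
      also have "\<dots> = a z * w (p1 z) t - b z * w (p2 z) t"
        using elim unfolding w_def by (simp add: suminf_diff[symmetric] summable_mult suminf_mult)
      finally show ?case .
    qed
  qed
  have e1: "(\<integral>\<^sup>+ t. \<integral>\<^sup>+ z. ennreal ((a z * (S N (p1 z) t - w (p1 z) t) - b z * (S N (p2 z) t - w (p2 z) t))\<^sup>2) \<partial>Z \<partial>ivl T)
    = (\<integral>\<^sup>+ t. \<integral>\<^sup>+ z. ennreal (((\<Sum>n<N. C n z * Psi2 T n t) - (\<Sum>n. C n z * Psi2 T n t))\<^sup>2) \<partial>Z \<partial>ivl T)" for N
  proof -
    have e: "a z * (S N (p1 z) t - w (p1 z) t) - b z * (S N (p2 z) t - w (p2 z) t)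
      = (a z * S N (p1 z) t - b z * S N (p2 z) t) - (a z * w (p1 z) t - b z * w (p2 z) t)" for z t
      by (simp add: algebra_simps)
    show ?thesis unfolding SC e
      by (intro nn_integral_cong_AE, rule eventually_mono[OF wC])
         (auto intro!: nn_integral_cong_AE elim!: eventually_mono)
  qed
  show "(\<lambda>N. \<integral>\<^sup>+ t. \<integral>\<^sup>+ z. ennreal ((a z * (S N (p1 z) t - w (p1 z) t) - b z * (S N (p2 z) t - w (p2 z) t))\<^sup>2) \<partial>Z \<partial>ivl T) \<longlonglongrightarrow> 0"
    unfolding e1 by (rule E(3))
  show "(\<integral>\<^sup>+ t. \<integral>\<^sup>+ z. ennreal ((a z * S N (p1 z) t - b z * S N (p2 z) t)\<^sup>2) \<partial>Z \<partial>ivl T) < \<infinity>"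
    using E(4)[of N] unfolding SC .
  have e2: "(\<integral>\<^sup>+ t. \<integral>\<^sup>+ z. ennreal ((a z * w (p1 z) t - b z * w (p2 z) t)\<^sup>2) \<partial>Z \<partial>ivl T)
    = (\<integral>\<^sup>+ t. \<integral>\<^sup>+ z. ennreal ((\<Sum>n. C n z * Psi2 T n t)\<^sup>2) \<partial>Z \<partial>ivl T)"
    by (intro nn_integral_cong_AE, rule eventually_mono[OF wC])
       (auto intro!: nn_integral_cong_AE elim!: eventually_mono)
  show "(\<integral>\<^sup>+ t. \<integral>\<^sup>+ z. ennreal ((a z * w (p1 z) t - b z * w (p2 z) t)\<^sup>2) \<partial>Z \<partial>ivl T) < \<infinity>"
    unfolding e2 by (rule E(5))
qed

section \<open>Weak derivatives in space\<close>

abbreviation dmn :: "(real^'d::finite) set \<Rightarrow> (real^'d) measure" where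
  "dmn \<Omega> \<equiv> restrict_space lborel \<Omega>"

lemma finite_measure_dmn: "bounded \<Omega> \<Longrightarrow> open \<Omega> \<Longrightarrow> finite_measure (dmn \<Omega>)"
  by (rule finite_measureI) (use emeasure_bounded_finite[of \<Omega>] in \<open>simp add: emeasure_restrict_space space_restrict_space less_top\<close>)

lemma sigma_finite_dmn: "bounded \<Omega> \<Longrightarrow> open \<Omega> \<Longrightarrow> sigma_finite_measure (dmn \<Omega>)"
  using finite_measure_dmn by (auto simp: finite_measure_def)

lemma AE_dmn: "open \<Omega> \<Longrightarrow> (AE x in dmn \<Omega>. P x) \<longleftrightarrow> (AE x in lborel. x \<in> \<Omega> \<longrightarrow> P x)"
  by (rule AE_restrict_space_iff) simp

lemma AE_ivl: "(AE t in ivl T. P t) \<longleftrightarrow> (AE t in lborel. t \<in> {0<..<T} \<longrightarrow> P t)"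
  by (rule AE_restrict_space_iff) simp

lemma measurable_dmn: "f \<in> borel_measurable borel \<Longrightarrow> f \<in> borel_measurable (dmn \<Omega>)"
  by (rule measurable_restrict_space1) simp

lemma measurable_pair_dmn:
  assumes "(\<lambda>(x, t). f x t) \<in> borel_measurable (lborel \<Otimes>\<^sub>M lborel)"
  shows "case_prod f \<in> borel_measurable (dmn \<Omega> \<Otimes>\<^sub>M lborel)"
proof -
  have "(\<lambda>x. (fst x, snd x)) \<in> dmn \<Omega> \<Otimes>\<^sub>M lborel \<rightarrow>\<^sub>M lborel \<Otimes>\<^sub>M lborel"
    by (intro measurable_Pair measurable_snd measurable_compose[OF measurable_fst] measurable_restrict_space1 measurable_ident_sets) auto
  from measurable_compose[OF this assms] show ?thesis by simp
qed

lemma measurable_slice: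
  assumes "(\<lambda>(x, t). f x t) \<in> borel_measurable (lborel \<Otimes>\<^sub>M lborel)"
  shows "(\<lambda>x. f x t) \<in> borel_measurable (dmn \<Omega>)"
proof -
  have "(\<lambda>x. (x, t)) \<in> dmn \<Omega> \<rightarrow>\<^sub>M lborel \<Otimes>\<^sub>M lborel"
    by (intro measurable_Pair measurable_restrict_space1 measurable_ident_sets measurable_const) auto
  from measurable_compose[OF this assms] show ?thesis by simp
qed

lemma sqL2_eq:
  assumes "open \<Omega>"
  shows "sqL2 T \<Omega> f = (\<integral>\<^sup>+ t. \<integral>\<^sup>+ x. ennreal ((f x t)\<^sup>2) \<partial>dmn \<Omega> \<partial>ivl T)"
  using assms by (simp add: sqL2_def nn_integral_restrict_space)

text \<open>On the diagonal the weight is \<open>0\<close>, because \<open>0 powr a = 0\<close> and \<open>1 / 0 = 0\<close>.\<close>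
definition slob_weight :: "real \<Rightarrow> (real^'d::finite) \<times> (real^'d) \<Rightarrow> real" where
  "slob_weight s z = sqrt (1 / dist (fst z) (snd z) powr (real CARD('d) + 2 * s))"

lemma slob_weight_measurable: "slob_weight s \<in> borel_measurable (dmn \<Omega> \<Otimes>\<^sub>M dmn \<Omega>)"
proof -
  have i: "(\<lambda>x. x) \<in> dmn \<Omega> \<rightarrow>\<^sub>M borel"
    by (intro measurable_restrict_space1 measurable_ident_sets) simp
  have [measurable]: "fst \<in> dmn \<Omega> \<Otimes>\<^sub>M dmn \<Omega> \<rightarrow>\<^sub>M borel" "snd \<in> dmn \<Omega> \<Otimes>\<^sub>M dmn \<Omega> \<rightarrow>\<^sub>M borel"
    by (rule measurable_compose[OF measurable_fst i] measurable_compose[OF measurable_snd i])+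
  show ?thesis unfolding slob_weight_def[abs_def] by measurable
qed

text \<open>Drawing the root of the singular weight into the square exhibits the seminorm as an L2
  norm over pairs of points.\<close>

lemma slob_eq:
  fixes \<Omega> :: "(real^'d::finite) set"
  assumes o: "open \<Omega>" and b: "bounded \<Omega>" and f: "(\<lambda>(x, t). f x t) \<in> borel_measurable (lborel \<Otimes>\<^sub>M lborel)"
  shows "slob s T \<Omega> f = (\<integral>\<^sup>+ t. \<integral>\<^sup>+ z. ennreal ((slob_weight s z * f (fst z) t - slob_weight s z * f (snd z) t)\<^sup>2)
     \<partial>(dmn \<Omega> \<Otimes>\<^sub>M dmn \<Omega>) \<partial>ivl T)"
proof -
  interpret X: sigma_finite_measure "dmn \<Omega>" by (rule sigma_finite_dmn[OF b o])
  have sq: "(f x t - f y t)\<^sup>2 / dist x y powr (real CARD('d) + 2 * s)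
    = (slob_weight s (x, y) * f x t - slob_weight s (x, y) * f y t)\<^sup>2" for x y t
    unfolding slob_weight_def right_diff_distrib[symmetric] power_mult_distrib by simp
  have m: "(\<lambda>z. ennreal ((slob_weight s z * f (fst z) t - slob_weight s z * f (snd z) t)\<^sup>2)) \<in> borel_measurable (dmn \<Omega> \<Otimes>\<^sub>M dmn \<Omega>)" for t
  proof -
    have [measurable]: "(\<lambda>z. f (fst z) t) \<in> borel_measurable (dmn \<Omega> \<Otimes>\<^sub>M dmn \<Omega>)" "(\<lambda>z. f (snd z) t) \<in> borel_measurable (dmn \<Omega> \<Otimes>\<^sub>M dmn \<Omega>)"
      by (intro measurable_compose[OF measurable_fst measurable_slice[OF f]] measurable_compose[OF measurable_snd measurable_slice[OF f]])+
    note slob_weight_measurable[measurable]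
    show ?thesis by measurable
  qed
  have "slob s T \<Omega> f = (\<integral>\<^sup>+ t. \<integral>\<^sup>+ x. \<integral>\<^sup>+ y. ennreal ((slob_weight s (x, y) * f x t - slob_weight s (x, y) * f y t)\<^sup>2) \<partial>dmn \<Omega> \<partial>dmn \<Omega> \<partial>ivl T)"
    using o by (simp add: slob_def sq nn_integral_restrict_space)
  also have "\<dots> = (\<integral>\<^sup>+ t. \<integral>\<^sup>+ z. ennreal ((slob_weight s z * f (fst z) t - slob_weight s z * f (snd z) t)\<^sup>2)
     \<partial>(dmn \<Omega> \<Otimes>\<^sub>M dmn \<Omega>) \<partial>ivl T)"
    using X.nn_integral_fst[OF m] by simp
  finally show ?thesis .
qed

lemma AE_pair_fst:
  assumes M: "sigma_finite_measure M" and P: "AE x in X. P x"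
  shows "AE z in X \<Otimes>\<^sub>M M. P (fst z)"
proof -
  obtain N where N: "N \<in> null_sets X" "{x \<in> space X. \<not> P x} \<subseteq> N"
    using P by (auto simp: eventually_ae_filter)
  have "N \<times> space M \<in> null_sets (X \<Otimes>\<^sub>M M)"
    using sigma_finite_measure.times_in_null_sets1[OF M N(1)] by simp
  then show ?thesis by (rule AE_I') (use N in \<open>auto simp: space_pair_measure\<close>)
qed

lemma AE_pair_snd:
  assumes M: "sigma_finite_measure M" and P: "AE x in M. P x"
  shows "AE z in X \<Otimes>\<^sub>M M. P (snd z)"
proof -
  obtain N where N: "N \<in> null_sets M" "{x \<in> space M. \<not> P x} \<subseteq> N"
    using P by (auto simp: eventually_ae_filter)
  have "space X \<times> N \<in> null_sets (X \<Otimes>\<^sub>M M)"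
    by (rule sigma_finite_measure.times_in_null_sets2[OF M sets.top N(1)])
  then show ?thesis by (rule AE_I') (use N in \<open>auto simp: space_pair_measure\<close>)
qed

section \<open>Calculus of weak derivatives\<close>

lemma weak_xderiv_iff:
  assumes "open \<Omega>"
  shows "weak_xderiv \<Omega> is f g \<longleftrightarrow> (\<forall>\<phi>. test_fun \<Omega> \<phi> \<longrightarrow>
     integrable (dmn \<Omega>) (\<lambda>x. f x * ipd is \<phi> x) \<and> integrable (dmn \<Omega>) (\<lambda>x. g x * \<phi> x) \<and>
     (\<integral>x. f x * ipd is \<phi> x \<partial>dmn \<Omega>) = (-1) ^ length is * (\<integral>x. g x * \<phi> x \<partial>dmn \<Omega>))"
  using assms by (simp add: weak_xderiv_def set_integrable_def set_lebesgue_integral_def integrable_restrict_space integral_restrict_space)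

lemma test_fun_ipd:
  fixes \<Omega> :: "(real^'d::finite) set"
  assumes "test_fun \<Omega> \<phi>" "bounded \<Omega>"
  obtains B where "B > 0" "ipd is \<phi> \<in> borel_measurable borel" "\<And>x. x \<in> \<Omega> \<Longrightarrow> \<bar>ipd is \<phi> x\<bar> \<le> B"
proof -
  have c: "continuous_on UNIV (ipd is \<phi>)"
    using assms(1) unfolding test_fun_def smooth_fun_def
    by (intro continuous_at_imp_continuous_on) (auto intro: differentiable_imp_continuous_within)
  have "bounded (ipd is \<phi> ` closure \<Omega>)"
    using assms(2) by (intro compact_imp_bounded compact_continuous_image continuous_on_subset[OF c]) auto
  then obtain B where "B > 0" "\<forall>x\<in>closure \<Omega>. \<bar>ipd is \<phi> x\<bar> \<le> B"
    unfolding bounded_pos by auto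
  then show ?thesis using that c closure_subset by (blast intro: borel_measurable_continuous_onI)
qed

lemma sq_int_bounded:
  assumes "finite_measure M" "f \<in> borel_measurable M" "\<And>x. x \<in> space M \<Longrightarrow> \<bar>f x\<bar> \<le> B"
  shows "sq_int M f"
proof -
  interpret finite_measure M by fact
  have "integrable M (\<lambda>x. (f x)\<^sup>2)"
  proof (rule integrable_const_bound)
    show "AE x in M. norm ((f x)\<^sup>2) \<le> B\<^sup>2"
    proof (rule AE_I2)
      fix x assume "x \<in> space M"
      then have "\<bar>f x\<bar> \<le> \<bar>B\<bar>" using assms(3)[of x] by auto
      then show "norm ((f x)\<^sup>2) \<le> B\<^sup>2" by (simp add: abs_le_square_iff)
    qed
  qed (use assms(2) in measurable)
  then show ?thesis using assms(2) by (simp add: sq_int_def)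
qed

lemma sq_int_test:
  assumes "test_fun \<Omega> \<phi>" "bounded \<Omega>" "open \<Omega>"
  shows "sq_int (dmn \<Omega>) (ipd is \<phi>)"
proof -
  obtain B where "B > 0" "ipd is \<phi> \<in> borel_measurable borel" "\<And>x. x \<in> \<Omega> \<Longrightarrow> \<bar>ipd is \<phi> x\<bar> \<le> B"
    using test_fun_ipd[OF assms(1,2), of "is"] by blast
  then show ?thesis
    by (intro sq_int_bounded[of _ _ B] finite_measure_dmn assms measurable_dmn) (auto simp: space_restrict_space)
qed

lemma weak_xderiv_sum:
  assumes o: "open \<Omega>" and "\<And>n. n \<in> A \<Longrightarrow> weak_xderiv \<Omega> is (f n) (g n)"
  shows "weak_xderiv \<Omega> is (\<lambda>x. \<Sum>n\<in>A. f n x * a n) (\<lambda>x. \<Sum>n\<in>A. g n x * a n)"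
  unfolding weak_xderiv_iff[OF o]
proof (intro allI impI conjI)
  fix \<phi> assume \<phi>: "test_fun \<Omega> \<phi>"
  note w = assms(2)[unfolded weak_xderiv_iff[OF o], rule_format, OF _ \<phi>]
  have i: "integrable (dmn \<Omega>) (\<lambda>x. a n * (f n x * ipd is \<phi> x))" "integrable (dmn \<Omega>) (\<lambda>x. a n * (g n x * \<phi> x))" if "n \<in> A" for n
    using w[OF that] by auto
  have e: "(\<Sum>n\<in>A. f n x * a n) * ipd is \<phi> x = (\<Sum>n\<in>A. a n * (f n x * ipd is \<phi> x))"
    "(\<Sum>n\<in>A. g n x * a n) * \<phi> x = (\<Sum>n\<in>A. a n * (g n x * \<phi> x))" for x
    unfolding sum_distrib_right by (auto intro!: sum.cong)
  show "integrable (dmn \<Omega>) (\<lambda>x. (\<Sum>n\<in>A. f n x * a n) * ipd is \<phi> x)"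
    unfolding e by (intro Bochner_Integration.integrable_sum i)
  show "integrable (dmn \<Omega>) (\<lambda>x. (\<Sum>n\<in>A. g n x * a n) * \<phi> x)"
    unfolding e by (intro Bochner_Integration.integrable_sum i)
  have "(\<integral>x. (\<Sum>n\<in>A. a n * (f n x * ipd is \<phi> x)) \<partial>dmn \<Omega>) = (\<Sum>n\<in>A. a n * (\<integral>x. f n x * ipd is \<phi> x \<partial>dmn \<Omega>))"
    by (subst Bochner_Integration.integral_sum[OF i(1)]) simp_all
  also have "\<dots> = (\<Sum>n\<in>A. a n * ((-1) ^ length is * (\<integral>x. g n x * \<phi> x \<partial>dmn \<Omega>)))"
    by (rule sum.cong) (use w in auto)
  also have "\<dots> = (-1) ^ length is * (\<Sum>n\<in>A. a n * (\<integral>x. g n x * \<phi> x \<partial>dmn \<Omega>))"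
    by (simp add: sum_distrib_left mult_ac)
  also have "(\<Sum>n\<in>A. a n * (\<integral>x. g n x * \<phi> x \<partial>dmn \<Omega>)) = (\<integral>x. (\<Sum>n\<in>A. a n * (g n x * \<phi> x)) \<partial>dmn \<Omega>)"
    by (subst Bochner_Integration.integral_sum[OF i(2)]) simp_all
  finally show "(\<integral>x. (\<Sum>n\<in>A. f n x * a n) * ipd is \<phi> x \<partial>dmn \<Omega>) = (-1) ^ length is * (\<integral>x. (\<Sum>n\<in>A. g n x * a n) * \<phi> x \<partial>dmn \<Omega>)"
    unfolding e .
qed

text \<open>Needed because \<open>ucoef\<close> agrees with its kernel representation only almost
  everywhere.\<close>

lemma weak_xderiv_cong_AE:
  assumes o: "open \<Omega>" and b: "bounded \<Omega>" and w: "weak_xderiv \<Omega> is f g"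
    and m: "f \<in> borel_measurable (dmn \<Omega>)" "f' \<in> borel_measurable (dmn \<Omega>)" "g \<in> borel_measurable (dmn \<Omega>)" "g' \<in> borel_measurable (dmn \<Omega>)"
    and ae: "AE x in dmn \<Omega>. f' x = f x" "AE x in dmn \<Omega>. g' x = g x"
  shows "weak_xderiv \<Omega> is f' g'"
  unfolding weak_xderiv_iff[OF o]
proof (intro allI impI)
  fix \<phi> assume \<phi>: "test_fun \<Omega> \<phi>"
  note w = w[unfolded weak_xderiv_iff[OF o], rule_format, OF \<phi>]
  have [measurable]: "ipd is \<phi> \<in> borel_measurable (dmn \<Omega>)" "\<phi> \<in> borel_measurable (dmn \<Omega>)"
    using sq_int_test[OF \<phi> b o, of "is"] sq_int_test[OF \<phi> b o, of "[]"] by (auto simp: sq_int_def)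
  note m[measurable]
  have a: "AE x in dmn \<Omega>. f' x * ipd is \<phi> x = f x * ipd is \<phi> x" "AE x in dmn \<Omega>. g' x * \<phi> x = g x * \<phi> x"
    using ae by (auto elim: eventually_mono)
  have i: "integrable (dmn \<Omega>) (\<lambda>x. f' x * ipd is \<phi> x) = integrable (dmn \<Omega>) (\<lambda>x. f x * ipd is \<phi> x)"
    "integrable (dmn \<Omega>) (\<lambda>x. g' x * \<phi> x) = integrable (dmn \<Omega>) (\<lambda>x. g x * \<phi> x)"
    "(\<integral>x. f' x * ipd is \<phi> x \<partial>dmn \<Omega>) = (\<integral>x. f x * ipd is \<phi> x \<partial>dmn \<Omega>)"
    "(\<integral>x. g' x * \<phi> x \<partial>dmn \<Omega>) = (\<integral>x. g x * \<phi> x \<partial>dmn \<Omega>)"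
    by (rule integrable_cong_AE integral_cong_AE; (rule a | measurable))+
  show "integrable (dmn \<Omega>) (\<lambda>x. f' x * ipd is \<phi> x) \<and> integrable (dmn \<Omega>) (\<lambda>x. g' x * \<phi> x) \<and>
     (\<integral>x. f' x * ipd is \<phi> x \<partial>dmn \<Omega>) = (-1) ^ length is * (\<integral>x. g' x * \<phi> x \<partial>dmn \<Omega>)"
    unfolding i by (rule w)
qed

lemma integral_L2_tendsto:
  assumes "\<And>N. sq_int M (f N)" "sq_int M g" "sq_int M h"
    and lim: "(\<lambda>N. \<integral>\<^sup>+ x. ennreal ((f N x - g x)\<^sup>2) \<partial>M) \<longlonglongrightarrow> 0"
  shows "(\<lambda>N. \<integral>x. f N x * h x \<partial>M) \<longlonglongrightarrow> (\<integral>x. g x * h x \<partial>M)"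
proof -
  have d: "sq_int M (\<lambda>x. f N x - g x)" for N by (intro sq_int_diff assms)
  have "(\<integral>\<^sup>+ x. ennreal ((f N x - g x)\<^sup>2) \<partial>M) = ennreal (\<integral>x. (f N x - g x)\<^sup>2 \<partial>M)" for N
    using d[of N] by (intro nn_integral_eq_integral) (auto simp: sq_int_def)
  then have l: "(\<lambda>N. \<integral>x. (f N x - g x)\<^sup>2 \<partial>M) \<longlonglongrightarrow> 0"
    using lim tendsto_ennreal_iff[of "\<lambda>N. \<integral>x. (f N x - g x)\<^sup>2 \<partial>M" sequentially 0]
    by (simp add: integral_square_nonneg)
  have b: "((\<integral>x. f N x * h x \<partial>M) - (\<integral>x. g x * h x \<partial>M))\<^sup>2 \<le> (\<integral>x. (f N x - g x)\<^sup>2 \<partial>M) * (\<integral>x. (h x)\<^sup>2 \<partial>M)" for N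
  proof -
    have "(\<integral>x. f N x * h x \<partial>M) - (\<integral>x. g x * h x \<partial>M) = (\<integral>x. (f N x - g x) * h x \<partial>M)"
      by (subst Bochner_Integration.integral_diff[symmetric])
         (auto intro!: sq_int_mult_integrable assms simp: left_diff_distrib)
    then show ?thesis using Cauchy_Schwarz_sq_int[OF d[of N] assms(3)] by simp
  qed
  have "(\<lambda>N. ((\<integral>x. f N x * h x \<partial>M) - (\<integral>x. g x * h x \<partial>M))\<^sup>2) \<longlonglongrightarrow> 0"
    by (rule tendsto_sandwich[OF _ _ tendsto_const tendsto_mult_left_zero[OF l, of "\<integral>x. (h x)\<^sup>2 \<partial>M"]]) (use b in auto)
  then have "(\<lambda>N. (\<integral>x. f N x * h x \<partial>M) - (\<integral>x. g x * h x \<partial>M)) \<longlonglongrightarrow> 0"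
    using tendsto_real_sqrt[of "\<lambda>N. ((\<integral>x. f N x * h x \<partial>M) - (\<integral>x. g x * h x \<partial>M))\<^sup>2" 0]
    by (auto intro: tendsto_rabs_zero_cancel)
  then show ?thesis by (rule Lim_null[THEN iffD2])
qed

text \<open>On a bounded domain the test functions and their derivatives are square-integrable, so
  both sides of the defining identity are continuous in L2.\<close>

lemma weak_xderiv_limit:
  assumes o: "open \<Omega>" and b: "bounded \<Omega>" and w: "\<And>N. weak_xderiv \<Omega> is (f N) (g N)"
    and sq: "\<And>N. sq_int (dmn \<Omega>) (f N)" "\<And>N. sq_int (dmn \<Omega>) (g N)" "sq_int (dmn \<Omega>) f'" "sq_int (dmn \<Omega>) g'"
    and lim: "(\<lambda>N. \<integral>\<^sup>+ x. ennreal ((f N x - f' x)\<^sup>2) \<partial>dmn \<Omega>) \<longlonglongrightarrow> 0"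
      "(\<lambda>N. \<integral>\<^sup>+ x. ennreal ((g N x - g' x)\<^sup>2) \<partial>dmn \<Omega>) \<longlonglongrightarrow> 0"
  shows "weak_xderiv \<Omega> is f' g'"
  unfolding weak_xderiv_iff[OF o]
proof (intro allI impI conjI)
  fix \<phi> assume \<phi>: "test_fun \<Omega> \<phi>"
  note w = w[unfolded weak_xderiv_iff[OF o], rule_format, OF \<phi>]
  have t: "sq_int (dmn \<Omega>) (ipd is \<phi>)" "sq_int (dmn \<Omega>) \<phi>"
    using sq_int_test[OF \<phi> b o, of "is"] sq_int_test[OF \<phi> b o, of "[]"] by auto
  show "integrable (dmn \<Omega>) (\<lambda>x. f' x * ipd is \<phi> x)" "integrable (dmn \<Omega>) (\<lambda>x. g' x * \<phi> x)"
    by (intro sq_int_mult_integrable sq t)+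
  have "(\<lambda>N. \<integral>x. f N x * ipd is \<phi> x \<partial>dmn \<Omega>) \<longlonglongrightarrow> (\<integral>x. f' x * ipd is \<phi> x \<partial>dmn \<Omega>)"
    by (rule integral_L2_tendsto[OF sq(1,3) t(1) lim(1)])
  moreover have "(\<lambda>N. (-1) ^ length is * (\<integral>x. g N x * \<phi> x \<partial>dmn \<Omega>)) \<longlonglongrightarrow> (-1) ^ length is * (\<integral>x. g' x * \<phi> x \<partial>dmn \<Omega>)"
    by (intro tendsto_mult_left integral_L2_tendsto[OF sq(2,4) t(2) lim(2)])
  ultimately show "(\<integral>x. f' x * ipd is \<phi> x \<partial>dmn \<Omega>) = (-1) ^ length is * (\<integral>x. g' x * \<phi> x \<partial>dmn \<Omega>)"
    unfolding w[THEN conjunct2, THEN conjunct2, symmetric] by (rule LIMSEQ_unique)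
qed

text \<open>The hypothesis of Fubini's theorem: f is in L2 of the product, and so is the bounded
  factor since both measures are finite.\<close>

lemma integrable_pair_bounded_mult:
  assumes b: "bounded \<Omega>" and o: "open \<Omega>" 
    and f: "case_prod f \<in> borel_measurable (dmn \<Omega> \<Otimes>\<^sub>M lborel)"
    and fin: "(\<integral>\<^sup>+ t. \<integral>\<^sup>+ x. ennreal ((f x t)\<^sup>2) \<partial>dmn \<Omega> \<partial>ivl T) < \<infinity>"
    and h: "h \<in> borel_measurable (dmn \<Omega>)" "\<And>x. x \<in> \<Omega> \<Longrightarrow> \<bar>h x\<bar> \<le> B"
    and K: "continuous_on UNIV K"
  shows "integrable (dmn \<Omega> \<Otimes>\<^sub>M ivl T) (\<lambda>(x, t). f x t * K t * h x)"
proof -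
  interpret X: finite_measure "dmn \<Omega>" by (rule finite_measure_dmn[OF b o])
  interpret I: finite_measure "ivl T" by (rule finite_measure_ivl)
  interpret P: pair_sigma_finite "dmn \<Omega>" "ivl T" ..
  have Pf: "finite_measure (dmn \<Omega> \<Otimes>\<^sub>M ivl T)"
    by (rule finite_measure_pair_measure) unfold_locales
  obtain C where C: "\<And>t. t \<in> {0..T} \<Longrightarrow> \<bar>K t\<bar> \<le> C" using continuous_on_ivl_bounded[OF K] by blast
  have fm[measurable]: "(\<lambda>x. f (fst x) (snd x)) \<in> borel_measurable (dmn \<Omega> \<Otimes>\<^sub>M ivl T)"
    using measurable_pair_ivl[OF f] by (simp add: case_prod_beta')
  have hm: "(\<lambda>x. h (fst x)) \<in> borel_measurable (dmn \<Omega> \<Otimes>\<^sub>M ivl T)"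
    by (rule measurable_compose[OF measurable_fst h(1)])
  have Km: "(\<lambda>x. K (snd x)) \<in> borel_measurable (dmn \<Omega> \<Otimes>\<^sub>M ivl T)"
    by (rule measurable_compose[OF measurable_snd borel_measurable_ivl[OF borel_measurable_continuous_onI[OF K]]])
  have m2: "(\<lambda>x. ennreal ((f (fst x) (snd x))\<^sup>2)) \<in> borel_measurable (dmn \<Omega> \<Otimes>\<^sub>M ivl T)"
    by measurable
  have "(\<integral>\<^sup>+ x. ennreal ((f (fst x) (snd x))\<^sup>2) \<partial>(dmn \<Omega> \<Otimes>\<^sub>M ivl T)) < \<infinity>"
    using P.nn_integral_snd[of "\<lambda>x. ennreal ((f (fst x) (snd x))\<^sup>2)"] m2 fin by (simp add: case_prod_beta')
  then have sf: "sq_int (dmn \<Omega> \<Otimes>\<^sub>M ivl T) (\<lambda>x. f (fst x) (snd x))"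
    by (simp add: sq_int_iff_nn_integral[OF fm])
  have "sq_int (dmn \<Omega> \<Otimes>\<^sub>M ivl T) (\<lambda>x. K (snd x) * h (fst x))"
  proof (rule sq_int_bounded[OF Pf, of _ "\<bar>C\<bar> * \<bar>B\<bar>"])
    show "(\<lambda>x. K (snd x) * h (fst x)) \<in> borel_measurable (dmn \<Omega> \<Otimes>\<^sub>M ivl T)"
      by (intro borel_measurable_times Km hm)
    fix z assume "z \<in> space (dmn \<Omega> \<Otimes>\<^sub>M ivl T)"
    then have "fst z \<in> \<Omega>" "snd z \<in> {0..T}" by (auto simp: space_pair_measure space_restrict_space)
    then show "\<bar>K (snd z) * h (fst z)\<bar> \<le> \<bar>C\<bar> * \<bar>B\<bar>"
      unfolding abs_mult using order.trans[OF C abs_ge_self] order.trans[OF h(2) abs_ge_self]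
      by (intro mult_mono) simp_all
  qed
  from sq_int_mult_integrable[OF sf this] show ?thesis by (simp add: case_prod_beta' mult.assoc)
qed

text \<open>Fubini brings the space integral inside, where the weak identity holds at almost every
  t. This is how coefficients acquire spatial derivatives.\<close>

lemma weak_xderiv_time_integral:
  assumes b: "bounded \<Omega>" and o: "open \<Omega>" and K: "continuous_on UNIV K"
    and f: "case_prod f \<in> borel_measurable (dmn \<Omega> \<Otimes>\<^sub>M lborel)" "(\<integral>\<^sup>+ t. \<integral>\<^sup>+ x. ennreal ((f x t)\<^sup>2) \<partial>dmn \<Omega> \<partial>ivl T) < \<infinity>"
    and g: "case_prod g \<in> borel_measurable (dmn \<Omega> \<Otimes>\<^sub>M lborel)" "(\<integral>\<^sup>+ t. \<integral>\<^sup>+ x. ennreal ((g x t)\<^sup>2) \<partial>dmn \<Omega> \<partial>ivl T) < \<infinity>"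
    and w: "AE t in ivl T. weak_xderiv \<Omega> is (\<lambda>x. f x t) (\<lambda>x. g x t)"
  shows "weak_xderiv \<Omega> is (\<lambda>x. \<integral>t. f x t * K t \<partial>ivl T) (\<lambda>x. \<integral>t. g x t * K t \<partial>ivl T)"
  unfolding weak_xderiv_iff[OF o]
proof (intro allI impI conjI)
  fix \<phi> assume \<phi>: "test_fun \<Omega> \<phi>"
  interpret X: finite_measure "dmn \<Omega>" by (rule finite_measure_dmn[OF b o])
  interpret I: finite_measure "ivl T" by (rule finite_measure_ivl)
  interpret P: pair_sigma_finite "dmn \<Omega>" "ivl T" ..
  obtain B where B: "ipd is \<phi> \<in> borel_measurable borel" "\<And>x. x \<in> \<Omega> \<Longrightarrow> \<bar>ipd is \<phi> x\<bar> \<le> B"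
    using test_fun_ipd[OF \<phi> b, of "is"] by blast
  obtain B' where B': "\<phi> \<in> borel_measurable borel" "\<And>x. x \<in> \<Omega> \<Longrightarrow> \<bar>\<phi> x\<bar> \<le> B'"
    using test_fun_ipd[OF \<phi> b, of "[]"] by auto
  have if1: "integrable (dmn \<Omega> \<Otimes>\<^sub>M ivl T) (\<lambda>(x, t). f x t * K t * ipd is \<phi> x)"
    by (rule integrable_pair_bounded_mult[OF b o f measurable_dmn[OF B(1)] B(2) K])
  have ig1: "integrable (dmn \<Omega> \<Otimes>\<^sub>M ivl T) (\<lambda>(x, t). g x t * K t * \<phi> x)"
    by (rule integrable_pair_bounded_mult[OF b o g measurable_dmn[OF B'(1)] B'(2) K])
  show "integrable (dmn \<Omega>) (\<lambda>x. (\<integral>t. f x t * K t \<partial>ivl T) * ipd is \<phi> x)"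
    using P.integrable_fst[OF if1] by simp
  show "integrable (dmn \<Omega>) (\<lambda>x. (\<integral>t. g x t * K t \<partial>ivl T) * \<phi> x)"
    using P.integrable_fst[OF ig1] by simp
  have "(\<integral>x. (\<integral>t. f x t * K t \<partial>ivl T) * ipd is \<phi> x \<partial>dmn \<Omega>) = (\<integral>x. (\<integral>t. f x t * K t * ipd is \<phi> x \<partial>ivl T) \<partial>dmn \<Omega>)"
    by simp
  also have "\<dots> = (\<integral>t. (\<integral>x. f x t * K t * ipd is \<phi> x \<partial>dmn \<Omega>) \<partial>ivl T)"
    by (rule P.Fubini_integral[OF if1, symmetric])
  also have "\<dots> = (\<integral>t. (-1) ^ length is * (\<integral>x. g x t * K t * \<phi> x \<partial>dmn \<Omega>) \<partial>ivl T)"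
  proof (rule integral_cong_AE)
    show "(\<lambda>t. \<integral>x. f x t * K t * ipd is \<phi> x \<partial>dmn \<Omega>) \<in> borel_measurable (ivl T)"
      using P.integrable_snd[OF if1] by (rule borel_measurable_integrable)
    show "(\<lambda>t. (-1) ^ length is * (\<integral>x. g x t * K t * \<phi> x \<partial>dmn \<Omega>)) \<in> borel_measurable (ivl T)"
      using P.integrable_snd[OF ig1] by (intro borel_measurable_times borel_measurable_integrable) auto
    show "AE t in ivl T. (\<integral>x. f x t * K t * ipd is \<phi> x \<partial>dmn \<Omega>) = (-1) ^ length is * (\<integral>x. g x t * K t * \<phi> x \<partial>dmn \<Omega>)"
      using w
    proof eventually_elim
      case (elim t)
      have r: "f x t * K t * ipd is \<phi> x = K t * (f x t * ipd is \<phi> x)" "g x t * K t * \<phi> x = K t * (g x t * \<phi> x)" for x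
        by simp_all
      show ?case unfolding r Bochner_Integration.integral_mult_right_zero
        using elim \<phi> by (simp add: weak_xderiv_iff[OF o])
    qed
  qed
  also have "\<dots> = (-1) ^ length is * (\<integral>t. (\<integral>x. g x t * K t * \<phi> x \<partial>dmn \<Omega>) \<partial>ivl T)"
    by (rule Bochner_Integration.integral_mult_right_zero)
  also have "(\<integral>t. (\<integral>x. g x t * K t * \<phi> x \<partial>dmn \<Omega>) \<partial>ivl T) = (\<integral>x. (\<integral>t. g x t * K t * \<phi> x \<partial>ivl T) \<partial>dmn \<Omega>)"
    by (rule P.Fubini_integral[OF ig1])
  also have "\<dots> = (\<integral>x. (\<integral>t. g x t * K t \<partial>ivl T) * \<phi> x \<partial>dmn \<Omega>)" by simp
  finally show "(\<integral>x. (\<integral>t. f x t * K t \<partial>ivl T) * ipd is \<phi> x \<partial>dmn \<Omega>) = (-1) ^ length is * (\<integral>x. (\<integral>t. g x t * K t \<partial>ivl T) * \<phi> x \<partial>dmn \<Omega>)" .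
qed

section \<open>The sum of the series is the second time derivative\<close>

lemma finite_multiindices: "finite {is :: 'd::finite list. length is \<le> m}"
  using finite_lists_length_le[of "UNIV :: 'd set" m] by simp

lemma finite_multiindices_eq: "finite {is :: 'd::finite list. length is = m}"
  using finite_lists_length_eq[of "UNIV :: 'd set" m] by simp

lemma sqL2_le_L2H_sq: 
  assumes "length is \<le> sob_m p" shows "sqL2 T \<Omega> (Du is) \<le> L2H_sq T \<Omega> p Du"
proof -
  have "sqL2 T \<Omega> (Du is) \<le> (\<Sum>is\<in>{is. length is \<le> sob_m p}. sqL2 T \<Omega> (Du is))"
    by (rule member_le_sum) (use assms finite_multiindices in auto)
  then show ?thesis unfolding L2H_sq_def by (rule order.trans) simp
qed

lemma slob_le_L2H_sq: 
  assumes "length is = sob_m p" "sob_s p > 0" shows "slob (sob_s p) T \<Omega> (Du is) \<le> L2H_sq T \<Omega> p Du"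
proof -
  have "slob (sob_s p) T \<Omega> (Du is) \<le> (\<Sum>is\<in>{is. length is = sob_m p}. slob (sob_s p) T \<Omega> (Du is))"
    by (rule member_le_sum) (use assms finite_multiindices_eq in auto)
  then show ?thesis using assms(2) unfolding L2H_sq_def by (simp add: add_increasing)
qed

text \<open>The exponentials combine to exp (- t), so weighted coefficients in \<open>Psi\<close>
  are Legendre coefficients of exp (- t) u.\<close>

lemma ucoef_eq: "ucoef T u n x = (\<integral>t. u x t * (exp (- t) * poly (Qpoly T n) t) \<partial>ivl T)"
proof -
  have "exp (- 2 * t) * u x t * Psi T n t = u x t * (exp (- t) * poly (Qpoly T n) t)" for t
  proof -
    have "exp (- 2 * t) * exp t = exp (- t)" by (simp flip: exp_add)
    then show ?thesis unfolding Psi_eq by (metis mult.assoc mult.commute)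
  qed
  then show ?thesis by (simp only: ucoef_def integral_ivl)
qed

lemma time_integral_measurable:
  fixes u :: "'x::euclidean_space \<Rightarrow> real \<Rightarrow> real"
  assumes "(\<lambda>(x, t). u x t) \<in> borel_measurable (lborel \<Otimes>\<^sub>M lborel)" "continuous_on UNIV K"
  shows "(\<lambda>x. \<integral>t. u x t * K t \<partial>ivl T) \<in> borel_measurable borel"
proof -
  interpret I: sigma_finite_measure "ivl T" by (rule sigma_finite_ivl)
  have 1: "(\<lambda>x. u (fst x) (snd x)) \<in> borel_measurable (lborel \<Otimes>\<^sub>M ivl T)"
    using measurable_pair_ivl[OF assms(1)] by (simp only: case_prod_beta')
  have 2: "(\<lambda>x. K (snd x)) \<in> borel_measurable (lborel \<Otimes>\<^sub>M ivl T)"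
    by (rule measurable_compose[OF measurable_snd borel_measurable_ivl[OF borel_measurable_continuous_onI[OF assms(2)]]])
  have "(\<lambda>x. u (fst x) (snd x) * K (snd x)) \<in> borel_measurable (lborel \<Otimes>\<^sub>M ivl T)"
    by (rule borel_measurable_times[OF 1 2])
  then have "(\<lambda>x. \<integral>t. u x t * K t \<partial>ivl T) \<in> borel_measurable lborel"
    by (intro I.borel_measurable_lebesgue_integral) (simp only: case_prod_beta')
  then show ?thesis by simp
qed

lemma nn_integral_swap_ivl:
  assumes X: "sigma_finite_measure X" and f: "case_prod f \<in> borel_measurable (X \<Otimes>\<^sub>M lborel)"
  shows "(\<integral>\<^sup>+ x. \<integral>\<^sup>+ t. ennreal ((f x t)\<^sup>2) \<partial>ivl T \<partial>X) = (\<integral>\<^sup>+ t. \<integral>\<^sup>+ x. ennreal ((f x t)\<^sup>2) \<partial>X \<partial>ivl T)"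
proof -
  interpret X: sigma_finite_measure X by (rule X)
  interpret I: sigma_finite_measure "ivl T" by (rule sigma_finite_ivl)
  interpret P: pair_sigma_finite X "ivl T" ..
  have [measurable]: "(\<lambda>x. f (fst x) (snd x)) \<in> borel_measurable (X \<Otimes>\<^sub>M ivl T)"
    using measurable_pair_ivl[OF f] by (simp add: case_prod_beta')
  have "(\<lambda>x. ennreal ((f (fst x) (snd x))\<^sup>2)) \<in> borel_measurable (X \<Otimes>\<^sub>M ivl T)" by measurable
  from P.Fubini[OF this] show ?thesis by simp
qed

text \<open>Moving both derivatives from \<open>Psi T n\<close> to the test function gives the n-th
  Legendre coefficient of exp t times its second derivative. The pairing becomes a partial Parseval
  sum, and in its limit the exponentials of \<open>F\<close> and \<open>G\<close> cancel.\<close>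

lemma pairing_limit:
  assumes T: "T > 0" and u: "sq_int (ivl T) (u x)" and \<phi>: "test_t T \<phi>"
  shows "(\<lambda>N. \<integral>t. psum2 T u N x t * \<phi> t \<partial>ivl T) \<longlonglongrightarrow> (\<integral>t. u x t * (deriv ^^ 2) \<phi> t \<partial>ivl T)"
proof -
  define F where "F t = u x t * exp (- t)" for t
  define G where "G t = exp t * (deriv ^^ 2) \<phi> t" for t
  have cs: "continuous_on UNIV \<phi>" "continuous_on UNIV (deriv \<phi>)" "continuous_on UNIV ((deriv ^^ 2) \<phi>)"
    using test_t_continuous[OF \<phi>, of 0] test_t_continuous[OF \<phi>, of 1] test_t_continuous[OF \<phi>, of 2] by simp_all
  have sF: "sq_int (ivl T) F" unfolding F_def by (intro sq_int_mult_continuous u continuous_intros)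
  have cG: "continuous_on UNIV G" unfolding G_def by (intro continuous_intros cs)
  have DE: "((\<lambda>t. exp t * poly p t) has_real_derivative exp t * poly (p + pderiv p) t) (at t)" for p :: "real poly" and t
    by (auto intro!: derivative_eq_intros simp: algebra_simps)
  have q: "(\<integral>t. Psi2 T n t * \<phi> t \<partial>ivl T) = q_coef T G n" for n
  proof -
    let ?Q = "Qpoly T n"
    have P2: "Psi2 T n = (\<lambda>t. exp t * poly ((?Q + pderiv ?Q) + pderiv (?Q + pderiv ?Q)) t)"
      unfolding Psi2_def Psi_eq deriv_exp_poly ..
    have "(\<integral>t. Psi2 T n t * \<phi> t \<partial>ivl T) = - (\<integral>t. exp t * poly (?Q + pderiv ?Q) t * deriv \<phi> t \<partial>ivl T)"
      unfolding P2 by (rule test_t_by_parts[OF T \<phi> DE]) (intro continuous_intros)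
    also have "\<dots> = (\<integral>t. exp t * poly ?Q t * deriv (deriv \<phi>) t \<partial>ivl T)"
      by (subst test_t_by_parts[OF T test_t_deriv[OF \<phi>] DE]) (auto intro!: continuous_intros)
    finally show ?thesis by (simp add: G_def numeral_2_eq_2 mult_ac)
  qed
  have c: "ucoef T u n x = q_coef T F n" for n by (simp add: ucoef_eq F_def mult.assoc)
  have "(\<integral>t. psum2 T u N x t * \<phi> t \<partial>ivl T) = (\<Sum>n<N. q_coef T F n * q_coef T G n)" for N
  proof -
    have "(\<integral>t. psum2 T u N x t * \<phi> t \<partial>ivl T) = (\<integral>t. (\<Sum>n<N. ucoef T u n x * (Psi2 T n t * \<phi> t)) \<partial>ivl T)"
      by (simp add: psum2_def sum_distrib_right mult.assoc)
    also have "\<dots> = (\<Sum>n<N. ucoef T u n x * (\<integral>t. Psi2 T n t * \<phi> t \<partial>ivl T))"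
      by (subst Bochner_Integration.integral_sum)
         (auto intro!: continuous_on_imp_integrable_ivl continuous_intros continuous_Psi2 cs)
    finally show ?thesis by (simp add: q c)
  qed
  moreover have "(\<integral>t. F t * G t \<partial>ivl T) = (\<integral>t. u x t * (deriv ^^ 2) \<phi> t \<partial>ivl T)"
  proof -
    have "F t * G t = u x t * (deriv ^^ 2) \<phi> t" for t
    proof -
      have "exp (- t) * exp t = 1" by (simp flip: exp_add)
      then show ?thesis unfolding F_def G_def by (metis mult.assoc mult_1)
    qed
    then show ?thesis by simp
  qed
  ultimately show ?thesis using parseval_Qpoly[OF T sF cG] by simp
qed

text \<open>\<open>L N\<close> tends to \<open>I\<close> almost everywhere, and to \<open>J\<close>
  in L2 by Cauchy-Schwarz in time. Fatou's lemma compares the two limits without choosing a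
  subsequence.\<close>

lemma weak_tderiv_2_limit:
  fixes \<Omega> :: "(real^'d::finite) set"
  assumes T: "T > 0" and o: "open \<Omega>" and b: "bounded \<Omega>"
    and u: "(\<lambda>(x, t). u x t) \<in> borel_measurable (lborel \<Otimes>\<^sub>M lborel)" "sqL2 T \<Omega> u < \<infinity>"
    and w: "(\<lambda>(x, t). w x t) \<in> borel_measurable (lborel \<Otimes>\<^sub>M lborel)" "sqL2 T \<Omega> w < \<infinity>"
    and S: "\<And>N. (\<lambda>(x, t). psum2 T u N x t) \<in> borel_measurable (lborel \<Otimes>\<^sub>M lborel)"
    and conv: "(\<lambda>N. sqL2 T \<Omega> (\<lambda>x t. psum2 T u N x t - w x t)) \<longlonglongrightarrow> 0"
  shows "weak_tderiv T \<Omega> 2 u w"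
  unfolding weak_tderiv_def
proof (intro allI impI)
  fix \<phi> assume \<phi>: "test_t T \<phi>"
  interpret X: sigma_finite_measure "dmn \<Omega>" by (rule sigma_finite_dmn[OF b o])
  let ?X = "dmn \<Omega>"
  have cs: "continuous_on UNIV \<phi>" "continuous_on UNIV ((deriv ^^ 2) \<phi>)"
    using test_t_continuous[OF \<phi>, of 0] test_t_continuous[OF \<phi>, of 2] by simp_all
  define I where "I x = (\<integral>t. u x t * (deriv ^^ 2) \<phi> t \<partial>ivl T)" for x
  define J where "J x = (\<integral>t. w x t * \<phi> t \<partial>ivl T)" for x
  define L where "L N x = (\<integral>t. psum2 T u N x t * \<phi> t \<partial>ivl T)" for N x
  define K where "K = (\<integral>t. (\<phi> t)\<^sup>2 \<partial>ivl T)"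
  have [measurable]: "I \<in> borel_measurable ?X" "J \<in> borel_measurable ?X" "L N \<in> borel_measurable ?X" for N
    unfolding I_def[abs_def] J_def[abs_def] L_def[abs_def] by (intro measurable_dmn time_integral_measurable u w S cs)+
  have Xf: "AE x in ?X. sq_int (ivl T) (u x)" "AE x in ?X. sq_int (ivl T) (w x)"
    using AE_slices_sq_int[OF X.sigma_finite_measure_axioms measurable_pair_dmn[OF u(1)]] u(2)
      AE_slices_sq_int[OF X.sigma_finite_measure_axioms measurable_pair_dmn[OF w(1)]] w(2)
    by (simp_all add: sqL2_eq[OF o])
  have bound: "(\<integral>\<^sup>+ x. ennreal ((L N x - J x)\<^sup>2) \<partial>?X) \<le> ennreal K * sqL2 T \<Omega> (\<lambda>x t. psum2 T u N x t - w x t)" for N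
  proof -
    let ?f = "\<lambda>x t. psum2 T u N x t - w x t"
    have fm0: "(\<lambda>(x, t). ?f x t) \<in> borel_measurable (lborel \<Otimes>\<^sub>M lborel)"
      using borel_measurable_diff[OF S[of N] w(1)] by (simp add: case_prod_beta')
    have fm: "case_prod ?f \<in> borel_measurable (?X \<Otimes>\<^sub>M lborel)" by (rule measurable_pair_dmn[OF fm0])
    have "(\<integral>\<^sup>+ x. ennreal ((L N x - J x)\<^sup>2) \<partial>?X) \<le> (\<integral>\<^sup>+ x. ennreal K * (\<integral>\<^sup>+ t. ennreal ((?f x t)\<^sup>2) \<partial>ivl T) \<partial>?X)"
    proof (rule nn_integral_mono_AE)
      show "AE x in ?X. ennreal ((L N x - J x)\<^sup>2) \<le> ennreal K * (\<integral>\<^sup>+ t. ennreal ((?f x t)\<^sup>2) \<partial>ivl T)"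
        using Xf(2)
      proof eventually_elim
        case (elim x)
        have sp: "sq_int (ivl T) (psum2 T u N x)"
          unfolding psum2_def by (intro sq_int_ivl_continuous continuous_intros continuous_Psi2)
        have s\<phi>: "sq_int (ivl T) \<phi>" by (rule sq_int_ivl_continuous[OF cs(1)])
        have sf: "sq_int (ivl T) (?f x)" by (rule sq_int_diff[OF sp elim])
        have "L N x - J x = (\<integral>t. ?f x t * \<phi> t \<partial>ivl T)"
          unfolding L_def J_def
          by (subst Bochner_Integration.integral_diff[symmetric])
             (auto intro!: sq_int_mult_integrable sp elim s\<phi> simp: left_diff_distrib)
        then have "(L N x - J x)\<^sup>2 \<le> K * (\<integral>t. (?f x t)\<^sup>2 \<partial>ivl T)"
          using Cauchy_Schwarz_sq_int[OF sf s\<phi>] by (simp add: K_def mult.commute)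
        then have "ennreal ((L N x - J x)\<^sup>2) \<le> ennreal K * ennreal (\<integral>t. (?f x t)\<^sup>2 \<partial>ivl T)"
          by (simp add: ennreal_leI K_def integral_square_nonneg flip: ennreal_mult)
        also have "ennreal (\<integral>t. (?f x t)\<^sup>2 \<partial>ivl T) = (\<integral>\<^sup>+ t. ennreal ((?f x t)\<^sup>2) \<partial>ivl T)"
          using sf by (intro nn_integral_eq_integral[symmetric]) (auto simp: sq_int_def)
        finally show ?case .
      qed
    qed
    also have "\<dots> = ennreal K * (\<integral>\<^sup>+ x. (\<integral>\<^sup>+ t. ennreal ((?f x t)\<^sup>2) \<partial>ivl T) \<partial>?X)"
    proof (rule nn_integral_cmult)
      interpret I: sigma_finite_measure "ivl T" by (rule sigma_finite_ivl)
      have [measurable]: "(\<lambda>x. ?f (fst x) (snd x)) \<in> borel_measurable (?X \<Otimes>\<^sub>M ivl T)"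
        using measurable_pair_ivl[OF fm] by (simp add: case_prod_beta')
      have "(\<lambda>x. ennreal ((?f (fst x) (snd x))\<^sup>2)) \<in> borel_measurable (?X \<Otimes>\<^sub>M ivl T)" by measurable
      from I.borel_measurable_nn_integral_fst[OF this]
      show "(\<lambda>x. \<integral>\<^sup>+ t. ennreal ((?f x t)\<^sup>2) \<partial>ivl T) \<in> borel_measurable ?X" by simp
    qed
    also have "\<dots> = ennreal K * sqL2 T \<Omega> ?f"
      unfolding sqL2_eq[OF o] by (subst nn_integral_swap_ivl[OF X.sigma_finite_measure_axioms fm]) simp
    finally show ?thesis .
  qed
  have limK: "(\<lambda>N. ennreal K * sqL2 T \<Omega> (\<lambda>x t. psum2 T u N x t - w x t)) \<longlonglongrightarrow> ennreal K * 0"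
    by (intro ennreal_tendsto_cmult conv) simp
  have lim0: "(\<lambda>N. \<integral>\<^sup>+ x. ennreal ((L N x - J x)\<^sup>2) \<partial>?X) \<longlonglongrightarrow> 0"
    by (rule tendsto_sandwich[OF _ _ tendsto_const limK[unfolded mult_zero_right]])
       (simp, intro always_eventually allI bound)
  have "(\<integral>\<^sup>+ x. ennreal ((I x - J x)\<^sup>2) \<partial>?X) = (\<integral>\<^sup>+ x. liminf (\<lambda>N. ennreal ((L N x - J x)\<^sup>2)) \<partial>?X)"
  proof (rule nn_integral_cong_AE)
    show "AE x in ?X. ennreal ((I x - J x)\<^sup>2) = liminf (\<lambda>N. ennreal ((L N x - J x)\<^sup>2))"
      using Xf(1)
    proof eventually_elim
      case (elim x)
      have "(\<lambda>N. ennreal ((L N x - J x)\<^sup>2)) \<longlonglongrightarrow> ennreal ((I x - J x)\<^sup>2)"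
        unfolding L_def I_def by (intro tendsto_intros pairing_limit[OF T _ \<phi>] elim)
      then show ?case by (intro lim_imp_Liminf[symmetric]) auto
    qed
  qed
  also have "\<dots> \<le> liminf (\<lambda>N. \<integral>\<^sup>+ x. ennreal ((L N x - J x)\<^sup>2) \<partial>?X)"
    by (rule nn_integral_liminf) measurable
  also have "\<dots> = 0" using lim0 by (intro lim_imp_Liminf) auto
  finally have "AE x in ?X. I x = J x"
    by (subst (asm) le_zero_eq, subst (asm) nn_integral_0_iff_AE) auto
  then show "AE x in lborel. x \<in> \<Omega> \<longrightarrow> (LINT t:{0<..<T}|lborel. u x t * (deriv ^^ 2) \<phi> t) =
        (- 1) ^ 2 * (LINT t:{0<..<T}|lborel. w x t * \<phi> t)"
    by (simp add: AE_dmn[OF o] I_def J_def integral_ivl)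
qed

lemma weak_tderiv_series_sum:
  fixes \<Omega> :: "(real^'d::finite) set"
  assumes T: "T > 0" and o: "open \<Omega>" and b: "bounded \<Omega>" and u: "L2H T \<Omega> p u"
    and conv: "L2H_conv T \<Omega> p (psum2 T u) w"
  shows "L2H T \<Omega> p w \<and> weak_tderiv T \<Omega> 2 u w"
proof -
  obtain DS Dw where D: "\<And>N. L2H_fam T \<Omega> p (psum2 T u N) (DS N)" "L2H_fam T \<Omega> p w Dw" "L2H_sq T \<Omega> p Dw < \<infinity>"
      "(\<lambda>N. L2H_sq T \<Omega> p (\<lambda>is x t. DS N is x t - Dw is x t)) \<longlonglongrightarrow> 0"
    using conv unfolding L2H_conv_def by blast
  obtain Du where Du: "L2H_fam T \<Omega> p u Du" "L2H_sq T \<Omega> p Du < \<infinity>"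
    using u unfolding L2H_def by blast
  have e: "Du [] = u" "Dw [] = w" "\<And>N. DS N [] = psum2 T u N"
    using Du D by (auto simp: L2H_fam_def)
  have m: "(\<lambda>(x, t). u x t) \<in> borel_measurable (lborel \<Otimes>\<^sub>M lborel)"
    "(\<lambda>(x, t). w x t) \<in> borel_measurable (lborel \<Otimes>\<^sub>M lborel)"
    "(\<lambda>(x, t). psum2 T u N x t) \<in> borel_measurable (lborel \<Otimes>\<^sub>M lborel)" for N
    using Du(1) D(1)[of N] D(2) unfolding L2H_fam_def by (metis e le0 list.size(3))+
  have s: "sqL2 T \<Omega> u < \<infinity>" "sqL2 T \<Omega> w < \<infinity>"
    using sqL2_le_L2H_sq[of "[]" p T \<Omega> Du] sqL2_le_L2H_sq[of "[]" p T \<Omega> Dw] Du D by (auto simp: e)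
  have "(\<lambda>N. sqL2 T \<Omega> (\<lambda>x t. psum2 T u N x t - w x t)) \<longlonglongrightarrow> 0"
  proof (rule tendsto_sandwich[OF _ _ tendsto_const D(4)])
    show "\<forall>\<^sub>F N in sequentially. sqL2 T \<Omega> (\<lambda>x t. psum2 T u N x t - w x t) \<le> L2H_sq T \<Omega> p (\<lambda>is x t. DS N is x t - Dw is x t)"
      using sqL2_le_L2H_sq[of "[]" p T \<Omega> "\<lambda>is x t. DS N is x t - Dw is x t" for N] by (simp add: e)
  qed simp
  then have "weak_tderiv T \<Omega> 2 u w"
    by (intro weak_tderiv_2_limit T o b m s)
  moreover have "L2H T \<Omega> p w" using D unfolding L2H_def by blast
  ultimately show ?thesis by blast
qed

section \<open>Convergence of the series\<close>

text \<open>\<open>HkH\<close> relates each derivative to u, not to its neighbour. Testing v with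
  the derivative of the cutoff and v' with the cutoff produces the same integral of u, which is
  eliminated.\<close>

lemma weak_tderiv_cutoff:
  assumes T: "T > 0" and o: "open \<Omega>"
    and w: "weak_tderiv T \<Omega> j u v" "weak_tderiv T \<Omega> (Suc j) u v'"
  shows "AE x in dmn \<Omega>. (\<integral>t. v x t * deriv (cutoff T g m) t \<partial>ivl T) = - (\<integral>t. v' x t * cutoff T g m t \<partial>ivl T)"
proof -
  have t: "test_t T (cutoff T g m)" by (rule test_t_cutoff[OF T])
  have 1: "AE x in dmn \<Omega>. (\<integral>t. u x t * (deriv ^^ j) (deriv (cutoff T g m)) t \<partial>ivl T) = (-1) ^ j * (\<integral>t. v x t * deriv (cutoff T g m) t \<partial>ivl T)"
    using w(1) test_t_deriv[OF t] unfolding weak_tderiv_def AE_dmn[OF o] integral_ivl by blast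
  have 2: "AE x in dmn \<Omega>. (\<integral>t. u x t * (deriv ^^ Suc j) (cutoff T g m) t \<partial>ivl T) = (-1) ^ Suc j * (\<integral>t. v' x t * cutoff T g m t \<partial>ivl T)"
    using w(2) t unfolding weak_tderiv_def AE_dmn[OF o] integral_ivl by blast
  show ?thesis using 1 2
  proof eventually_elim
    case (elim x)
    then have "(-1) ^ j * (\<integral>t. v x t * deriv (cutoff T g m) t \<partial>ivl T) = (-1) ^ Suc j * (\<integral>t. v' x t * cutoff T g m t \<partial>ivl T)"
      by (simp only: funpow_Suc_right o_def)
    then have "(-1) ^ j * (\<integral>t. v x t * deriv (cutoff T g m) t \<partial>ivl T) = (-1) ^ j * (- (\<integral>t. v' x t * cutoff T g m t \<partial>ivl T))"
      by simp
    then show ?case by (subst (asm) mult_cancel_left) simp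
  qed
qed

lemma series_Psi2_converges:
  fixes \<Omega> :: "(real^'d::finite) set"
  assumes T: "T > 0" and o: "open \<Omega>" and b: "bounded \<Omega>" and k: "k \<ge> 5" and u: "HkH T \<Omega> p k u"
  shows "\<exists>w. L2H_conv T \<Omega> p (psum2 T u) w"
proof -
  let ?X = "dmn \<Omega>" and ?m = "sob_m p"
  have X: "sigma_finite_measure ?X" by (rule sigma_finite_dmn[OF b o])
  obtain v where v0: "v 0 = u" and v: "\<And>j. j \<le> k \<Longrightarrow> L2H T \<Omega> p (v j)" "\<And>j. j \<le> k \<Longrightarrow> weak_tderiv T \<Omega> j u (v j)"
    using u unfolding HkH_def by blast
  have "\<forall>j\<in>{..5}. \<exists>Dv. L2H_fam T \<Omega> p (v j) Dv \<and> L2H_sq T \<Omega> p Dv < \<infinity>"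
    using v(1) k unfolding L2H_def by auto
  then obtain Dv where "\<forall>j\<in>{..5}. L2H_fam T \<Omega> p (v j) (Dv j) \<and> L2H_sq T \<Omega> p (Dv j) < \<infinity>"
    using bchoice by metis
  then have fam: "L2H_fam T \<Omega> p (v j) (Dv j)" and Dsq: "L2H_sq T \<Omega> p (Dv j) < \<infinity>" if "j \<le> 5" for j
    using that by auto
  have Dv0: "Dv j [] = v j" if "j \<le> 5" for j
    using fam[OF that] by (simp add: L2H_fam_def)
  have Dm: "(\<lambda>(x, t). Dv j is x t) \<in> borel_measurable (lborel \<Otimes>\<^sub>M lborel)" if "j \<le> 5" "length is \<le> ?m" for j "is"
    using fam[OF that(1)] that(2) by (simp add: L2H_fam_def)
  have DmX: "case_prod (Dv j is) \<in> borel_measurable (?X \<Otimes>\<^sub>M lborel)" if "j \<le> 5" "length is \<le> ?m" for j "is"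
    by (rule measurable_pair_dmn[OF Dm[OF that]])
  have D2: "(\<integral>\<^sup>+ t. \<integral>\<^sup>+ x. ennreal ((Dv j is x t)\<^sup>2) \<partial>?X \<partial>ivl T) < \<infinity>" if "j \<le> 5" "length is \<le> ?m" for j "is"
    using sqL2_le_L2H_sq[OF that(2), of T \<Omega> "Dv j"] Dsq[OF that(1)] by (auto simp: sqL2_eq[OF o])
  have Dw: "AE t in ivl T. weak_xderiv \<Omega> is (\<lambda>x. v j x t) (\<lambda>x. Dv j is x t)" if "j \<le> 5" "length is \<le> ?m" for j "is"
    using fam[OF that(1)] that(2) by (simp add: L2H_fam_def AE_ivl)
  define c' where "c' is n x = (\<Sum>j\<le>5. \<integral>t. Dv j is x t * coef_kernel T n j t \<partial>ivl T)" for "is" n x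
  \<comment> \<open>At the empty multi-index the partial sums have to be \<open>psum2\<close> at
    every point, so \<open>ucoef\<close> is kept there; it agrees with the kernel formula only
    almost everywhere.\<close>
  define c where "c is n = (if is = [] then ucoef T u n else c' is n)" for "is" n
  have c'm: "c' is n \<in> borel_measurable borel" if "length is \<le> ?m" for "is" n
    unfolding c'_def by (intro borel_measurable_sum time_integral_measurable[OF Dm continuous_coef_kernel] that) auto
  have um: "ucoef T u n \<in> borel_measurable borel" for n
  proof -
    have "(\<lambda>(x, t). u x t) \<in> borel_measurable (lborel \<Otimes>\<^sub>M lborel)"
      using Dm[of 0 "[]"] Dv0[of 0] v0 by simp
    then show ?thesis
      unfolding ucoef_eq[abs_def] by (intro time_integral_measurable continuous_intros)
  qed
  have cm: "c is n \<in> borel_measurable borel" if "length is \<le> ?m" for "is" n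
    using c'm[OF that] um by (simp add: c_def)
  have vsq: "AE x in ?X. \<forall>j\<in>{..5}. sq_int (ivl T) (v j x)"
    by (subst AE_ball_countable) (use AE_slices_sq_int[OF X DmX D2, of _ "[]"] Dv0 in auto)
  \<comment> \<open>For given n only countably many cutoffs occur, so their exceptional sets can be
    united.\<close>
  have vweak: "AE x in ?X. \<forall>j\<in>{..<5}. \<forall>i. \<forall>m. (\<integral>t. v j x t * deriv (cutoff T (wpoly T ^ i * (pderiv ^^ (i+1)) (Qpoly T n)) m) t \<partial>ivl T)
      = - (\<integral>t. v (Suc j) x t * cutoff T (wpoly T ^ i * (pderiv ^^ (i+1)) (Qpoly T n)) m t \<partial>ivl T)" for n
    unfolding AE_all_countable[symmetric]
    using k by (subst AE_ball_countable) (auto simp: AE_all_countable intro!: weak_tderiv_cutoff[OF T o v(2) v(2)])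
  have ceq0: "AE x in ?X. ucoef T u n x = c' [] n x" for n
    using vsq vweak[of n]
  proof eventually_elim
    case (elim x)
    have "(\<integral>t. v 0 x t * (exp (- t) * poly (Qpoly T n) t) \<partial>ivl T) = (\<Sum>j\<le>5. \<integral>t. v j x t * coef_kernel T n j t \<partial>ivl T)"
      by (rule coefficient_representation[OF T]) (use elim in \<open>auto intro: sq_int_ivl_integrable\<close>)
    then show ?case by (simp add: ucoef_eq c'_def Dv0 v0)
  qed
  have ceq: "AE x in ?X. c is n x = c' is n x" for "is" n
    using ceq0 by (simp add: c_def)
  have cfin: "(\<Sum>n. ennreal ((real n + 1) ^ 10) * (\<integral>\<^sup>+ x. ennreal ((c is n x)\<^sup>2) \<partial>?X)) < \<infinity>" if "length is \<le> ?m" for "is"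
    by (rule kernel_coefficients_summable[OF T X DmX D2 measurable_dmn[OF cm] ceq[unfolded c'_def]]) (use that in auto)
  have cw: "weak_xderiv \<Omega> is (c [] n) (c is n)" if l: "length is \<le> ?m" for "is" n
  proof (rule weak_xderiv_cong_AE[OF o b])
    have "weak_xderiv \<Omega> is (\<lambda>x. \<Sum>j\<le>5. (\<integral>t. Dv j [] x t * coef_kernel T n j t \<partial>ivl T) * 1) (\<lambda>x. \<Sum>j\<le>5. (\<integral>t. Dv j is x t * coef_kernel T n j t \<partial>ivl T) * 1)"
    proof (rule weak_xderiv_sum[OF o])
      fix j :: nat assume "j \<in> {..5}"
      then have j: "j \<le> 5" by simp
      show "weak_xderiv \<Omega> is (\<lambda>x. \<integral>t. Dv j [] x t * coef_kernel T n j t \<partial>ivl T) (\<lambda>x. \<integral>t. Dv j is x t * coef_kernel T n j t \<partial>ivl T)"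
        by (rule weak_xderiv_time_integral[OF b o continuous_coef_kernel DmX[OF j] D2[OF j] DmX[OF j l] D2[OF j l]])
           (use Dw[OF j l] Dv0[OF j] in auto)
    qed
    then show "weak_xderiv \<Omega> is (c' [] n) (c' is n)" by (simp add: c'_def[abs_def])
  qed (use l in \<open>auto intro!: measurable_dmn c'm cm ceq\<close>)
  define S where "S N is x t = (\<Sum>n<N. c is n x * Psi2 T n t)" for N "is" x t
  \<comment> \<open>Total by convention of \<open>suminf\<close>; up to the order \<open>?m\<close>,
    at almost every t the series diverges only on a null set of x.\<close>
  define w where "w is x t = (\<Sum>n. c is n x * Psi2 T n t)" for "is" x t
  have S0: "S N [] = psum2 T u N" for N
    by (simp add: S_def psum2_def c_def fun_eq_iff)
  have cpm: "(\<lambda>z. c is n (fst z) * Psi2 T n (snd z)) \<in> borel_measurable (lborel \<Otimes>\<^sub>M lborel)" if "length is \<le> ?m" for "is" n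
    using measurable_compose[OF measurable_fst, of "c is n" lborel borel lborel] cm[OF that, of n]
      measurable_compose[OF measurable_snd, of "Psi2 T n" lborel borel lborel] Psi2_measurable[of T n]
    by (intro borel_measurable_times) auto
  have Sm: "(\<lambda>(x, t). S N is x t) \<in> borel_measurable (lborel \<Otimes>\<^sub>M lborel)" if "length is \<le> ?m" for N "is"
    unfolding S_def case_prod_beta' by (intro borel_measurable_sum cpm that)
  have wm: "(\<lambda>(x, t). w is x t) \<in> borel_measurable (lborel \<Otimes>\<^sub>M lborel)" if "length is \<le> ?m" for "is"
    unfolding w_def case_prod_beta' by (intro borel_measurable_suminf cpm that)
  have Sw: "weak_xderiv \<Omega> is (\<lambda>x. S N [] x t) (\<lambda>x. S N is x t)" if "length is \<le> ?m" for N "is" t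
    unfolding S_def by (rule weak_xderiv_sum[OF o cw[OF that]])
  have sl: "AE t in ivl T. (\<forall>N. sq_int ?X (\<lambda>x. S N is x t)) \<and> sq_int ?X (\<lambda>x. w is x t)
      \<and> (\<lambda>N. \<integral>\<^sup>+ x. ennreal ((S N is x t - w is x t)\<^sup>2) \<partial>?X) \<longlonglongrightarrow> 0" if l: "length is \<le> ?m" for "is"
    using series_Psi2_slices(2)[OF T measurable_dmn[OF cm[OF l]] cfin[OF l]]
    unfolding sq_int_iff_nn_integral[OF measurable_slice[OF Sm[OF l]]] sq_int_iff_nn_integral[OF measurable_slice[OF wm[OF l]]]
    unfolding S_def w_def .
  have l0: "length ([] :: 'd list) \<le> ?m" by simp
  \<comment> \<open>At almost every t both series converge in L2 over the domain, so the weak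
    derivative passes to the limit slice by slice.\<close>
  have ww: "AE t in ivl T. weak_xderiv \<Omega> is (\<lambda>x. w [] x t) (\<lambda>x. w is x t)" if l: "length is \<le> ?m" for "is"
    using sl[OF l0] sl[OF l]
  proof eventually_elim
    case (elim t)
    show ?case by (rule weak_xderiv_limit[OF o b Sw[OF l]]) (use elim in auto)
  qed
  have sqS: "sqL2 T \<Omega> (S N is) < \<infinity>" and sqw: "sqL2 T \<Omega> (w is) < \<infinity>"
    and sqlim: "(\<lambda>N. sqL2 T \<Omega> (\<lambda>x t. S N is x t - w is x t)) \<longlonglongrightarrow> 0" if l: "length is \<le> ?m" for N "is"
    unfolding sqL2_eq[OF o] S_def w_def
    by (rule series_Psi2_slices[OF T measurable_dmn[OF cm[OF l]] cfin[OF l]])+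
  have slS: "slob (sob_s p) T \<Omega> (S N is) < \<infinity>" (is "?A N") and slw: "slob (sob_s p) T \<Omega> (w is) < \<infinity>" (is ?B)
    and sllim: "(\<lambda>N. slob (sob_s p) T \<Omega> (\<lambda>x t. S N is x t - w is x t)) \<longlonglongrightarrow> 0" (is ?C)
    if l: "length is = ?m" and s: "sob_s p > 0" for N "is"
  proof -
    have l': "length is \<le> ?m" using l by simp
    let ?Z = "?X \<Otimes>\<^sub>M ?X" and ?a = "slob_weight (sob_s p)"
    have Z: "sigma_finite_measure ?Z" by (rule sigma_finite_pair_measure[OF X X])
    have finN: "(\<integral>\<^sup>+ t. \<integral>\<^sup>+ z. ennreal ((?a z * Dv j is (fst z) t - ?a z * Dv j is (snd z) t)\<^sup>2) \<partial>?Z \<partial>ivl T) < \<infinity>" if "j \<le> 5" for j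
      using slob_le_L2H_sq[OF l s, of T \<Omega> "Dv j"] Dsq[OF that] unfolding slob_eq[OF o b Dm[OF that l']]
      by (rule le_less_trans)
    note res = seminorm_series_convergence[of T ?X ?Z fst snd ?a ?a "\<lambda>j. Dv j is" "c is",
        OF T X Z measurable_fst measurable_snd AE_pair_fst[OF X] AE_pair_snd[OF X] slob_weight_measurable slob_weight_measurable
           DmX[OF _ l'] D2[OF _ l'] measurable_dmn[OF cm[OF l']] ceq[unfolded c'_def] finN]
    show "?A N" unfolding slob_eq[OF o b Sm[OF l']] unfolding S_def by (rule res(2))
    show ?B unfolding slob_eq[OF o b wm[OF l']] unfolding w_def by (rule res(3))
    have dm: "(\<lambda>(x, t). S N is x t - w is x t) \<in> borel_measurable (lborel \<Otimes>\<^sub>M lborel)" for N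
      using borel_measurable_diff[OF Sm[OF l', of N] wm[OF l']] by (simp add: case_prod_beta')
    show ?C unfolding slob_eq[OF o b dm] unfolding S_def w_def by (rule res(1))
  qed
  have famS: "L2H_fam T \<Omega> p (psum2 T u N) (S N)" for N
    unfolding L2H_fam_def using Sm Sw S0 by (auto intro!: AE_I2)
  have famw: "L2H_fam T \<Omega> p (w []) w"
    unfolding L2H_fam_def using wm ww by (auto simp: AE_ivl)
  have "L2H_sq T \<Omega> p (S N) < \<infinity>" for N
    unfolding L2H_sq_def using sqS slS by (auto simp: ennreal_sum_less_top finite_multiindices finite_multiindices_eq)
  moreover have "L2H_sq T \<Omega> p w < \<infinity>"
    unfolding L2H_sq_def using sqw slw by (auto simp: ennreal_sum_less_top finite_multiindices finite_multiindices_eq)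
  moreover have "(\<lambda>N. L2H_sq T \<Omega> p (\<lambda>is x t. S N is x t - w is x t)) \<longlonglongrightarrow> 0"
  proof -
    have 1: "(\<lambda>N. \<Sum>is\<in>{is. length is \<le> ?m}. sqL2 T \<Omega> (\<lambda>x t. S N is x t - w is x t)) \<longlonglongrightarrow> (\<Sum>is\<in>{is :: 'd list. length is \<le> ?m}. 0)"
      by (intro tendsto_sum sqlim) simp
    have 2: "(\<lambda>N. \<Sum>is\<in>{is. length is = ?m}. slob (sob_s p) T \<Omega> (\<lambda>x t. S N is x t - w is x t)) \<longlonglongrightarrow> (\<Sum>is\<in>{is :: 'd list. length is = ?m}. 0)"
      if "sob_s p > 0"
      by (intro tendsto_sum sllim that) simp
    show ?thesis
      using tendsto_add[OF 1 2] 1 by (cases "sob_s p > 0") (simp_all add: L2H_sq_def)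
  qed
  ultimately show ?thesis
    unfolding L2H_conv_def using famS famw by blast
qed

theorem theorem2p1:
  fixes T p :: real and \<Omega> :: "(real^'d::finite) set" and u :: "real^'d \<Rightarrow> real \<Rightarrow> real"
  assumes "T > 0" and "open \<Omega>" and "connected \<Omega>" and "bounded \<Omega>" and "smooth_boundary \<Omega>"
    and "p \<ge> 0" and "L2H T \<Omega> p u"
  shows "(\<forall>w. L2H_conv T \<Omega> p (psum2 T u) w \<longrightarrow> L2H T \<Omega> p w \<and> weak_tderiv T \<Omega> 2 u w)
       \<and> (\<forall>k::nat. k \<ge> 5 \<longrightarrow> HkH T \<Omega> p k u \<longrightarrow> (\<exists>w. L2H_conv T \<Omega> p (psum2 T u) w))"
  using weak_tderiv_series_sum[OF assms(1,2,4,7)] series_Psi2_converges[OF assms(1,2,4)] by blast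

end
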